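(* Let $H=\langle a_1,a_2,a_3\rangle$ be a numerical semigroup generated by three positive integers $a_1,a_2,a_3$ with $\gcd(a_1,a_2,a_3)=1$, let $k$ be a field and $R=k[[H]]$. Assume that $R$ is not a Gorenstein ring, let $\alpha,\beta,\gamma,\alpha',\beta',\gamma'>0$ be the integers attached to $(a_1,a_2,a_3)$ as in the context, and set $$a=a_2\beta'-a_1\alpha=a_3\gamma'-a_2\beta=a_1\alpha'-a_3\gamma .$$ Assume that $a>0$. Then the following conditions are equivalent: (1) $R$ is a GGL ring. (2) $3a\in H$. (3) $\alpha\le\alpha'$, $\beta\le\beta'$, and $\gamma\le\gamma'$. When this is the case, $\mathfrak c=(t^{\alpha a_1},t^{\beta a_2},t^{\gamma a_3})$ and $\ell_R(R/\mathfrak c)=\alpha\beta\gamma$, where $\mathfrak c=R:R[K]$.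
   Context: $H=\langle a_1,a_2,a_3\rangle=\{\sum c_ia_i\mid 0\le c_i\in\mathbb Z\}$ and $R=k[[H]]=k[[t^{a_1},t^{a_2},t^{a_3}]]\subseteq k[[t]]$, a one-dimensional Cohen-Macaulay local domain with maximal ideal $\mathfrak m$. Let $\varphi:k[X,Y,Z]\to k[t^{a_1},t^{a_2},t^{a_3}]$ be the $k$-algebra map with $X\mapsto t^{a_1}$, $Y\mapsto t^{a_2}$, $Z\mapsto t^{a_3}$. If $R$ is not Gorenstein, it is known (Herzog) that $$\operatorname{Ker}\varphi=I_2\begin{pmatrix}X^\alpha&Y^\beta&Z^\gamma\\ Y^{\beta'}&Z^{\gamma'}&X^{\alpha'}\end{pmatrix}$$ for some integers $\alpha,\beta,\gamma,\alpha',\beta',\gamma'>0$, where $I_2$ denotes the ideal of $2\times 2$ minors; these are the integers used in the claim. The three expressions defining $a$ agree and are nonzero; $a>0$ can always be achieved by permuting $a_2$ and $a_3$. Let $f=\max(\mathbb Z\setminus H)$, $\mathrm{PF}(H)=\{m\in\mathbb Z\setminus H\mid m+a_i\in H\ \forall i\}$, and $K=\sum_{c\in\mathrm{PF}(H)}Rt^{f-c}$, a fractional ideal isomorphic to the canonical module $K_R$ with $R\subseteq K\subseteq k[[t]]$ (here $K=R+Rt^a$). $R[K]$ is the subring generated by $K$ over $R$, and $R:R[K]=\{x\in Q(R)\mid xR[K]\subseteq R\}$. $\ell_R$ is length. A finitely generated $R$-module $C$ is an Ulrich $R$-module with respect to an $\mathfrak m$-primary ideal $\mathfrak a$ if $C$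 is nonzero Cohen-Macaulay, $e_{\mathfrak a}^0(C)=\ell_R(C/\mathfrak aC)$ (multiplicity with respect to $\mathfrak a$), and $C/\mathfrak aC$ is $R/\mathfrak a$-free. $R$ is a GGL ring if for some $\mathfrak m$-primary ideal $\mathfrak a$ there is an exact sequence $0\to R\to K_R\to C\to0$ of $R$-modules with $C$ an Ulrich $R$-module with respect to $\mathfrak a$ and $K_R/\mathfrak aK_R$ free over $R/\mathfrak a$. *)

theory Defs
  imports
    "HOL-Library.Extended_Real"
    "HOL-Computational_Algebra.Formal_Laurent_Series"
    "HOL-Algebra.QuotRing"
    "HOL-Algebra.Generated_Rings"
    "HOL-Algebra.Ring_Divisibility"
    "HOL-Algebra.Module"
begin

section \<open>Modules over a commutative ring\<close>

text \<open>
  In the module records built below the fields for multiplication and unit, which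
  \<^locale>\<open>module\<close> ignores, carry no meaning.
\<close>

definition mod_hom :: "('a, 'r) ring_scheme \<Rightarrow> ('a, 'b, 'm) module_scheme \<Rightarrow> ('a, 'c, 'n) module_scheme
    \<Rightarrow> ('b \<Rightarrow> 'c) set" where
  "mod_hom R M N = {h \<in> carrier M \<rightarrow> carrier N.
     (\<forall>x\<in>carrier M. \<forall>y\<in>carrier M. h (x \<oplus>\<^bsub>M\<^esub> y) = h x \<oplus>\<^bsub>N\<^esub> h y) \<and>
     (\<forall>r\<in>carrier R. \<forall>x\<in>carrier M. h (r \<odot>\<^bsub>M\<^esub> x) = r \<odot>\<^bsub>N\<^esub> h x)}"

definition self_module :: "('a, 'r) ring_scheme \<Rightarrow> ('a, 'a) module" where
  "self_module R = \<lparr>carrier = carrier R, mult = mult R, one = \<one>\<^bsub>R\<^esub>, zero = \<zero>\<^bsub>R\<^esub>, add = add R,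
     smult = mult R\<rparr>"

definition submod_span :: "('a, 'r) ring_scheme \<Rightarrow> ('a, 'b, 'm) module_scheme \<Rightarrow> 'b set \<Rightarrow> 'b set" where
  "submod_span R M S = \<Inter>{L. submodule L R M \<and> S \<subseteq> L}"

definition fin_gen :: "('a, 'r) ring_scheme \<Rightarrow> ('a, 'b, 'm) module_scheme \<Rightarrow> bool" where
  "fin_gen R M \<longleftrightarrow> (\<exists>S\<subseteq>carrier M. finite S \<and> submod_span R M S = carrier M)"

text \<open>The submodule \<open>I N\<close> of \<open>M\<close>, for an ideal \<open>I\<close> of \<open>R\<close> and a submodule \<open>N\<close> of \<open>M\<close>.\<close>

definition ideal_smult :: "('a, 'r) ring_scheme \<Rightarrow> ('a, 'b, 'm) module_scheme \<Rightarrow> 'a set \<Rightarrow> 'b set \<Rightarrow> 'b set" where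
  "ideal_smult R M I N = submod_span R M {r \<odot>\<^bsub>M\<^esub> x | r x. r \<in> I \<and> x \<in> N}"

text \<open>The submodule \<open>I\<^sup>n M\<close>, computed as \<open>I (I (\<dots> (I M)))\<close>.\<close>

definition ideal_pow_smult :: "('a, 'r) ring_scheme \<Rightarrow> ('a, 'b, 'm) module_scheme \<Rightarrow> 'a set \<Rightarrow> nat \<Rightarrow> 'b set" where
  "ideal_pow_smult R M I n = (ideal_smult R M I ^^ n) (carrier M)"

text \<open>\<open>M / N\<close> as an \<open>R\<close>-module.\<close>

definition quot_module :: "('a, 'b, 'm) module_scheme \<Rightarrow> 'b set \<Rightarrow> ('a, 'b set) module" where
  "quot_module M N = \<lparr>carrier = a_rcosets\<^bsub>M\<^esub> N, mult = undefined, one = undefined,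
     zero = N, add = set_add M, smult = (\<lambda>r A. \<Union>x\<in>A. N +>\<^bsub>M\<^esub> (r \<odot>\<^bsub>M\<^esub> x))\<rparr>"

text \<open>\<open>M / I M\<close> as a module over the quotient ring \<^term>\<open>R Quot I\<close>, whose elements are cosets of \<open>I\<close>.\<close>

definition mod_reduction :: "('a, 'r) ring_scheme \<Rightarrow> ('a, 'b, 'm) module_scheme \<Rightarrow> 'a set \<Rightarrow> ('a set, 'b set) module" where
  "mod_reduction R M I = (let N = ideal_smult R M I (carrier M) in
     \<lparr>carrier = a_rcosets\<^bsub>M\<^esub> N, mult = undefined, one = undefined,
      zero = N, add = set_add M, smult = (\<lambda>c A. \<Union>r\<in>c. \<Union>x\<in>A. N +>\<^bsub>M\<^esub> (r \<odot>\<^bsub>M\<^esub> x))\<rparr>)"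

definition free_module :: "('a, 'r) ring_scheme \<Rightarrow> ('a, 'b, 'm) module_scheme \<Rightarrow> bool" where
  "free_module R M \<longleftrightarrow> module R M \<and>
     (\<exists>B\<subseteq>carrier M. \<forall>x\<in>carrier M. \<exists>!c. c \<in> B \<rightarrow>\<^sub>E carrier R \<and>
        finite {b\<in>B. c b \<noteq> \<zero>\<^bsub>R\<^esub>} \<and> x = (\<Oplus>\<^bsub>M\<^esub>b\<in>{b\<in>B. c b \<noteq> \<zero>\<^bsub>R\<^esub>}. c b \<odot>\<^bsub>M\<^esub> b))"

definition mod_length :: "('a, 'r) ring_scheme \<Rightarrow> ('a, 'b, 'm) module_scheme \<Rightarrow> enat" where
  "mod_length R M = Sup {enat n | n. \<exists>N. (\<forall>i\<le>n. submodule (N i) R M) \<and> (\<forall>i<n. N i \<subset> N (Suc i))}"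

definition annihilator :: "('a, 'r) ring_scheme \<Rightarrow> ('a, 'b, 'm) module_scheme \<Rightarrow> 'a set" where
  "annihilator R M = {r \<in> carrier R. \<forall>x\<in>carrier M. r \<odot>\<^bsub>M\<^esub> x = \<zero>\<^bsub>M\<^esub>}"

text \<open>The Krull dimension of \<open>R / Ann M\<close> (of use for nonzero \<open>M\<close> only).\<close>

definition mod_dim :: "('a, 'r) ring_scheme \<Rightarrow> ('a, 'b, 'm) module_scheme \<Rightarrow> enat" where
  "mod_dim R M = Sup {enat n | n. \<exists>P. (\<forall>i\<le>n. primeideal (P i) R) \<and> (\<forall>i<n. P i \<subset> P (Suc i)) \<and>
     annihilator R M \<subseteq> P 0}"


section \<open>Local rings, Cohen--Macaulay and Ulrich modules\<close>

definition local_ring :: "('a, 'r) ring_scheme \<Rightarrow> bool" where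
  "local_ring R \<longleftrightarrow> cring R \<and> (\<exists>!m. maximalideal m R)"

definition max_ideal :: "('a, 'r) ring_scheme \<Rightarrow> 'a set" where
  "max_ideal R = (THE m. maximalideal m R)"

definition radical :: "('a, 'r) ring_scheme \<Rightarrow> 'a set \<Rightarrow> 'a set" where
  "radical R I = {x \<in> carrier R. \<exists>n::nat. x [^]\<^bsub>R\<^esub> n \<in> I}"

definition m_primary :: "('a, 'r) ring_scheme \<Rightarrow> 'a set \<Rightarrow> bool" where
  "m_primary R I \<longleftrightarrow> ideal I R \<and> I \<noteq> carrier R \<and>
     (\<forall>x\<in>carrier R. \<forall>y\<in>carrier R. x \<otimes>\<^bsub>R\<^esub> y \<in> I \<longrightarrow> x \<in> I \<or> y \<in> radical R I) \<and>
     radical R I = max_ideal R"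

definition regular_seq :: "('a, 'r) ring_scheme \<Rightarrow> ('a, 'b, 'm) module_scheme \<Rightarrow> 'a list \<Rightarrow> bool" where
  "regular_seq R M xs \<longleftrightarrow> set xs \<subseteq> carrier R \<and>
     (\<forall>i<length xs. let N = ideal_smult R M (Idl\<^bsub>R\<^esub> (set (take i xs))) (carrier M) in
        \<forall>x\<in>carrier M. (xs ! i) \<odot>\<^bsub>M\<^esub> x \<in> N \<longrightarrow> x \<in> N) \<and>
     ideal_smult R M (Idl\<^bsub>R\<^esub> (set xs)) (carrier M) \<noteq> carrier M"

definition depth :: "('a, 'r) ring_scheme \<Rightarrow> ('a, 'b, 'm) module_scheme \<Rightarrow> enat" where
  "depth R M = Sup {enat (length xs) | xs. set xs \<subseteq> max_ideal R \<and> regular_seq R M xs}"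

definition cohen_macaulay :: "('a, 'r) ring_scheme \<Rightarrow> ('a, 'b, 'm) module_scheme \<Rightarrow> bool" where
  "cohen_macaulay R M \<longleftrightarrow> module R M \<and> fin_gen R M \<and> depth R M = mod_dim R M"

text \<open>
  The multiplicity \<open>e\<^sup>0\<^sub>I(M)\<close>: with \<open>s = dim M\<close> (and not \<open>dim R\<close>), it is \<open>s!\<close> times the coefficient of
  \<open>n\<^sup>s\<close> in the polynomial that agrees with the length of \<open>M / I\<^sup>n\<^sup>+\<^sup>1 M\<close> for large \<open>n\<close>.
\<close>

definition multiplicity0 :: "('a, 'r) ring_scheme \<Rightarrow> 'a set \<Rightarrow> ('a, 'b, 'm) module_scheme \<Rightarrow> ereal" where
  "multiplicity0 R I M = (let s = the_enat (mod_dim R M) in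
     lim (\<lambda>n. ereal (fact s) * ereal_of_enat (mod_length R (quot_module M (ideal_pow_smult R M I (Suc n))))
              / ereal (real n ^ s)))"

definition ulrich :: "('a, 'r) ring_scheme \<Rightarrow> 'a set \<Rightarrow> ('a, 'b, 'm) module_scheme \<Rightarrow> bool" where
  "ulrich R I C \<longleftrightarrow> module R C \<and> fin_gen R C \<and> carrier C \<noteq> {\<zero>\<^bsub>C\<^esub>} \<and> cohen_macaulay R C \<and>
     multiplicity0 R I C = ereal_of_enat (mod_length R (quot_module C (ideal_smult R C I (carrier C)))) \<and>
     free_module (R Quot I) (mod_reduction R C I)"

definition short_exact :: "('a, 'r) ring_scheme \<Rightarrow> ('a, 'b, 'm) module_scheme \<Rightarrow> ('a, 'c, 'n) module_scheme
    \<Rightarrow> ('a, 'd, 'o) module_scheme \<Rightarrow> ('b \<Rightarrow> 'c) \<Rightarrow> ('c \<Rightarrow> 'd) \<Rightarrow> bool" where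
  "short_exact R L M N g h \<longleftrightarrow> module R L \<and> module R M \<and> module R N \<and>
     g \<in> mod_hom R L M \<and> h \<in> mod_hom R M N \<and>
     inj_on g (carrier L) \<and> g ` carrier L = {x \<in> carrier M. h x = \<zero>\<^bsub>N\<^esub>} \<and>
     h ` carrier M = carrier N"

text \<open>
  The second argument is the canonical module of \<open>R\<close>. The module \<open>C\<close> is isomorphic to the quotient of \<open>KR\<close>
  by the image of \<open>R\<close>, so letting it range over modules of sets of elements of \<open>KR\<close> is no restriction.
\<close>

definition ggl_ring :: "('a, 'r) ring_scheme \<Rightarrow> ('a, 'b, 'm) module_scheme \<Rightarrow> bool" where
  "ggl_ring R KR \<longleftrightarrow> local_ring R \<and>
     (\<exists>I. m_primary R I \<and>
        (\<exists>(C :: ('a, 'b set) module) g h. short_exact R (self_module R) KR C g h \<and> ulrich R I C) \<and>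
        free_module (R Quot I) (mod_reduction R KR I))"


section \<open>Gorenstein local rings\<close>

text \<open>
  By Baer's criterion it suffices to test injectivity on the inclusions of ideals into \<open>R\<close>, so the test
  modules may be taken over the type of elements of \<open>R\<close>.
\<close>

definition injective_module :: "('a, 'r) ring_scheme \<Rightarrow> ('a, 'e) module \<Rightarrow> bool" where
  "injective_module R E \<longleftrightarrow> module R E \<and>
     (\<forall>(M :: ('a, 'a) module) (N :: ('a, 'a) module) i g.
        module R M \<and> module R N \<and> i \<in> mod_hom R M N \<and> inj_on i (carrier M) \<and> g \<in> mod_hom R M E \<longrightarrow>
        (\<exists>h\<in>mod_hom R N E. \<forall>x\<in>carrier M. h (i x) = g x))"

definition finite_inj_dim :: "'e itself \<Rightarrow> ('a, 'r) ring_scheme \<Rightarrow> ('a, 'b, 'm) module_scheme \<Rightarrow> bool" where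
  "finite_inj_dim _ R M \<longleftrightarrow>
     (\<exists>(E :: nat \<Rightarrow> ('a, 'e) module) d \<epsilon> n.
        (\<forall>i. injective_module R (E i)) \<and> (\<forall>i>n. carrier (E i) = {\<zero>\<^bsub>E i\<^esub>}) \<and>
        \<epsilon> \<in> mod_hom R M (E 0) \<and> inj_on \<epsilon> (carrier M) \<and> (\<forall>i. d i \<in> mod_hom R (E i) (E (Suc i))) \<and>
        \<epsilon> ` carrier M = {x \<in> carrier (E 0). d 0 x = \<zero>\<^bsub>E (Suc 0)\<^esub>} \<and>
        (\<forall>i. d i ` carrier (E i) = {x \<in> carrier (E (Suc i)). d (Suc i) x = \<zero>\<^bsub>E (Suc (Suc i))\<^esub>}))"

text \<open>
  Self-injective dimension is finite. The type argument is the type of the elements of the modules in the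
  resolution. For a one-dimensional local subring \<open>R\<close> of \<open>k((t))\<close> with fraction field \<open>Q\<close>, the type
  of sets of Laurent series is large enough: if \<open>R\<close> is Gorenstein, its minimal injective resolution is
  \<open>0 \<rightarrow> R \<rightarrow> Q \<rightarrow> Q / R \<rightarrow> 0\<close>.
\<close>

definition gorenstein_local :: "'e itself \<Rightarrow> ('a, 'r) ring_scheme \<Rightarrow> bool" where
  "gorenstein_local T R \<longleftrightarrow> local_ring R \<and> noetherian_ring R \<and> finite_inj_dim T R (self_module R)"


section \<open>Numerical semigroups with three generators and their rings\<close>

definition num_semigroup :: "nat \<Rightarrow> nat \<Rightarrow> nat \<Rightarrow> int set" where
  "num_semigroup a1 a2 a3 = {int (c1 * a1 + c2 * a2 + c3 * a3) | c1 c2 c3. True}"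

definition frobenius_number :: "int set \<Rightarrow> int" where
  "frobenius_number H = (GREATEST x. x \<notin> H)"

definition pseudo_frobenius :: "nat \<Rightarrow> nat \<Rightarrow> nat \<Rightarrow> int set" where
  "pseudo_frobenius a1 a2 a3 = (let H = num_semigroup a1 a2 a3 in
     {m. m \<notin> H \<and> m + int a1 \<in> H \<and> m + int a2 \<in> H \<and> m + int a3 \<in> H})"

definition fls_ring :: "'k::field fls ring" where
  "fls_ring = \<lparr>carrier = UNIV, mult = (*), one = 1, zero = 0, add = (+)\<rparr>"

abbreviation tpow :: "int \<Rightarrow> 'k::field fls" where
  "tpow n \<equiv> fls_X_intpow n"

text \<open>The ring \<open>k[[H]]\<close>, as a subring of \<open>k((t))\<close>: the series all of whose exponents lie in \<open>H\<close>.\<close>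

definition semigroup_ring :: "int set \<Rightarrow> 'k::field fls ring" where
  "semigroup_ring H = fls_ring\<lparr>carrier := {F. \<forall>n. fls_nth F n \<noteq> 0 \<longrightarrow> n \<in> H}\<rparr>"

definition fraction_set :: "'k::field fls ring \<Rightarrow> 'k fls set" where
  "fraction_set R = {x / y | x y. x \<in> carrier R \<and> y \<in> carrier R \<and> y \<noteq> 0}"

text \<open>The colon \<open>R : S\<close> in the fraction field of \<open>R\<close>.\<close>

definition colon :: "'k::field fls ring \<Rightarrow> 'k fls set \<Rightarrow> 'k fls set" where
  "colon R S = {x \<in> fraction_set R. \<forall>y\<in>S. x * y \<in> carrier R}"

text \<open>An \<open>R\<close>-submodule of \<open>k((t))\<close> as a module record.\<close>

definition fls_module :: "'k::field fls set \<Rightarrow> ('k fls, 'k fls) module" where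
  "fls_module S = \<lparr>carrier = S, mult = (*), one = 1, zero = 0, add = (+), smult = (*)\<rparr>"

text \<open>
  The fractional ideal \<open>K = \<Sum> R t\<^sup>f\<^sup>-\<^sup>c\<close>, the sum ranging over the pseudo-Frobenius numbers \<open>c\<close>, with
  \<open>R \<subseteq> K \<subseteq> k[[t]]\<close>. As an \<open>R\<close>-module it is the canonical module of \<open>R = k[[H]]\<close>.
\<close>

definition canonical_ideal :: "nat \<Rightarrow> nat \<Rightarrow> nat \<Rightarrow> 'k::field fls set" where
  "canonical_ideal a1 a2 a3 = (let H = num_semigroup a1 a2 a3; P = pseudo_frobenius a1 a2 a3 in
     {\<Sum>c\<in>P. r c * tpow (frobenius_number H - c) | r. \<forall>c\<in>P. r c \<in> carrier (semigroup_ring H)})"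

text \<open>The subring \<open>R[K]\<close> of \<open>k((t))\<close>.\<close>

definition ring_adjoin :: "'k::field fls ring \<Rightarrow> 'k fls set \<Rightarrow> 'k fls set" where
  "ring_adjoin R K = generate_ring fls_ring (carrier R \<union> K)"


section \<open>The defining ideal\<close>

text \<open>\<open>k[X,Y,Z]\<close> is the iterated polynomial ring \<open>k[X][Y][Z]\<close>.\<close>

definition varX :: "'k::field poly poly poly" where "varX = [:[:[:0, 1:]:]:]"
definition varY :: "'k::field poly poly poly" where "varY = [:[:0, 1:]:]"
definition varZ :: "'k::field poly poly poly" where "varZ = [:0, 1:]"

text \<open>The \<open>k\<close>-algebra map \<open>k[X,Y,Z] \<rightarrow> k[t]\<close> with \<open>X \<mapsto> t\<^sup>a\<^sup>1\<close>, \<open>Y \<mapsto> t\<^sup>a\<^sup>2\<close>, \<open>Z \<mapsto> t\<^sup>a\<^sup>3\<close>.\<close>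

definition toric_map :: "nat \<Rightarrow> nat \<Rightarrow> nat \<Rightarrow> 'k::field poly poly poly \<Rightarrow> 'k poly" where
  "toric_map a1 a2 a3 F =
     poly (map_poly (\<lambda>q. poly (map_poly (\<lambda>p. pcompose p (Polynomial.monom 1 a1)) q)
                              (Polynomial.monom 1 a2)) F)
          (Polynomial.monom 1 a3)"

text \<open>The ideal of \<open>2 \<times> 2\<close> minors of the matrix with rows \<open>p1, p2, p3\<close> and \<open>q1, q2, q3\<close>.\<close>

definition minors_ideal :: "'r::comm_ring_1 \<Rightarrow> 'r \<Rightarrow> 'r \<Rightarrow> 'r \<Rightarrow> 'r \<Rightarrow> 'r \<Rightarrow> 'r set" where
  "minors_ideal p1 p2 p3 q1 q2 q3 =
     {u * (p1 * q2 - p2 * q1) + v * (p1 * q3 - p3 * q1) + w * (p2 * q3 - p3 * q2) | u v w. True}"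

end

theory Submission
  imports Defs
begin

text \<open>
  Everything about \<open>R = k[[H]]\<close> that the theorem needs can be decided on exponents. Let \<open>L\<close> be the
  lattice of integer vectors orthogonal to \<open>(a\<^sub>1, a\<^sub>2, a\<^sub>3)\<close>. The ideal of minors is generated by three
  binomials, so a linear functional that adds up the coefficients over a class of exponent vectors
  modulo the exponent differences of these binomials vanishes on it; since the binomial of any relation
  lies in the kernel, the three differences generate \<open>L\<close> (\<open>herzog_relations_from_kernel\<close>). They add up
  to zero, and a relation becomes a triple \<open>(p, q, r)\<close> up to a common summand. Each question about \<open>H\<close> is
  now a comparison of signs in three cyclically symmetric linear forms.

  Write \<open>a\<close> for the shift between the two rows of the matrix: \<open>a + \<alpha>a\<^sub>1 = \<beta>'a\<^sub>2\<close>, \<open>a + \<beta>a\<^sub>2 = \<gamma>'a\<^sub>3\<close>,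
  \<open>a + \<gamma>a\<^sub>3 = \<alpha>'a\<^sub>1\<close>. Adding these gives \<open>3a = (\<alpha>' - \<alpha>)a\<^sub>1 + (\<beta>' - \<beta>)a\<^sub>2 + (\<gamma>' - \<gamma>)a\<^sub>3\<close>, and no other
  expression of \<open>3a\<close> can have nonnegative coefficients. So \<open>3a \<in> H\<close> exactly if \<open>\<alpha> \<le> \<alpha>'\<close>, \<open>\<beta> \<le> \<beta>'\<close> and
  \<open>\<gamma> \<le> \<gamma>'\<close> (\<open>three_shift_iff\<close>). A duality between \<open>H\<close> and its complement (\<open>duality\<close>) finds the two
  pseudo-Frobenius numbers, which differ by \<open>a\<close>, so \<open>K = R + Rt\<^sup>a\<close>. The exponents \<open>h\<close> of \<open>H\<close> with \<open>h + a\<close> in \<open>H\<close> are exactly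
  those in the ideal of \<open>H\<close> generated by the first row (\<open>conductor_set_eq\<close>), and the exponents outside
  form a box with \<open>\<alpha>\<beta>\<gamma>\<close> elements (\<open>box_bij\<close>).

  If the inequalities hold, the monomial ideal \<open>\<cc>\<close> of the first row is stable under \<open>t\<^sup>a\<close>.
  Hence \<open>\<cc>K = \<cc>\<close>, \<open>\<cc>\<close> is the conductor \<open>R : R[K]\<close>, \<open>K / \<cc>K\<close> is free on \<open>1, t\<^sup>a\<close>, and \<open>K / R\<close> is killed by \<open>\<cc>\<close> and free on \<open>t\<^sup>a\<close>
  over \<open>R / \<cc>\<close>; so \<open>0 \<rightarrow> R \<rightarrow> K \<rightarrow> K / R \<rightarrow> 0\<close> shows that \<open>R\<close> is GGL (\<open>three_shift_imp_ggl\<close>).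

  Conversely let \<open>0 \<rightarrow> R \<rightarrow> K \<rightarrow> C \<rightarrow> 0\<close> and \<open>I\<close> witness the GGL property, and let \<open>w\<close> be the image of \<open>1\<close>.
  The module \<open>C = K / Rw\<close> has finite length, so the multiplicity is its length and the Ulrich condition
  forces \<open>IC = 0\<close> (\<open>ulrich_quotient_killed\<close>). Freeness of \<open>C\<close> makes \<open>w\<close> a minimal generator of \<open>K\<close>
  (\<open>minimal_generator\<close>), and freeness of \<open>K / IK\<close> then makes \<open>r \<in> I\<close> equivalent to \<open>rw \<in> IK\<close>. For a column
  \<open>(t\<^sup>p, t\<^sup>q)\<close> of the matrix and \<open>w = x + yt\<^sup>a\<close>, the element \<open>r = xt\<^sup>p + yt\<^sup>q\<close> satisfies \<open>r \<cdot> 1 = t\<^sup>pw\<close> and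
  \<open>rt\<^sup>a = t\<^sup>qw\<close>. So \<open>rK \<subseteq> Rw\<close>, whence \<open>r \<in> I\<close>, whence \<open>t\<^sup>p\<close> and \<open>t\<^sup>q\<close> lie in \<open>I\<close>, and \<open>IK \<subseteq> Rw\<close> puts
  \<open>t\<^sup>p\<close> and \<open>t\<^sup>q \<cdot> t\<^sup>a\<close> into \<open>Rw\<close>. Comparing orders, the first forces that \<open>w\<close> has order \<open>0\<close> and the second
  that \<open>\<beta>'a\<^sub>2\<close>, \<open>\<gamma>'a\<^sub>3\<close> and \<open>\<alpha>'a\<^sub>1\<close> stay in \<open>H\<close> after adding \<open>a\<close>. These are thus in the ideal of the
  first row, which amounts to the inequalities (\<open>ggl_imp_three_shift\<close>).
\<close>

section \<open>The relation lattice of three positive integers\<close>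

lemma mult_le_neg: "0 < A \<Longrightarrow> x < 0 \<Longrightarrow> A * x \<le> - A" for A x :: int
  using mult_left_mono[of x "-1" A] by simp

lemma mult_le_nonpos: "0 < A \<Longrightarrow> x \<le> 0 \<Longrightarrow> A * x \<le> 0" for A x :: int
  by (simp add: mult_le_0_iff)

text \<open>
  The exponents of a \<open>2 \<times> 3\<close> matrix of powers whose minors define the monomial curve. The three vectors
  multiplied by \<open>p\<close>, \<open>q\<close> and \<open>r\<close> are the exponent differences of the minors. They add up to
  zero; listing all three keeps the setting invariant under cyclic permutation.
\<close>

locale herzog_relations =
  fixes a1 a2 a3 \<alpha> \<beta> \<gamma> \<alpha>' \<beta>' \<gamma>' :: int
  assumes a_pos: "0 < a1" "0 < a2" "0 < a3"
    and exp_pos: "0 < \<alpha>" "0 < \<beta>" "0 < \<gamma>" "0 < \<alpha>'" "0 < \<beta>'" "0 < \<gamma>'"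
    and rel_Y: "(\<beta> + \<beta>') * a2 = \<alpha> * a1 + \<gamma>' * a3"
    and rel_X: "(\<alpha> + \<alpha>') * a1 = \<beta>' * a2 + \<gamma> * a3"
    and rel_Z: "(\<gamma> + \<gamma>') * a3 = \<alpha>' * a1 + \<beta> * a2"
    and lattice: "\<And>x y z. x * a1 + y * a2 + z * a3 = 0 \<Longrightarrow>
      \<exists>p q r. x = \<alpha> * (p - r) + \<alpha>' * (q - r) \<and> y = \<beta> * (q - p) + \<beta>' * (r - p) \<and>
        z = \<gamma> * (r - q) + \<gamma>' * (p - q)"
begin

definition H :: "int set" where
  "H = {x * a1 + y * a2 + z * a3 | x y z. 0 \<le> x \<and> 0 \<le> y \<and> 0 \<le> z}"

text \<open>
  The number \<open>a\<close>: multiplication by \<open>t\<^sup>a\<close> takes the first row of the matrix to the second.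
\<close>

definition shift :: int where "shift = \<beta>' * a2 - \<alpha> * a1"

lemma shift_eqs: "shift = \<gamma>' * a3 - \<beta> * a2" "shift = \<alpha>' * a1 - \<gamma> * a3"
  using rel_Y rel_X by (auto simp: shift_def algebra_simps)

text \<open>
  One argument in the \<open>X\<close>-direction thereby serves all three directions.
\<close>

lemma rotated: "herzog_relations a2 a3 a1 \<beta> \<gamma> \<alpha> \<beta>' \<gamma>' \<alpha>'"
proof
  fix x y z assume "x * a2 + y * a3 + z * a1 = 0"
  then have "z * a1 + x * a2 + y * a3 = 0" by simp
  from lattice[OF this]
  show "\<exists>p q r. x = \<beta> * (p - r) + \<beta>' * (q - r) \<and> y = \<gamma> * (q - p) + \<gamma>' * (r - p) \<and>
      z = \<alpha> * (r - q) + \<alpha>' * (p - q)"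
    by metis
qed (use a_pos exp_pos rel_X rel_Y rel_Z in auto)

text \<open>
  Each coordinate of the second representation excludes one sign pattern of \<open>p - r\<close>, \<open>q - p\<close>, \<open>r - q\<close>:
  a strict wrong sign costs at least \<open>\<alpha>\<close> (or \<open>\<beta>\<close>, \<open>\<gamma>\<close>), more than the box allows. The three implications
  chase each other around, which leaves only \<open>p = q = r\<close>. The next lemmas follow the same scheme.
\<close>

lemma unique_box:
  assumes "x < \<alpha>" "y < \<beta>" "z < \<gamma>" "0 \<le> x'" "0 \<le> y'" "0 \<le> z'"
    and "x * a1 + y * a2 + z * a3 = x' * a1 + y' * a2 + z' * a3"
  shows "x' = x \<and> y' = y \<and> z' = z"
proof -
  have "(x' - x) * a1 + (y' - y) * a2 + (z' - z) * a3 = 0"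
    using assms by (simp add: algebra_simps)
  from lattice[OF this] obtain p q r where e: "x' - x = \<alpha> * (p - r) + \<alpha>' * (q - r)" "y' - y = \<beta> * (q - p) + \<beta>' * (r - p)"
    "z' - z = \<gamma> * (r - q) + \<gamma>' * (p - q)"
    by blast
  have x: "q \<le> r \<Longrightarrow> r \<le> p"
    using e(1) assms mult_le_neg[of \<alpha> "p - r"] mult_le_nonpos[of \<alpha>' "q - r"] exp_pos by linarith
  have y: "r \<le> p \<Longrightarrow> p \<le> q"
    using e(2) assms mult_le_neg[of \<beta> "q - p"] mult_le_nonpos[of \<beta>' "r - p"] exp_pos by linarith
  have z: "p \<le> q \<Longrightarrow> q \<le> r"
    using e(3) assms mult_le_neg[of \<gamma> "r - q"] mult_le_nonpos[of \<gamma>' "p - q"] exp_pos by linarith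
  have "p = q \<and> q = r" using x y z by linarith
  then show ?thesis using e by simp
qed

lemma unique_alpha:
  assumes "0 \<le> x" "0 \<le> y" "0 \<le> z" "\<alpha> * a1 = x * a1 + y * a2 + z * a3"
  shows "x = \<alpha> \<and> y = 0 \<and> z = 0"
proof -
  have "(x - \<alpha>) * a1 + (y) * a2 + (z) * a3 = 0"
    using assms by (simp add: algebra_simps)
  from lattice[OF this] obtain p q r where e: "x - \<alpha> = \<alpha> * (p - r) + \<alpha>' * (q - r)" "y = \<beta> * (q - p) + \<beta>' * (r - p)"
    "z = \<gamma> * (r - q) + \<gamma>' * (p - q)"
    by blast
  have y: "r \<le> p \<Longrightarrow> p \<le> q"
    using e(2) assms mult_le_neg[of \<beta> "q - p"] mult_le_nonpos[of \<beta>' "r - p"] exp_pos by linarith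
  have z: "p \<le> q \<Longrightarrow> q \<le> r"
    using e(3) assms mult_le_neg[of \<gamma> "r - q"] mult_le_nonpos[of \<gamma>' "p - q"] exp_pos by linarith
  have z': "p < q \<Longrightarrow> q < r"
    using e(3) assms mult_le_nonpos[of \<gamma> "r - q"] mult_le_neg[of \<gamma>' "p - q"] exp_pos by linarith
  have x: "p \<ge> r" if "q < r"
    using e(1) assms mult_le_neg[of \<alpha> "p - r"] mult_le_neg[of \<alpha>' "q - r"] exp_pos that by linarith
  have "p = q \<and> q = r" using x y z z' by linarith
  then show ?thesis using e by simp
qed

text \<open>
  The monomials multiplied into \<open>R\<close> by \<open>t\<^sup>a\<close> are those in the ideal of the first row. The shift is
  written as \<open>\<beta>'a\<^sub>2 - \<alpha>a\<^sub>1\<close>, which moves the inequality \<open>r \<le> p\<close> of the previous argument to \<open>r + 1 \<le> p\<close>.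
\<close>

lemma shift_into_semigroup:
  assumes "0 \<le> x" "0 \<le> y" "0 \<le> z" "0 \<le> x'" "0 \<le> y'" "0 \<le> z'"
    and "shift + (x * a1 + y * a2 + z * a3) = x' * a1 + y' * a2 + z' * a3"
  shows "\<alpha> \<le> x \<or> \<beta> \<le> y \<or> \<gamma> \<le> z"
proof (rule ccontr)
  assume "\<not> ?thesis"
  then have lt: "x < \<alpha>" "y < \<beta>" "z < \<gamma>" by auto
  have "(x' - x + \<alpha>) * a1 + (y' - y - \<beta>') * a2 + (z' - z) * a3 = 0"
    using assms by (simp add: algebra_simps shift_def)
  from lattice[OF this] obtain p q r where e: "x' - x + \<alpha> = \<alpha> * (p - r) + \<alpha>' * (q - r)"
    "y' - y - \<beta>' = \<beta> * (q - p) + \<beta>' * (r - p)" "z' - z = \<gamma> * (r - q) + \<gamma>' * (p - q)"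
    by blast
  have x: "q \<le> r \<Longrightarrow> r + 1 \<le> p"
    using e(1) assms lt mult_le_nonpos[of \<alpha> "p - r"] mult_le_nonpos[of \<alpha>' "q - r"] exp_pos by linarith
  have y: "r + 1 \<le> p \<Longrightarrow> p \<le> q"
    using e(2) assms lt mult_le_neg[of \<beta> "q - p"] mult_le_neg[of \<beta>' "r - p"] exp_pos by linarith
  have z: "p \<le> q \<Longrightarrow> q \<le> r"
    using e(3) assms lt mult_le_neg[of \<gamma> "r - q"] mult_le_nonpos[of \<gamma>' "p - q"] exp_pos by linarith
  show False using x y z by linarith
qed

lemma alpha_minus_shift:
  assumes "0 \<le> x" "0 \<le> y" "0 \<le> z" and "\<alpha> * a1 - shift = x * a1 + y * a2 + z * a3"
  shows "\<alpha>' \<le> \<alpha>"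
proof (rule ccontr)
  assume n: "\<not> ?thesis"
  have "(x - \<alpha> + \<alpha>') * a1 + (y) * a2 + (z - \<gamma>) * a3 = 0"
    using assms by (simp add: algebra_simps shift_eqs(2))
  from lattice[OF this] obtain p q r where e: "x - \<alpha> + \<alpha>' = \<alpha> * (p - r) + \<alpha>' * (q - r)"
    "y = \<beta> * (q - p) + \<beta>' * (r - p)" "z - \<gamma> = \<gamma> * (r - q) + \<gamma>' * (p - q)"
    by blast
  have y: "r \<le> p \<Longrightarrow> p \<le> q"
    using e(2) assms mult_le_neg[of \<beta> "q - p"] mult_le_nonpos[of \<beta>' "r - p"] exp_pos by linarith
  have y': "r < p \<Longrightarrow> p < q"
    using e(2) assms mult_le_nonpos[of \<beta> "q - p"] mult_le_neg[of \<beta>' "r - p"] exp_pos by linarith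
  have z: "p < q \<Longrightarrow> q \<le> r"
    using e(3) assms mult_le_neg[of \<gamma> "r - q"] mult_le_neg[of \<gamma>' "p - q"] exp_pos by linarith
  have x: "q \<le> r - 1 \<Longrightarrow> p \<ge> r + 1"
    using e(1) assms n mult_le_nonpos[of \<alpha> "p - r"] mult_le_neg[of \<alpha>' "q - r"] exp_pos by linarith
  have x': "q = r \<Longrightarrow> p \<ge> r"
    using e(1) assms n mult_le_neg[of \<alpha> "p - r"] mult_le_nonpos[of \<alpha>' "q - r"] exp_pos by linarith
  have "p = q \<and> q = r" using x x' y y' z by linarith
  then show False using e assms n by simp
qed

text \<open>
  The obvious representation of \<open>3a\<close> corresponds to \<open>p = q = r\<close>. Here \<open>r\<close> is a maximum of the three; the
  other cases arise by rotation.
\<close>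

lemma three_shift_aux:
  assumes "0 \<le> x" "0 \<le> y" "0 \<le> z"
    and e: "x - \<alpha>' + \<alpha> = \<alpha> * (p - r) + \<alpha>' * (q - r)"
    "y - \<beta>' + \<beta> = \<beta> * (q - p) + \<beta>' * (r - p)" "z - \<gamma>' + \<gamma> = \<gamma> * (r - q) + \<gamma>' * (p - q)"
    and m: "p \<le> r" "q \<le> r"
  shows "p = q \<and> q = r"
proof -
  have x: "q < r \<Longrightarrow> p > r"
    using e(1) assms mult_le_nonpos[of \<alpha> "p - r"] mult_le_neg[of \<alpha>' "q - r"] exp_pos by linarith
  have z: "q = r \<Longrightarrow> p \<ge> q"
    using e(3) assms mult_le_neg[of \<gamma>' "p - q"] mult_le_nonpos[of \<gamma> "r - q"] exp_pos by linarith
  show ?thesis using x z m by linarith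
qed

end

context herzog_relations begin

interpretation rot: herzog_relations a2 a3 a1 \<beta> \<gamma> \<alpha> \<beta>' \<gamma>' \<alpha>' by (rule rotated)
interpretation rot2: herzog_relations a3 a1 a2 \<gamma> \<alpha> \<beta> \<gamma>' \<alpha>' \<beta>' by (rule rot.rotated)

lemma three_shift_iff:
  "3 * shift \<in> H \<longleftrightarrow> \<alpha> \<le> \<alpha>' \<and> \<beta> \<le> \<beta>' \<and> \<gamma> \<le> \<gamma>'"
proof
  assume "3 * shift \<in> H"
  then obtain x y z where xyz: "0 \<le> x" "0 \<le> y" "0 \<le> z" "3 * shift = x * a1 + y * a2 + z * a3"
    by (auto simp: H_def)
  have "3 * shift = (\<alpha>' - \<alpha>) * a1 + (\<beta>' - \<beta>) * a2 + (\<gamma>' - \<gamma>) * a3"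
    using shift_eqs by (simp add: shift_def algebra_simps)
  then have "(x - \<alpha>' + \<alpha>) * a1 + (y - \<beta>' + \<beta>) * a2 + (z - \<gamma>' + \<gamma>) * a3 = 0"
    using xyz by (simp add: algebra_simps)
  from lattice[OF this] obtain p q r where e: "x - \<alpha>' + \<alpha> = \<alpha> * (p - r) + \<alpha>' * (q - r)"
    "y - \<beta>' + \<beta> = \<beta> * (q - p) + \<beta>' * (r - p)" "z - \<gamma>' + \<gamma> = \<gamma> * (r - q) + \<gamma>' * (p - q)"
    by blast
  have "p = q \<and> q = r"
  proof -
    consider "p \<le> r \<and> q \<le> r" | "q \<le> p \<and> r \<le> p" | "p \<le> q \<and> r \<le> q" by linarith
    then show ?thesis
    proof cases
      case 1 then show ?thesis using three_shift_aux[OF xyz(1-3) e] by blast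
    next
      case 2 then show ?thesis using rot.three_shift_aux[OF xyz(2,3,1) e(2,3,1)] by blast
    next
      case 3 then show ?thesis using rot2.three_shift_aux[OF xyz(3,1,2) e(3,1,2)] by blast
    qed
  qed
  then show "\<alpha> \<le> \<alpha>' \<and> \<beta> \<le> \<beta>' \<and> \<gamma> \<le> \<gamma>'" using e xyz by simp
next
  assume "\<alpha> \<le> \<alpha>' \<and> \<beta> \<le> \<beta>' \<and> \<gamma> \<le> \<gamma>'"
  moreover have "3 * shift = (\<alpha>' - \<alpha>) * a1 + (\<beta>' - \<beta>) * a2 + (\<gamma>' - \<gamma>) * a3"
    using shift_eqs by (simp add: shift_def algebra_simps)
  ultimately show "3 * shift \<in> H"
    unfolding H_def by force
qed

end


locale herzog_semigroup = herzog_relations +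
  assumes bezout: "\<exists>x y z. x * a1 + y * a2 + z * a3 = 1"
    and shift_pos: "0 < shift"
begin

text \<open>
  Modulo \<open>X\<close> the ideal becomes \<open>(Y\<^sup>\<beta>\<^sup>+\<^sup>\<beta>\<^sup>', Y\<^sup>\<beta>\<^sup>'Z\<^sup>\<gamma>, Z\<^sup>\<gamma>\<^sup>+\<^sup>\<gamma>\<^sup>')\<close>. The two corners of this staircase, lowered by
  \<open>a\<^sub>1\<close>, are the pseudo-Frobenius numbers.
\<close>

definition pf1 :: int where "pf1 = (\<beta> + \<beta>' - 1) * a2 + (\<gamma> - 1) * a3 - a1"
definition pf2 :: int where "pf2 = (\<beta>' - 1) * a2 + (\<gamma> + \<gamma>' - 1) * a3 - a1"

lemma pf2_eq: "pf2 = pf1 + shift"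
  by (simp add: pf1_def pf2_def shift_eqs(1) algebra_simps)

lemma semigroup_nonneg: "h \<in> H \<Longrightarrow> 0 \<le> h"
  using a_pos by (auto simp: H_def)

lemma semigroup_add: "g \<in> H \<Longrightarrow> h \<in> H \<Longrightarrow> g + h \<in> H"
proof -
  assume "g \<in> H" "h \<in> H"
  then obtain x y z x' y' z' where "0 \<le> x" "0 \<le> y" "0 \<le> z" "0 \<le> x'" "0 \<le> y'" "0 \<le> z'"
    "g = x * a1 + y * a2 + z * a3" "h = x' * a1 + y' * a2 + z' * a3"
    by (auto simp: H_def)
  then have "g + h = (x + x') * a1 + (y + y') * a2 + (z + z') * a3" "0 \<le> x + x'" "0 \<le> y + y'" "0 \<le> z + z'"
    by (auto simp: algebra_simps)
  then show ?thesis unfolding H_def by blast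
qed

lemma semigroupI: "0 \<le> x \<Longrightarrow> 0 \<le> y \<Longrightarrow> 0 \<le> z \<Longrightarrow> x * a1 + y * a2 + z * a3 \<in> H"
  by (auto simp: H_def)

lemma semigroup_zero [simp]: "0 \<in> H"
  using semigroupI[of 0 0 0] by simp

lemma gens_in_semigroup:
  "0 \<le> n \<Longrightarrow> n * a1 \<in> H" "0 \<le> n \<Longrightarrow> n * a2 \<in> H" "0 \<le> n \<Longrightarrow> n * a3 \<in> H"
  using semigroupI[of n 0 0] semigroupI[of 0 n 0] semigroupI[of 0 0 n] by auto

text \<open>
  The minors replace \<open>Y\<^sup>\<beta>\<^sup>+\<^sup>\<beta>\<^sup>'\<close>, \<open>Y\<^sup>\<beta>\<^sup>'Z\<^sup>\<gamma>\<close> and \<open>Z\<^sup>\<gamma>\<^sup>+\<^sup>\<gamma>\<^sup>'\<close> by monomials divisible by \<open>X\<close>, which lowers the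
  contribution of \<open>Y\<close> and \<open>Z\<close>. A representation that minimizes this contribution therefore has its
  \<open>(y, z)\<close> below the staircase. The coefficient \<open>x\<close> may be negative.
\<close>

lemma apery_representation:
  obtains x y z where "m = x * a1 + y * a2 + z * a3" "0 \<le> y" "0 \<le> z"
    "y < \<beta> + \<beta>' \<and> z < \<gamma> \<or> y < \<beta>' \<and> z < \<gamma> + \<gamma>'"
proof -
  define P where "P = (\<lambda>(x, y, z). m = x * a1 + y * a2 + z * a3 \<and> 0 \<le> y \<and> 0 \<le> z)"
  define \<mu> where "\<mu> = (\<lambda>(x :: int, y, z). nat (y * a2 + z * a3))"
  obtain u v w where 1: "u * a1 + v * a2 + w * a3 = 1" using bezout by blast
  \<comment> \<open>Bezout coefficients, with multiples of \<open>a\<^sub>1\<close> traded in to make those of \<open>a\<^sub>2\<close> and \<open>a\<^sub>3\<close> nonnegative.\<close>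
  define y z where "y = m * v + \<bar>m * v\<bar> * a1" and "z = m * w + \<bar>m * w\<bar> * a1"
  have "\<bar>m * v\<bar> * 1 \<le> \<bar>m * v\<bar> * a1" "\<bar>m * w\<bar> * 1 \<le> \<bar>m * w\<bar> * a1"
    using a_pos by (intro mult_left_mono; simp)+
  then have "0 \<le> y" "0 \<le> z" by (auto simp: y_def z_def)
  moreover have "m = (m * u - \<bar>m * v\<bar> * a2 - \<bar>m * w\<bar> * a3) * a1 + y * a2 + z * a3"
  proof -
    have "m = m * (u * a1 + v * a2 + w * a3)" using 1 by simp
    then show ?thesis by (simp add: y_def z_def algebra_simps)
  qed
  ultimately have "P (m * u - \<bar>m * v\<bar> * a2 - \<bar>m * w\<bar> * a3, y, z)" by (simp add: P_def)
  from ex_has_least_nat[of P, OF this, of \<mu>] obtain t where t: "P t" "\<And>s. P s \<Longrightarrow> \<mu> t \<le> \<mu> s" by auto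
  obtain x y z where xyz: "t = (x, y, z)" by (cases t)
  have m: "m = x * a1 + y * a2 + z * a3" and nn: "0 \<le> y" "0 \<le> z"
    using t(1) by (auto simp: P_def xyz)
  have least: "y * a2 + z * a3 \<le> y' * a2 + z' * a3"
    if "m = x' * a1 + y' * a2 + z' * a3" "0 \<le> y'" "0 \<le> z'" for x' y' z'
  proof -
    have "\<mu> (x, y, z) \<le> \<mu> (x', y', z')" using t(2)[of "(x', y', z')"] that by (simp add: P_def xyz)
    moreover have "0 \<le> y' * a2 + z' * a3" using that a_pos by simp
    ultimately show ?thesis by (simp add: \<mu>_def nat_le_eq_zle)
  qed
  have pos: "0 < \<alpha> * a1" "0 < \<alpha>' * a1" "0 < (\<alpha> + \<alpha>') * a1" using a_pos exp_pos by simp_all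
  have A: "y < \<beta> + \<beta>'"
  proof (rule ccontr)
    assume "\<not> ?thesis"
    then have "y * a2 + z * a3 \<le> (y - (\<beta> + \<beta>')) * a2 + (z + \<gamma>') * a3"
      using m nn rel_Y exp_pos
      by (intro least[of "x + \<alpha>"]) (auto simp: algebra_simps)
    then show False using rel_Y pos by (simp add: algebra_simps)
  qed
  have B: "z < \<gamma> + \<gamma>'"
  proof (rule ccontr)
    assume "\<not> ?thesis"
    then have "y * a2 + z * a3 \<le> (y + \<beta>) * a2 + (z - (\<gamma> + \<gamma>')) * a3"
      using m nn rel_Z exp_pos
      by (intro least[of "x + \<alpha>'"]) (auto simp: algebra_simps)
    then show False using rel_Z pos by (simp add: algebra_simps)
  qed
  have C: "y < \<beta>' \<or> z < \<gamma>"
  proof (rule ccontr)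
    assume "\<not> ?thesis"
    then have "y * a2 + z * a3 \<le> (y - \<beta>') * a2 + (z - \<gamma>) * a3"
      using m nn rel_X exp_pos
      by (intro least[of "x + \<alpha> + \<alpha>'"]) (auto simp: algebra_simps)
    then show False using rel_X pos by (simp add: algebra_simps)
  qed
  show thesis using that[OF m nn] A B C exp_pos by linarith
qed

lemma pf1_notin: "pf1 \<notin> H"
proof
  assume "pf1 \<in> H"
  then obtain x y z where xyz: "0 \<le> x" "0 \<le> y" "0 \<le> z" "pf1 = x * a1 + y * a2 + z * a3"
    by (auto simp: H_def)
  then have "(x + 1) * a1 + (y - \<beta> - \<beta>' + 1) * a2 + (z - \<gamma> + 1) * a3 = 0"
    by (simp add: pf1_def algebra_simps)
  from lattice[OF this] obtain p q r where e: "x + 1 = \<alpha> * (p - r) + \<alpha>' * (q - r)"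
     "y - \<beta> - \<beta>' + 1 = \<beta> * (q - p) + \<beta>' * (r - p)" "z - \<gamma> + 1 = \<gamma> * (r - q) + \<gamma>' * (p - q)" by blast
  have x: "p \<le> r \<Longrightarrow> r < q"
    using e(1) xyz mult_le_nonpos[of \<alpha> "p - r"] mult_le_nonpos[of \<alpha>' "q - r"] exp_pos by linarith
  have y: "r < p \<Longrightarrow> p \<le> q"
    using e(2) xyz mult_le_neg[of \<beta> "q - p"] mult_le_neg[of \<beta>' "r - p"] exp_pos by linarith
  have z: "r < q \<Longrightarrow> q < p"
    using e(3) xyz mult_le_neg[of \<gamma> "r - q"] mult_le_nonpos[of \<gamma>' "p - q"] exp_pos by linarith
  show False using x y z by linarith
qed

lemma pf2_notin: "pf2 \<notin> H"
proof
  assume "pf2 \<in> H"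
  then obtain x y z where xyz: "0 \<le> x" "0 \<le> y" "0 \<le> z" "pf2 = x * a1 + y * a2 + z * a3"
    by (auto simp: H_def)
  then have "(x + 1) * a1 + (y - \<beta>' + 1) * a2 + (z - \<gamma> - \<gamma>' + 1) * a3 = 0"
    by (simp add: pf2_def algebra_simps)
  from lattice[OF this] obtain p q r where e: "x + 1 = \<alpha> * (p - r) + \<alpha>' * (q - r)"
     "y - \<beta>' + 1 = \<beta> * (q - p) + \<beta>' * (r - p)" "z - \<gamma> - \<gamma>' + 1 = \<gamma> * (r - q) + \<gamma>' * (p - q)" by blast
  have x: "p \<le> r \<Longrightarrow> r < q"
    using e(1) xyz mult_le_nonpos[of \<alpha> "p - r"] mult_le_nonpos[of \<alpha>' "q - r"] exp_pos by linarith
  have y: "r < p \<Longrightarrow> p < q"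
    using e(2) xyz mult_le_nonpos[of \<beta> "q - p"] mult_le_neg[of \<beta>' "r - p"] exp_pos by linarith
  have z: "r < q \<Longrightarrow> q \<le> p"
    using e(3) xyz mult_le_neg[of \<gamma> "r - q"] mult_le_neg[of \<gamma>' "p - q"] exp_pos by linarith
  show False using x y z by linarith
qed

text \<open>
  This is the symmetry behind the canonical module. In a representation \<open>xa\<^sub>1 + ya\<^sub>2 + za\<^sub>3\<close> of \<open>m \<notin> H\<close> with
  \<open>(y, z)\<close> below the staircase, \<open>x\<close> is negative, and subtracting from the corner above \<open>(y, z)\<close> leaves
  three nonnegative coefficients.
\<close>

lemma duality: "m \<notin> H \<longleftrightarrow> pf1 - m \<in> H \<or> pf2 - m \<in> H"
proof
  assume m: "m \<notin> H"
  obtain x y z where e: "m = x * a1 + y * a2 + z * a3" "0 \<le> y" "0 \<le> z"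
    and c: "y < \<beta> + \<beta>' \<and> z < \<gamma> \<or> y < \<beta>' \<and> z < \<gamma> + \<gamma>'" by (rule apery_representation)
  have x: "0 \<le> - 1 - x" using e m semigroupI[of x y z] by (cases "0 \<le> x") auto
  from c show "pf1 - m \<in> H \<or> pf2 - m \<in> H"
  proof
    assume "y < \<beta> + \<beta>' \<and> z < \<gamma>"
    then have "(- 1 - x) * a1 + (\<beta> + \<beta>' - 1 - y) * a2 + (\<gamma> - 1 - z) * a3 \<in> H"
      using x by (intro semigroupI) auto
    also have "(- 1 - x) * a1 + (\<beta> + \<beta>' - 1 - y) * a2 + (\<gamma> - 1 - z) * a3 = pf1 - m"
      by (simp add: e pf1_def algebra_simps)
    finally show ?thesis ..
  next
    assume "y < \<beta>' \<and> z < \<gamma> + \<gamma>'"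
    then have "(- 1 - x) * a1 + (\<beta>' - 1 - y) * a2 + (\<gamma> + \<gamma>' - 1 - z) * a3 \<in> H"
      using x by (intro semigroupI) auto
    also have "(- 1 - x) * a1 + (\<beta>' - 1 - y) * a2 + (\<gamma> + \<gamma>' - 1 - z) * a3 = pf2 - m"
      by (simp add: e pf2_def algebra_simps)
    finally show ?thesis ..
  qed
next
  assume "pf1 - m \<in> H \<or> pf2 - m \<in> H"
  then show "m \<notin> H"
    using semigroup_add[of "pf1 - m" m] semigroup_add[of "pf2 - m" m] pf1_notin pf2_notin by auto
qed

lemma above_frobenius: "pf2 < m \<Longrightarrow> m \<in> H"
  using duality[of m] semigroup_nonneg[of "pf1 - m"] semigroup_nonneg[of "pf2 - m"] pf2_eq shift_pos
  by fastforce

lemma shift_notin: "shift \<notin> H"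
  using shift_into_semigroup[of 0 0 0] exp_pos by (auto simp: H_def)

lemma semigroup_minus_gen:
  "h \<in> H \<Longrightarrow> h \<noteq> 0 \<Longrightarrow> h - a1 \<in> H \<or> h - a2 \<in> H \<or> h - a3 \<in> H"
proof -
  assume "h \<in> H" "h \<noteq> 0"
  then obtain x y z where h: "0 \<le> x" "0 \<le> y" "0 \<le> z" "h = x * a1 + y * a2 + z * a3"
    by (auto simp: H_def)
  then have "1 \<le> x \<or> 1 \<le> y \<or> 1 \<le> z" using \<open>h \<noteq> 0\<close> by (cases "x = 0"; cases "y = 0"; cases "z = 0") auto
  moreover have "h - a1 = (x - 1) * a1 + y * a2 + z * a3" "h - a2 = x * a1 + (y - 1) * a2 + z * a3"
    "h - a3 = x * a1 + y * a2 + (z - 1) * a3" by (auto simp: h algebra_simps)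
  ultimately show ?thesis using h semigroupI by (metis diff_ge_0_iff_ge)
qed

text \<open>
  By duality \<open>p - m \<in> H\<close> for one corner \<open>p\<close>. If this difference were \<open>a\<^sub>i + h\<close> with \<open>h \<in> H\<close>, then
  \<open>p = (m + a\<^sub>i) + h\<close> would be in \<open>H\<close>; so a pseudo-Frobenius number equals its corner.
  Both corners qualify since neither \<open>a\<close> nor
  \<open>- a\<close> is in \<open>H\<close>.
\<close>

lemma pseudo_frobenius_eq:
  "{m. m \<notin> H \<and> m + a1 \<in> H \<and> m + a2 \<in> H \<and> m + a3 \<in> H} = {pf1, pf2}"
    (is "?P = _")
proof
  show "?P \<subseteq> {pf1, pf2}"
  proof
    fix m assume m: "m \<in> ?P"
    have "p = m" if "p - m \<in> H" "p \<notin> H" for p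
    proof (rule ccontr)
      assume "p \<noteq> m"
      then have "p - m - a1 \<in> H \<or> p - m - a2 \<in> H \<or> p - m - a3 \<in> H"
        using semigroup_minus_gen[of "p - m"] that by simp
      then show False
        using m semigroup_add[of "p - m - a1" "m + a1"] semigroup_add[of "p - m - a2" "m + a2"]
          semigroup_add[of "p - m - a3" "m + a3"] that by auto
    qed
    then show "m \<in> {pf1, pf2}" using m duality pf1_notin pf2_notin by blast
  qed
  have gens: "a1 \<in> H" "a2 \<in> H" "a3 \<in> H"
    using gens_in_semigroup[of 1] by auto
  have neg: "- g \<notin> H" "- shift - g \<notin> H" if "g \<in> H" "0 < g" for g
    using semigroup_nonneg[of "- g"] semigroup_nonneg[of "- shift - g"] shift_pos that by auto
  have sh: "shift - g \<notin> H" if "g \<in> H" for g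
    using semigroup_add[of "shift - g" g] that shift_notin by auto
  have "pf1 + g \<in> H" "pf2 + g \<in> H" if "g \<in> H" "0 < g" for g
    using duality[of "pf1 + g"] duality[of "pf2 + g"] neg[OF that] sh[OF that(1)]
    by (auto simp: pf2_eq)
  then show "{pf1, pf2} \<subseteq> ?P" using pf1_notin pf2_notin gens a_pos by auto
qed


interpretation rot: herzog_relations a2 a3 a1 \<beta> \<gamma> \<alpha> \<beta>' \<gamma>' \<alpha>' by (rule rotated)
interpretation rot2: herzog_relations a3 a1 a2 \<gamma> \<alpha> \<beta> \<gamma>' \<alpha>' \<beta>' by (rule rot.rotated)

lemma rot_shift: "rot.shift = shift" "rot2.shift = shift"
  using rel_X rel_Y rel_Z by (simp_all add: shift_def rot.shift_def rot2.shift_def algebra_simps)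

text \<open>
  A monomial dividing both \<open>X\<^sup>\<alpha>\<close> and \<open>Y\<^sup>\<beta>\<close> in \<open>R\<close> is trivial, because each of the two degrees has only the
  evident representation.
\<close>

lemma common_divisor_zero:
  assumes g: "g \<in> H" "\<alpha> * a1 - g \<in> H" "\<beta> * a2 - g \<in> H"
  shows "g = 0"
proof -
  obtain x y z where 1: "0 \<le> x" "0 \<le> y" "0 \<le> z" "g = x * a1 + y * a2 + z * a3"
    using g(1) by (auto simp: H_def)
  obtain x' y' z' where 2: "0 \<le> x'" "0 \<le> y'" "0 \<le> z'" "\<alpha> * a1 - g = x' * a1 + y' * a2 + z' * a3"
    using g(2) by (auto simp: H_def)
  obtain x'' y'' z'' where 3: "0 \<le> x''" "0 \<le> y''" "0 \<le> z''" "\<beta> * a2 - g = x'' * a1 + y'' * a2 + z'' * a3"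
    using g(3) by (auto simp: H_def)
  have "\<alpha> * a1 = (x + x') * a1 + (y + y') * a2 + (z + z') * a3" using 1 2 by (simp add: algebra_simps)
  from unique_alpha[OF _ _ _ this] have "y + y' = 0" "z + z' = 0" using 1(1-3) 2(1-3) by simp_all
  then have "y = 0" "z = 0" using 1 2 by linarith+
  have "\<beta> * a2 = (y + y'') * a2 + (z + z'') * a3 + (x + x'') * a1" using 1 3 by (simp add: algebra_simps)
  from rot.unique_alpha[OF _ _ _ this] have "x + x'' = 0" using 1(1-3) 3(1-3) by simp
  then have "x = 0" using 1(1) 3(1) by linarith
  then show ?thesis using 1(4) \<open>y = 0\<close> \<open>z = 0\<close> by simp
qed

text \<open>
  Otherwise \<open>\<alpha>' \<le> \<alpha>\<close>, \<open>\<beta>' \<le> \<beta>\<close> and \<open>\<gamma>' \<le> \<gamma>\<close>, and \<open>3a\<close> would not be positive.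
\<close>

lemma not_all_minus_shift:
  assumes "\<alpha> * a1 - shift \<in> H" "\<beta> * a2 - shift \<in> H" "\<gamma> * a3 - shift \<in> H"
  shows False
proof -
  obtain x y z where 1: "0 \<le> x" "0 \<le> y" "0 \<le> z" "\<alpha> * a1 - shift = x * a1 + y * a2 + z * a3"
    using assms(1) by (auto simp: H_def)
  obtain x' y' z' where 2: "0 \<le> x'" "0 \<le> y'" "0 \<le> z'" "\<beta> * a2 - shift = y' * a2 + z' * a3 + x' * a1"
    using assms(2) by (auto simp: H_def)
  obtain x'' y'' z'' where 3: "0 \<le> x''" "0 \<le> y''" "0 \<le> z''" "\<gamma> * a3 - shift = z'' * a3 + x'' * a1 + y'' * a2"
    using assms(3) by (auto simp: H_def)
  have "\<alpha>' \<le> \<alpha>" "\<beta>' \<le> \<beta>" "\<gamma>' \<le> \<gamma>"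
    using alpha_minus_shift[OF 1] rot.alpha_minus_shift[of y' z' x', unfolded rot_shift, OF 2(2,3,1,4)]
      rot2.alpha_minus_shift[of z'' x'' y'', unfolded rot_shift, OF 3(3,1,2,4)]
    by simp_all
  then have "(\<alpha>' - \<alpha>) * a1 \<le> 0" "(\<beta>' - \<beta>) * a2 \<le> 0" "(\<gamma>' - \<gamma>) * a3 \<le> 0"
    using a_pos by (auto simp: mult_le_0_iff)
  moreover have "3 * shift = (\<alpha>' - \<alpha>) * a1 + (\<beta>' - \<beta>) * a2 + (\<gamma>' - \<gamma>) * a3"
    using shift_eqs by (simp add: shift_def algebra_simps)
  ultimately show False using shift_pos by linarith
qed

text \<open>
  The exponents of the monomials in \<open>R : K\<close>. If \<open>3a \<in> H\<close> this is also the set for \<open>R : R[K]\<close>.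
\<close>

definition conductor_set :: "int set" where
  "conductor_set = {h \<in> H. h + shift \<in> H}"

lemma conductor_set_eq:
  "conductor_set = (+) (\<alpha> * a1) ` H \<union> (+) (\<beta> * a2) ` H \<union> (+) (\<gamma> * a3) ` H"
    (is "_ = ?U")
proof
  show "conductor_set \<subseteq> ?U"
  proof
    fix h assume "h \<in> conductor_set"
    then obtain x y z x' y' z' where h: "0 \<le> x" "0 \<le> y" "0 \<le> z" "0 \<le> x'" "0 \<le> y'" "0 \<le> z'"
      "h = x * a1 + y * a2 + z * a3" "h + shift = x' * a1 + y' * a2 + z' * a3"
      by (auto simp: conductor_set_def H_def)
    then have "\<alpha> \<le> x \<or> \<beta> \<le> y \<or> \<gamma> \<le> z" by (intro shift_into_semigroup[of x y z x' y' z']) auto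
    moreover have "h = \<alpha> * a1 + ((x - \<alpha>) * a1 + y * a2 + z * a3)" "h = \<beta> * a2 + (x * a1 + (y - \<beta>) * a2 + z * a3)"
      "h = \<gamma> * a3 + (x * a1 + y * a2 + (z - \<gamma>) * a3)" by (auto simp: h(7) algebra_simps)
    moreover have "\<alpha> \<le> x \<Longrightarrow> (x - \<alpha>) * a1 + y * a2 + z * a3 \<in> H"
      "\<beta> \<le> y \<Longrightarrow> x * a1 + (y - \<beta>) * a2 + z * a3 \<in> H"
      "\<gamma> \<le> z \<Longrightarrow> x * a1 + y * a2 + (z - \<gamma>) * a3 \<in> H"
      using h by (auto intro: semigroupI)
    ultimately show "h \<in> ?U" by blast
  qed
  have "p + h \<in> conductor_set" if "p + shift \<in> H" "p \<in> H" "h \<in> H" for p h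
    using semigroup_add[of "p + shift" h] semigroup_add[of p h] that by (simp add: conductor_set_def ac_simps)
  moreover have "\<alpha> * a1 + shift = \<beta>' * a2" "\<beta> * a2 + shift = \<gamma>' * a3" "\<gamma> * a3 + shift = \<alpha>' * a1"
    using shift_eqs by (auto simp: shift_def)
  ultimately show "?U \<subseteq> conductor_set" using gens_in_semigroup exp_pos by auto
qed

lemma conductor_set_subset: "conductor_set \<subseteq> H"
  by (auto simp: conductor_set_def)

lemma conductor_set_add: "g \<in> H \<Longrightarrow> h \<in> conductor_set \<Longrightarrow> g + h \<in> conductor_set"
  using semigroup_add[of g h] semigroup_add[of g "h + shift"] by (simp add: conductor_set_def ac_simps)

lemma conductor_set_high: "pf2 < h \<Longrightarrow> h \<in> conductor_set"
  using above_frobenius shift_pos by (simp add: conductor_set_def)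

text \<open>
  The shift takes the generators of the ideal to the entries of the second row, which are multiples of
  the generators under the three inequalities.
\<close>

lemma conductor_set_shift:
  assumes "\<alpha> \<le> \<alpha>'" "\<beta> \<le> \<beta>'" "\<gamma> \<le> \<gamma>'" and h: "h \<in> conductor_set"
  shows "h + shift \<in> conductor_set"
proof -
  have *: "p + g \<in> conductor_set"
    if "p \<in> {\<beta>' * a2, \<gamma>' * a3, \<alpha>' * a1}" "g \<in> H" for p g
  proof -
    have "p = \<beta> * a2 + (\<beta>' - \<beta>) * a2 \<or> p = \<gamma> * a3 + (\<gamma>' - \<gamma>) * a3 \<or> p = \<alpha> * a1 + (\<alpha>' - \<alpha>) * a1"
      using that by (auto simp: algebra_simps)
    moreover have "(\<beta>' - \<beta>) * a2 \<in> H" "(\<gamma>' - \<gamma>) * a3 \<in> H" "(\<alpha>' - \<alpha>) * a1 \<in> H"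
      using assms(1-3) by (auto intro: gens_in_semigroup)
    ultimately have "p \<in> conductor_set" unfolding conductor_set_eq by blast
    from conductor_set_add[OF that(2) this] show ?thesis by (simp only: add.commute)
  qed
  have "\<alpha> * a1 + shift = \<beta>' * a2" "\<beta> * a2 + shift = \<gamma>' * a3" "\<gamma> * a3 + shift = \<alpha>' * a1"
    using shift_eqs by (auto simp: shift_def)
  moreover obtain p g where "h = p + g" "g \<in> H" "p \<in> {\<alpha> * a1, \<beta> * a2, \<gamma> * a3}"
    using h unfolding conductor_set_eq by blast
  ultimately have "h + shift = (p + shift) + g" "p + shift \<in> {\<beta>' * a2, \<gamma>' * a3, \<alpha>' * a1}" by auto
  then show ?thesis using * \<open>g \<in> H\<close> by metis
qed

lemma conductor_power_le:
  "\<alpha>' * a1 \<in> conductor_set \<Longrightarrow> \<alpha> \<le> \<alpha>'" "\<beta>' * a2 \<in> conductor_set \<Longrightarrow> \<beta> \<le> \<beta>'"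
  "\<gamma>' * a3 \<in> conductor_set \<Longrightarrow> \<gamma> \<le> \<gamma>'"
  using shift_into_semigroup[of \<alpha>' 0 0] shift_into_semigroup[of 0 \<beta>' 0] shift_into_semigroup[of 0 0 \<gamma>'] exp_pos
  by (auto simp: conductor_set_def H_def add.commute[of _ shift])

text \<open>
  The monomials outside the ideal of the first row are represented in the box, and by \<open>unique_box\<close> only once.
\<close>

lemma box_bij:
  "bij_betw (\<lambda>(x, y, z). x * a1 + y * a2 + z * a3) ({0..<\<alpha>} \<times> {0..<\<beta>} \<times> {0..<\<gamma>}) (H - conductor_set)"
  unfolding bij_betw_def
proof (intro conjI equalityI subsetI inj_onI)
  fix s t assume st: "s \<in> {0..<\<alpha>} \<times> {0..<\<beta>} \<times> {0..<\<gamma>}" "t \<in> {0..<\<alpha>} \<times> {0..<\<beta>} \<times> {0..<\<gamma>}"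
    "(case s of (x, y, z) \<Rightarrow> x * a1 + y * a2 + z * a3) = (case t of (x, y, z) \<Rightarrow> x * a1 + y * a2 + z * a3)"
  obtain x y z x' y' z' where e: "s = (x, y, z)" "t = (x', y', z')" by (metis prod_cases3)
  have "x' = x \<and> y' = y \<and> z' = z" by (rule unique_box) (use st e in simp_all)
  then show "s = t" by (simp add: e)
next
  fix h assume "h \<in> (\<lambda>(x, y, z). x * a1 + y * a2 + z * a3) ` ({0..<\<alpha>} \<times> {0..<\<beta>} \<times> {0..<\<gamma>})"
  then obtain x y z where h: "h = x * a1 + y * a2 + z * a3" "0 \<le> x" "0 \<le> y" "0 \<le> z" "x < \<alpha>" "y < \<beta>" "z < \<gamma>"
    by auto
  have "h \<notin> conductor_set"
  proof
    assume "h \<in> conductor_set"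
    then obtain x' y' z' where "0 \<le> x'" "0 \<le> y'" "0 \<le> z'" "h + shift = x' * a1 + y' * a2 + z' * a3"
      by (auto simp: conductor_set_def H_def)
    then show False using shift_into_semigroup[of x y z x' y' z'] h by auto
  qed
  then show "h \<in> H - conductor_set" using h semigroupI by simp
next
  fix h assume h: "h \<in> H - conductor_set"
  then obtain x y z where e: "0 \<le> x" "0 \<le> y" "0 \<le> z" "h = x * a1 + y * a2 + z * a3" by (auto simp: H_def)
  have "h = \<alpha> * a1 + ((x - \<alpha>) * a1 + y * a2 + z * a3)" "h = \<beta> * a2 + (x * a1 + (y - \<beta>) * a2 + z * a3)"
      "h = \<gamma> * a3 + (x * a1 + y * a2 + (z - \<gamma>) * a3)" by (auto simp: e(4) algebra_simps)
  moreover have "\<alpha> \<le> x \<Longrightarrow> (x - \<alpha>) * a1 + y * a2 + z * a3 \<in> H"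
      "\<beta> \<le> y \<Longrightarrow> x * a1 + (y - \<beta>) * a2 + z * a3 \<in> H"
      "\<gamma> \<le> z \<Longrightarrow> x * a1 + y * a2 + (z - \<gamma>) * a3 \<in> H"
      using e by (auto intro: semigroupI)
  ultimately have "\<not> \<alpha> \<le> x" "\<not> \<beta> \<le> y" "\<not> \<gamma> \<le> z" using h unfolding conductor_set_eq by blast+
  then have "x < \<alpha>" "y < \<beta>" "z < \<gamma>" by auto
  then show "h \<in> (\<lambda>(x, y, z). x * a1 + y * a2 + z * a3) ` ({0..<\<alpha>} \<times> {0..<\<beta>} \<times> {0..<\<gamma>})"
    using e by (intro image_eqI[of _ _ "(x, y, z)"]) auto
qed

lemma card_outside_conductor: "card (H - conductor_set) = nat \<alpha> * nat \<beta> * nat \<gamma>"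
  using bij_betw_same_card[OF box_bij] by (simp add: card_cartesian_product)

end

section \<open>Reading off the lattice from the defining ideal\<close>

abbreviation mono3 :: "nat \<Rightarrow> nat \<Rightarrow> nat \<Rightarrow> 'k::field poly poly poly" where
  "mono3 i j l \<equiv> Polynomial.monom (Polynomial.monom (Polynomial.monom 1 i) j) l"

lemma const_poly_power: "[:p:] ^ n = [:p ^ n:]" for p :: "'a::comm_semiring_1"
  by (induction n) (auto simp: one_pCons mult.commute)

lemma var_powers:
  "varX ^ n = (mono3 n 0 0 :: 'k::field poly poly poly)" "varY ^ n = (mono3 0 n 0 :: 'k poly poly poly)"
  "varZ ^ n = (mono3 0 0 n :: 'k poly poly poly)"
  by (auto simp: varX_def varY_def varZ_def const_poly_power monom_altdef simp flip: one_pCons)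

lemma mono3_mult: "mono3 i j l * mono3 i' j' l' = mono3 (i + i') (j + j') (l + l')"
  by (simp add: mult_monom)

lemma pcompose_monom_monom:
  "pcompose (Polynomial.monom c i) (Polynomial.monom 1 n) = Polynomial.monom c (n * i)"
  for c :: "'k::field"
proof (induction i)
  case (Suc i)
  then show ?case by (simp add: monom_Suc pcompose_pCons mult_monom)
qed (simp add: monom_0)

lemma map_poly_diff:
  "g 0 = 0 \<Longrightarrow> (\<And>x y. g (x - y) = g x - g y) \<Longrightarrow> map_poly g (p - q) = map_poly g p - map_poly g q"
  by (intro poly_eqI) (simp add: coeff_map_poly)

lemma toric_map_diff: "toric_map a1 a2 a3 (F - G) = toric_map a1 a2 a3 F - toric_map a1 a2 a3 G"
proof -
  have "map_poly (\<lambda>p. pcompose p (Polynomial.monom 1 a1)) (p - q) =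
      map_poly (\<lambda>p. pcompose p (Polynomial.monom 1 a1)) p - map_poly (\<lambda>p. pcompose p (Polynomial.monom 1 a1)) q"
    for p q :: "'a::field poly poly"
    by (rule map_poly_diff) (simp_all add: pcompose_diff)
  then show ?thesis unfolding toric_map_def
    by (subst map_poly_diff) simp_all
qed

lemma toric_map_mono3:
  "toric_map a1 a2 a3 (mono3 i j l :: 'k::field poly poly poly) = Polynomial.monom 1 (i * a1 + j * a2 + l * a3)"
  by (simp add: toric_map_def map_poly_monom pcompose_monom_monom poly_monom monom_power mult_monom ac_simps)

text \<open>
  The index lists the exponents of \<open>Z\<close>, \<open>Y\<close>, \<open>X\<close> in this order, following the nesting of \<open>k[X][Y][Z]\<close>.
\<close>

definition coeff3 :: "'k::field poly poly poly \<Rightarrow> nat \<times> nat \<times> nat \<Rightarrow> 'k" where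
  "coeff3 F = (\<lambda>(l, j, i). Polynomial.coeff (Polynomial.coeff (Polynomial.coeff F l) j) i)"

lemma finite_support_coeff3: "finite {m. coeff3 F m \<noteq> 0}"
proof (rule finite_subset)
  show "{m. coeff3 F m \<noteq> 0} \<subseteq> (SIGMA l:{..degree F}. SIGMA j:{..degree (Polynomial.coeff F l)}. {..degree (Polynomial.coeff (Polynomial.coeff F l) j)})"
    by (auto simp: coeff3_def intro!: le_degree)
qed auto

text \<open>
  A linear functional on polynomials. If \<open>S\<close> is stable under an exchange of two monomials, it vanishes on all
  multiples of their difference (by \<open>class_sum_mono3_mult\<close>).
\<close>

definition class_sum :: "(nat \<times> nat \<times> nat) set \<Rightarrow> 'k::field poly poly poly \<Rightarrow> 'k" where
  "class_sum S F = (\<Sum>m | m \<in> S \<and> coeff3 F m \<noteq> 0. coeff3 F m)"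

lemma class_sum_cover:
  assumes "finite A" "{m. coeff3 F m \<noteq> 0} \<subseteq> A"
  shows "class_sum S F = (\<Sum>m\<in>A \<inter> S. coeff3 F m)"
  unfolding class_sum_def using assms by (intro sum.mono_neutral_left) auto

lemma class_sum_diff: "class_sum S (F - G) = class_sum S F - class_sum S G"
proof -
  let ?A = "{m. coeff3 F m \<noteq> 0} \<union> {m. coeff3 G m \<noteq> 0}"
  have "finite ?A" by (simp add: finite_support_coeff3)
  moreover have "coeff3 (F - G) m = coeff3 F m - coeff3 G m" for m
    by (auto simp: coeff3_def split: prod.split)
  ultimately show ?thesis
    by (subst (1 2 3) class_sum_cover[of ?A]) (auto simp: sum_subtractf)
qed

lemma class_sum_mono3_mult:
  "class_sum S (mono3 i j l * F) = class_sum {(l', j', i'). (l + l', j + j', i + i') \<in> S} F"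
proof -
  have c: "coeff3 (mono3 i j l * F) (l', j', i') =
      (if l \<le> l' \<and> j \<le> j' \<and> i \<le> i' then coeff3 F (l' - l, j' - j, i' - i) else 0)" for l' j' i'
    by (auto simp: coeff3_def coeff_monom_mult)
  show ?thesis unfolding class_sum_def
    by (rule sum.reindex_bij_witness[where i = "\<lambda>(l', j', i'). (l + l', j + j', i + i')"
          and j = "\<lambda>(l', j', i'). (l' - l, j' - j, i' - i)"])
      (auto simp: c split: if_splits)
qed

lemma class_sum_mono3: "class_sum S (mono3 i j l :: 'k::field poly poly poly) = (if (l, j, i) \<in> S then 1 else 0)"
proof -
  have "{m. coeff3 (mono3 i j l :: 'k poly poly poly) m \<noteq> 0} \<subseteq> {(l, j, i)}"
    by (auto simp: coeff3_def split: if_splits)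
  then show ?thesis by (subst class_sum_cover[of "{(l, j, i)}"]) (auto simp: coeff3_def)
qed

lemma minors_ideal_add_diff:
  assumes "F \<in> minors_ideal p1 p2 p3 q1 q2 q3"
  obtains u v w where "F = (p1 * q2 * u - p2 * q1 * u) - ((p3 * q1 * v - p1 * q3 * v) - (p2 * q3 * w - p3 * q2 * w))"
  using assms by (auto simp: minors_ideal_def algebra_simps)

text \<open>
  The minors lie in the kernel, which gives the three relations. Conversely a relation among the \<open>a\<^sub>i\<close> gives
  a binomial in the kernel, hence in the ideal of minors. Summing coefficients over the exponent vectors
  congruent to one of its two terms, modulo the lattice of the minors, kills the ideal; so the other term
  belongs to the same class.
\<close>

lemma herzog_relations_from_kernel:
  fixes a1 a2 a3 \<alpha> \<beta> \<gamma> \<alpha>' \<beta>' \<gamma>' :: nat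
  assumes pos: "0 < a1" "0 < a2" "0 < a3" "0 < \<alpha>" "0 < \<beta>" "0 < \<gamma>" "0 < \<alpha>'" "0 < \<beta>'" "0 < \<gamma>'"
    and kernel: "{F :: 'k::field poly poly poly. toric_map a1 a2 a3 F = 0} =
       minors_ideal (varX ^ \<alpha>) (varY ^ \<beta>) (varZ ^ \<gamma>) (varY ^ \<beta>') (varZ ^ \<gamma>') (varX ^ \<alpha>')"
  shows "herzog_relations a1 a2 a3 \<alpha> \<beta> \<gamma> \<alpha>' \<beta>' \<gamma>'"
proof -
  let ?J = "minors_ideal (varX ^ \<alpha>) (varY ^ \<beta>) (varZ ^ \<gamma>) (varY ^ \<beta>') (varZ ^ \<gamma>') (varX ^ \<alpha>')
    :: 'k poly poly poly set"
  have J: "F \<in> ?J \<longleftrightarrow> toric_map a1 a2 a3 F = 0" for F using kernel by blast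
  have binom: "mono3 i j l - mono3 i' j' l' \<in> ?J \<longleftrightarrow> i * a1 + j * a2 + l * a3 = i' * a1 + j' * a2 + l' * a3"
    for i j l i' j' l'
    unfolding J by (auto simp: toric_map_diff toric_map_mono3 monom_eq_iff')
  have "mono3 \<alpha> 0 \<gamma>' - mono3 0 (\<beta> + \<beta>') 0 \<in> ?J"
    unfolding minors_ideal_def mem_Collect_eq
    by (rule exI[of _ 1], rule exI[of _ 0], rule exI[of _ 0]) (simp only: var_powers mono3_mult, simp)
  then have rY: "(\<beta> + \<beta>') * a2 = \<alpha> * a1 + \<gamma>' * a3" unfolding binom by simp
  have "mono3 (\<alpha> + \<alpha>') 0 0 - mono3 0 \<beta>' \<gamma> \<in> ?J"
    unfolding minors_ideal_def mem_Collect_eq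
    by (rule exI[of _ 0], rule exI[of _ 1], rule exI[of _ 0]) (simp only: var_powers mono3_mult, simp)
  then have rX: "(\<alpha> + \<alpha>') * a1 = \<beta>' * a2 + \<gamma> * a3" unfolding binom by simp
  have "mono3 \<alpha>' \<beta> 0 - mono3 0 0 (\<gamma> + \<gamma>') \<in> ?J"
    unfolding minors_ideal_def mem_Collect_eq
    by (rule exI[of _ 0], rule exI[of _ 0], rule exI[of _ 1]) (simp only: var_powers mono3_mult, simp)
  then have rZ: "(\<gamma> + \<gamma>') * a3 = \<alpha>' * a1 + \<beta> * a2" unfolding binom by simp
  define L where "L = (\<lambda>x y z. \<exists>p q r. x = int \<alpha> * (p - r) + int \<alpha>' * (q - r) \<and>
    y = int \<beta> * (q - p) + int \<beta>' * (r - p) \<and> z = int \<gamma> * (r - q) + int \<gamma>' * (p - q))"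
  have L_add: "L (x + x') (y + y') (z + z')" if "L x y z" "L x' y' z'" for x y z x' y' z'
  proof -
    from that obtain p q r p' q' r' where
      "x = int \<alpha> * (p - r) + int \<alpha>' * (q - r)" "y = int \<beta> * (q - p) + int \<beta>' * (r - p)"
      "z = int \<gamma> * (r - q) + int \<gamma>' * (p - q)"
      "x' = int \<alpha> * (p' - r') + int \<alpha>' * (q' - r')" "y' = int \<beta> * (q' - p') + int \<beta>' * (r' - p')"
      "z' = int \<gamma> * (r' - q') + int \<gamma>' * (p' - q')" unfolding L_def by blast
    then show ?thesis unfolding L_def
      by (intro exI[of _ "p + p'"] exI[of _ "q + q'"] exI[of _ "r + r'"]) (simp add: algebra_simps)
  qed
  have L_gens: "L \<alpha> (- \<beta> - \<beta>') \<gamma>'" "L (- \<alpha>) (\<beta> + \<beta>') (- \<gamma>')"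
      "L (- \<alpha> - \<alpha>') \<beta>' \<gamma>" "L (\<alpha> + \<alpha>') (- \<beta>') (- \<gamma>)"
      "L \<alpha>' \<beta> (- \<gamma> - \<gamma>')" "L (- \<alpha>') (- \<beta>) (\<gamma> + \<gamma>')" unfolding L_def
    by ((rule exI[of _ 1], rule exI[of _ 0], rule exI[of _ 0], simp),
        (rule exI[of _ "-1"], rule exI[of _ 0], rule exI[of _ 0], simp),
        (rule exI[of _ 0], rule exI[of _ 0], rule exI[of _ 1], simp),
        (rule exI[of _ 0], rule exI[of _ 0], rule exI[of _ "-1"], simp),
        (rule exI[of _ 0], rule exI[of _ 1], rule exI[of _ 0], simp),
        (rule exI[of _ 0], rule exI[of _ "-1"], rule exI[of _ 0], simp))
  have key: "L (int i - int i') (int j - int j') (int l - int l')"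
    if "i * a1 + j * a2 + l * a3 = i' * a1 + j' * a2 + l' * a3" for i j l i' j' l'
  proof -
    define S where "S = {(l :: nat, j :: nat, i :: nat). L (int i - int i') (int j - int j') (int l - int l')}"
    have "mono3 i j l - mono3 i' j' l' \<in> ?J" using that unfolding binom by simp
    then obtain u v w where F: "mono3 i j l - mono3 i' j' l' =
       (varX ^ \<alpha> * varZ ^ \<gamma>' * u - varY ^ \<beta> * varY ^ \<beta>' * u) -
       ((varZ ^ \<gamma> * varY ^ \<beta>' * v - varX ^ \<alpha> * varX ^ \<alpha>' * v) -
        (varY ^ \<beta> * varX ^ \<alpha>' * w - varZ ^ \<gamma> * varZ ^ \<gamma>' * w :: 'k poly poly poly))"
      by (rule minors_ideal_add_diff)
    have "L (int (\<alpha> + x) - int i') (int y - int j') (int (\<gamma>' + z) - int l') \<longleftrightarrow>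
          L (int x - int i') (int (\<beta> + \<beta>' + y) - int j') (int z - int l')" for x y z
      using L_add[OF L_gens(1), of "int x - int i'" "int (\<beta> + \<beta>' + y) - int j'" "int z - int l'"]
        L_add[OF L_gens(2), of "int (\<alpha> + x) - int i'" "int y - int j'" "int (\<gamma>' + z) - int l'"]
      by (auto simp: algebra_simps)
    moreover have "L (int x - int i') (int (\<beta>' + y) - int j') (int (\<gamma> + z) - int l') \<longleftrightarrow>
          L (int (\<alpha> + \<alpha>' + x) - int i') (int y - int j') (int z - int l')" for x y z
      using L_add[OF L_gens(3), of "int (\<alpha> + \<alpha>' + x) - int i'" "int y - int j'" "int z - int l'"]
        L_add[OF L_gens(4), of "int x - int i'" "int (\<beta>' + y) - int j'" "int (\<gamma> + z) - int l'"]
      by (auto simp: algebra_simps)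
    moreover have "L (int (\<alpha>' + x) - int i') (int (\<beta> + y) - int j') (int z - int l') \<longleftrightarrow>
          L (int x - int i') (int y - int j') (int (\<gamma> + \<gamma>' + z) - int l')" for x y z
      using L_add[OF L_gens(5), of "int x - int i'" "int y - int j'" "int (\<gamma> + \<gamma>' + z) - int l'"]
        L_add[OF L_gens(6), of "int (\<alpha>' + x) - int i'" "int (\<beta> + y) - int j'" "int z - int l'"]
      by (auto simp: algebra_simps)
    ultimately have "class_sum S (mono3 i j l - mono3 i' j' l' :: 'k poly poly poly) = 0"
      unfolding F var_powers mono3_mult
      by (simp only: class_sum_diff class_sum_mono3_mult) (simp add: S_def)
    moreover have "(l', j', i') \<in> S"
      by (auto simp: S_def L_def intro!: exI[of _ 0])
    ultimately have "(l, j, i) \<in> S"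
      by (auto simp: class_sum_diff class_sum_mono3 split: if_splits)
    then show ?thesis by (simp add: S_def)
  qed
  show ?thesis
  proof
    fix x y z :: int assume e: "x * int a1 + y * int a2 + z * int a3 = 0"
    have split: "\<exists>m n. x = int m - int n" for x :: int
      by (metis diff_0 diff_0_right int_cases2 of_nat_0)
    obtain i i' j j' l l' where xyz: "x = int i - int i'" "y = int j - int j'" "z = int l - int l'"
      using split by metis
    then have "int (i * a1 + j * a2 + l * a3) = int (i' * a1 + j' * a2 + l' * a3)"
      using e unfolding xyz by (simp add: algebra_simps)
    then have "L x y z" using key[of i j l i' j' l'] unfolding of_nat_eq_iff xyz by simp
    then show "\<exists>p q r. x = int \<alpha> * (p - r) + int \<alpha>' * (q - r) \<and> y = int \<beta> * (q - p) + int \<beta>' * (r - p) \<and>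
        z = int \<gamma> * (r - q) + int \<gamma>' * (p - q)" unfolding L_def .
  qed (use pos rX rY rZ in \<open>simp_all flip: of_nat_add of_nat_mult\<close>)
qed

section \<open>Semilinear surjections, length and free reductions\<close>

text \<open>
  The length of \<open>M / Z\<close>, measured by chains of submodules of \<open>M\<close>. It allows quotients of different kinds to be
  compared inside one module.
\<close>

definition mod_length_above :: "('a, 'r) ring_scheme \<Rightarrow> ('a, 'b, 'm) module_scheme \<Rightarrow> 'b set \<Rightarrow> enat" where
  "mod_length_above R M Z = Sup {enat n | n. \<exists>L. (\<forall>i\<le>n. submodule (L i) R M \<and> Z \<subseteq> L i) \<and>
     (\<forall>i<n. L i \<subset> L (Suc i))}"

lemma (in abelian_group) minus_eq_zero_iff:
  "a \<in> carrier G \<Longrightarrow> b \<in> carrier G \<Longrightarrow> a \<ominus> b = \<zero> \<longleftrightarrow> a = b"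
  by (metis a_minus_def add.inv_closed minus_minus minus_equality r_neg)

text \<open>
  A surjection of modules over a surjection of rings. With \<open>\<pi>\<close> the identity this covers quotient modules,
  with \<open>\<pi>\<close> a reduction modulo \<open>I\<close> it covers \<open>M \<rightarrow> M / IM\<close>. The target is assumed to carry operations only;
  that it is a module is inherited from the source.
\<close>

locale semilinear_surj = module R M
  for R :: "('a, 'r) ring_scheme" (structure) and M :: "('a, 'b, 'm) module_scheme" (structure) +
  fixes S :: "('c, 's) ring_scheme" and N :: "('c, 'd, 'n) module_scheme"
    and \<pi> :: "'a \<Rightarrow> 'c" and \<phi> :: "'b \<Rightarrow> 'd"
  assumes cring_S: "cring S" and pi_hom: "\<pi> \<in> ring_hom R S" and pi_surj: "\<pi> ` carrier R = carrier S"
    and phi_surj: "\<phi> ` carrier M = carrier N"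
    and phi_add: "\<And>x y. x \<in> carrier M \<Longrightarrow> y \<in> carrier M \<Longrightarrow> \<phi> (x \<oplus>\<^bsub>M\<^esub> y) = \<phi> x \<oplus>\<^bsub>N\<^esub> \<phi> y"
    and phi_smult: "\<And>r x. r \<in> carrier R \<Longrightarrow> x \<in> carrier M \<Longrightarrow> \<phi> (r \<odot>\<^bsub>M\<^esub> x) = \<pi> r \<odot>\<^bsub>N\<^esub> \<phi> x"
    and phi_zero: "\<phi> \<zero>\<^bsub>M\<^esub> = \<zero>\<^bsub>N\<^esub>"
begin

definition ker :: "'b set" where "ker = {x \<in> carrier M. \<phi> x = \<zero>\<^bsub>N\<^esub>}"

lemma phi_closed [simp]: "x \<in> carrier M \<Longrightarrow> \<phi> x \<in> carrier N"
  using phi_surj by blast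

lemma pi_closed [simp]: "r \<in> carrier R \<Longrightarrow> \<pi> r \<in> carrier S"
  using pi_surj by blast

lemma phi_obtain: assumes "y \<in> carrier N" obtains x where "x \<in> carrier M" "y = \<phi> x"
  using assms phi_surj by blast

lemma pi_obtain: assumes "s \<in> carrier S" obtains r where "r \<in> carrier R" "s = \<pi> r"
  using assms pi_surj by blast

lemma module_N: "module S N"
proof (rule moduleI)
  show "cring S" by (rule cring_S)
  show "abelian_group N"
  proof (rule abelian_groupI)
    show "\<zero>\<^bsub>N\<^esub> \<in> carrier N" using phi_closed[OF M.zero_closed] by (simp add: phi_zero)
  next
    fix x y assume "x \<in> carrier N" "y \<in> carrier N"
    then obtain x' y' where e: "x' \<in> carrier M" "x = \<phi> x'" "y' \<in> carrier M" "y = \<phi> y'"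
      by (metis phi_obtain)
    show "x \<oplus>\<^bsub>N\<^esub> y \<in> carrier N" "x \<oplus>\<^bsub>N\<^esub> y = y \<oplus>\<^bsub>N\<^esub> x"
      using e by (auto simp: M.a_comm simp flip: phi_add)
    fix z assume "z \<in> carrier N"
    then obtain z' where "z' \<in> carrier M" "z = \<phi> z'" by (metis phi_obtain)
    with e show "x \<oplus>\<^bsub>N\<^esub> y \<oplus>\<^bsub>N\<^esub> z = x \<oplus>\<^bsub>N\<^esub> (y \<oplus>\<^bsub>N\<^esub> z)"
      by (auto simp: M.a_assoc simp flip: phi_add)
  next
    fix x assume "x \<in> carrier N"
    then obtain x' where e: "x' \<in> carrier M" "x = \<phi> x'" by (metis phi_obtain)
    show "\<zero>\<^bsub>N\<^esub> \<oplus>\<^bsub>N\<^esub> x = x" using e by (simp flip: phi_zero phi_add)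
    show "\<exists>y\<in>carrier N. y \<oplus>\<^bsub>N\<^esub> x = \<zero>\<^bsub>N\<^esub>"
      using e by (intro bexI[of _ "\<phi> (\<ominus>\<^bsub>M\<^esub> x')"]) (simp_all add: M.l_neg flip: phi_zero phi_add)
  qed
next
  fix r x assume "r \<in> carrier S" "x \<in> carrier N"
  then obtain r' x' where e: "r' \<in> carrier R" "r = \<pi> r'" "x' \<in> carrier M" "x = \<phi> x'"
    by (metis pi_obtain phi_obtain)
  show "r \<odot>\<^bsub>N\<^esub> x \<in> carrier N" using e by (simp flip: phi_smult)
  { fix s assume "s \<in> carrier S"
    then obtain s' where s: "s' \<in> carrier R" "s = \<pi> s'" by (metis pi_obtain)
    show "(r \<oplus>\<^bsub>S\<^esub> s) \<odot>\<^bsub>N\<^esub> x = r \<odot>\<^bsub>N\<^esub> x \<oplus>\<^bsub>N\<^esub> s \<odot>\<^bsub>N\<^esub> x"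
      using e s by (simp add: smult_l_distr flip: phi_smult phi_add ring_hom_add[OF pi_hom])
    show "(r \<otimes>\<^bsub>S\<^esub> s) \<odot>\<^bsub>N\<^esub> x = r \<odot>\<^bsub>N\<^esub> (s \<odot>\<^bsub>N\<^esub> x)"
      using e s by (simp add: smult_assoc1 flip: phi_smult ring_hom_mult[OF pi_hom]) }
  { fix y assume "y \<in> carrier N"
    then obtain y' where y: "y' \<in> carrier M" "y = \<phi> y'" by (metis phi_obtain)
    show "r \<odot>\<^bsub>N\<^esub> (x \<oplus>\<^bsub>N\<^esub> y) = r \<odot>\<^bsub>N\<^esub> x \<oplus>\<^bsub>N\<^esub> r \<odot>\<^bsub>N\<^esub> y"
      using e y by (simp add: smult_r_distr flip: phi_smult phi_add) }
next
  fix x assume "x \<in> carrier N"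
  then obtain x' where e: "x' \<in> carrier M" "x = \<phi> x'" by (metis phi_obtain)
  then show "\<one>\<^bsub>S\<^esub> \<odot>\<^bsub>N\<^esub> x = x" by (simp flip: phi_smult ring_hom_one[OF pi_hom])
qed

sublocale N: module S N by (rule module_N)

lemma phi_neg: "x \<in> carrier M \<Longrightarrow> \<phi> (\<ominus>\<^bsub>M\<^esub> x) = \<ominus>\<^bsub>N\<^esub> \<phi> x"
  by (rule N.minus_equality[symmetric]) (simp_all add: M.l_neg flip: phi_zero phi_add)

lemma phi_minus: "x \<in> carrier M \<Longrightarrow> y \<in> carrier M \<Longrightarrow> \<phi> (x \<ominus>\<^bsub>M\<^esub> y) = \<phi> x \<ominus>\<^bsub>N\<^esub> \<phi> y"
  by (simp add: M.minus_eq N.minus_eq phi_add phi_neg)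

lemma phi_eq_iff: "x \<in> carrier M \<Longrightarrow> y \<in> carrier M \<Longrightarrow> \<phi> x = \<phi> y \<longleftrightarrow> x \<ominus>\<^bsub>M\<^esub> y \<in> ker"
  by (simp add: ker_def phi_minus N.minus_eq_zero_iff)

lemma submodule_vimage:
  assumes "submodule L S N" shows "submodule {x \<in> carrier M. \<phi> x \<in> L} R M"
  using N.submoduleE[OF assms] subgroup.one_closed[OF submodule.axioms(1)[OF assms]]
  by (intro submoduleI) (auto simp: phi_zero phi_neg phi_add phi_smult)

lemma submodule_image:
  assumes "submodule L R M" shows "submodule (\<phi> ` L) S N"
proof (rule N.submoduleI)
  note L = submoduleE[OF assms] subgroup.one_closed[OF submodule.axioms(1)[OF assms]]
  show "\<phi> ` L \<subseteq> carrier N" using L by auto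
  show "\<zero>\<^bsub>N\<^esub> \<in> \<phi> ` L" using L(7) by (auto simp flip: phi_zero)
  fix x assume "x \<in> \<phi> ` L"
  then obtain x' where x: "x' \<in> L" "x = \<phi> x'" by blast
  then show "\<ominus>\<^bsub>N\<^esub> x \<in> \<phi> ` L" using L by (auto simp: subset_iff simp flip: phi_neg)
  { fix y assume "y \<in> \<phi> ` L"
    then obtain y' where "y' \<in> L" "y = \<phi> y'" by blast
    with x show "x \<oplus>\<^bsub>N\<^esub> y \<in> \<phi> ` L" using L by (auto simp: subset_iff simp flip: phi_add) }
  fix s assume "s \<in> carrier S"
  then obtain r where "r \<in> carrier R" "s = \<pi> r" by (metis pi_obtain)
  with x show "s \<odot>\<^bsub>N\<^esub> x \<in> \<phi> ` L" using L by (auto simp: subset_iff simp flip: phi_smult)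
qed

text \<open>
  Preimage and image match the submodules of the target with those above the kernel and preserve strict
  inclusions.
\<close>

lemma mod_length_surj: "mod_length S N = mod_length_above R M ker"
proof -
  have "(\<exists>L. (\<forall>i\<le>n. submodule (L i) S N) \<and> (\<forall>i<n. L i \<subset> L (Suc i))) \<longleftrightarrow>
     (\<exists>L. (\<forall>i\<le>n. submodule (L i) R M \<and> ker \<subseteq> L i) \<and> (\<forall>i<n. L i \<subset> L (Suc i)))" (is "?N \<longleftrightarrow> ?M") for n
  proof
    assume ?N
    then obtain L where L: "\<And>i. i \<le> n \<Longrightarrow> submodule (L i) S N" "\<And>i. i < n \<Longrightarrow> L i \<subset> L (Suc i)" by blast
    let ?L = "\<lambda>i. {x \<in> carrier M. \<phi> x \<in> L i}"
    have "?L i \<subset> ?L (Suc i)" if i: "i < n" for i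
    proof -
      obtain y where y: "y \<in> L (Suc i)" "y \<notin> L i" using L(2)[OF i] by blast
      then have "y \<in> carrier N" using N.submoduleE(1)[OF L(1)[of "Suc i"]] i by auto
      then obtain x where "x \<in> carrier M" "y = \<phi> x" by (metis phi_obtain)
      then show ?thesis using y L(2)[OF i] by blast
    qed
    moreover have "submodule (?L i) R M \<and> ker \<subseteq> ?L i" if i: "i \<le> n" for i
      using submodule_vimage[OF L(1)[OF i]] subgroup.one_closed[OF submodule.axioms(1)[OF L(1)[OF i]]]
      by (auto simp: ker_def)
    ultimately show ?M by (intro exI[of _ ?L]) blast
  next
    assume ?M
    then obtain L where L: "\<And>i. i \<le> n \<Longrightarrow> submodule (L i) R M" "\<And>i. i \<le> n \<Longrightarrow> ker \<subseteq> L i"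
      "\<And>i. i < n \<Longrightarrow> L i \<subset> L (Suc i)" by blast
    have "\<phi> ` L i \<subset> \<phi> ` L (Suc i)" if i: "i < n" for i
    proof -
      obtain y where y: "y \<in> L (Suc i)" "y \<notin> L i" using L(3)[OF i] by blast
      have "\<phi> y \<notin> \<phi> ` L i"
      proof
        assume "\<phi> y \<in> \<phi> ` L i"
        then obtain x where x: "x \<in> L i" "\<phi> y = \<phi> x" by blast
        have c: "y \<in> carrier M" "x \<in> carrier M"
          using y x submoduleE(1)[OF L(1)] i by (meson less_imp_le_nat subsetD Suc_leI)+
        then have "y \<ominus>\<^bsub>M\<^esub> x \<in> L i" using x L(2)[of i] i phi_eq_iff[of y x] by auto
        then have "(y \<ominus>\<^bsub>M\<^esub> x) \<oplus>\<^bsub>M\<^esub> x \<in> L i" using x i by (intro submoduleE(5)[OF L(1)]) auto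
        moreover have "(y \<ominus>\<^bsub>M\<^esub> x) \<oplus>\<^bsub>M\<^esub> x = y" using c by (simp add: M.minus_eq M.a_assoc M.l_neg)
        ultimately show False using y by simp
      qed
      then show ?thesis using y L(3)[OF i] by blast
    qed
    then show ?N using L(1) submodule_image by (intro exI[of _ "\<lambda>i. \<phi> ` L i"]) blast
  qed
  then show ?thesis by (simp add: mod_length_def mod_length_above_def)
qed

abbreviation lincomb :: "'b set \<Rightarrow> ('b \<Rightarrow> 'a) \<Rightarrow> 'b" where
  "lincomb F e \<equiv> \<Oplus>\<^bsub>M\<^esub>y\<in>F. e y \<odot>\<^bsub>M\<^esub> y"

lemma phi_finsum:
  "finite F \<Longrightarrow> f \<in> F \<rightarrow> carrier M \<Longrightarrow> \<phi> (\<Oplus>\<^bsub>M\<^esub>x\<in>F. f x) = (\<Oplus>\<^bsub>N\<^esub>x\<in>F. \<phi> (f x))"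
  by (induction F rule: finite_induct) (auto simp: phi_zero phi_add Pi_iff)

lemma phi_combination:
  assumes "finite F" "F \<subseteq> carrier M" "e \<in> F \<rightarrow> carrier R"
  shows "\<phi> (lincomb F e) = (\<Oplus>\<^bsub>N\<^esub>y\<in>F. \<pi> (e y) \<odot>\<^bsub>N\<^esub> \<phi> y)"
proof -
  have "\<phi> (lincomb F e) = (\<Oplus>\<^bsub>N\<^esub>y\<in>F. \<phi> (e y \<odot>\<^bsub>M\<^esub> y))"
    using assms by (intro phi_finsum) (auto simp: Pi_iff subset_iff)
  also have "\<dots> = (\<Oplus>\<^bsub>N\<^esub>y\<in>F. \<pi> (e y) \<odot>\<^bsub>N\<^esub> \<phi> y)"
    using assms by (intro N.finsum_cong') (auto simp: phi_smult Pi_iff subset_iff)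
  finally show ?thesis .
qed

lemma finsum_support:
  assumes "finite F" "F \<subseteq> B" "B \<subseteq> carrier N" "c \<in> B \<rightarrow> carrier S" "\<And>b. b \<in> B - F \<Longrightarrow> c b = \<zero>\<^bsub>S\<^esub>"
  shows "(\<Oplus>\<^bsub>N\<^esub>b\<in>{b\<in>B. c b \<noteq> \<zero>\<^bsub>S\<^esub>}. c b \<odot>\<^bsub>N\<^esub> b) = (\<Oplus>\<^bsub>N\<^esub>b\<in>F. c b \<odot>\<^bsub>N\<^esub> b)"
  using assms by (intro N.add.finprod_mono_neutral_cong_left) (auto simp: Pi_iff subset_iff)

text \<open>
  For \<open>N = M / IM\<close> this turns freeness over \<open>R / I\<close> into statements about linear combinations in \<open>M\<close>: a
  lifted basis spans modulo the kernel, and a combination in the kernel has coefficients in \<open>I\<close>.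
\<close>

lemma free_module_lift_basis:
  assumes free: "free_module S N"
  obtains X where "X \<subseteq> carrier M"
    "\<And>x. x \<in> carrier M \<Longrightarrow> \<exists>F e. finite F \<and> F \<subseteq> X \<and> e \<in> F \<rightarrow> carrier R \<and>
       x \<ominus>\<^bsub>M\<^esub> lincomb F e \<in> ker"
    "\<And>F e y. finite F \<Longrightarrow> F \<subseteq> X \<Longrightarrow> e \<in> F \<rightarrow> carrier R \<Longrightarrow> lincomb F e \<in> ker \<Longrightarrow>
       y \<in> F \<Longrightarrow> \<pi> (e y) = \<zero>\<^bsub>S\<^esub>"
proof -
  from free obtain B where B: "B \<subseteq> carrier N" and "\<forall>x\<in>carrier N.
      \<exists>!c. c \<in> B \<rightarrow>\<^sub>E carrier S \<and> finite {b\<in>B. c b \<noteq> \<zero>\<^bsub>S\<^esub>} \<and>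
        x = (\<Oplus>\<^bsub>N\<^esub>b\<in>{b\<in>B. c b \<noteq> \<zero>\<^bsub>S\<^esub>}. c b \<odot>\<^bsub>N\<^esub> b)"
    unfolding free_module_def by (elim conjE exE)
  note coord = bspec[OF this(2)]
  define k where "k = inv_into (carrier M) \<phi>"
  have k: "k b \<in> carrier M" "\<phi> (k b) = b" if "b \<in> B" for b
    using that B phi_surj unfolding k_def by (auto intro: inv_into_into f_inv_into_f simp: subset_iff)
  define l where "l = inv_into (carrier R) \<pi>"
  have l: "l s \<in> carrier R" "\<pi> (l s) = s" if "s \<in> carrier S" for s
    using that pi_surj unfolding l_def by (auto intro: inv_into_into f_inv_into_f)
  have inj: "inj_on k B" using k by (metis inj_onI)
  show thesis
  proof (rule that[of "k ` B"])
    show "k ` B \<subseteq> carrier M" using k by auto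
  next
    fix x assume x: "x \<in> carrier M"
    obtain c where c: "c \<in> B \<rightarrow>\<^sub>E carrier S" "finite {b\<in>B. c b \<noteq> \<zero>\<^bsub>S\<^esub>}"
        "\<phi> x = (\<Oplus>\<^bsub>N\<^esub>b\<in>{b\<in>B. c b \<noteq> \<zero>\<^bsub>S\<^esub>}. c b \<odot>\<^bsub>N\<^esub> b)" using coord[of "\<phi> x"] x by auto
    let ?G = "{b\<in>B. c b \<noteq> \<zero>\<^bsub>S\<^esub>}" and ?e = "\<lambda>y. l (c (\<phi> y))"
    have cS: "c b \<in> carrier S" if "b \<in> B" for b using c(1) that by auto
    have e: "?e \<in> k ` ?G \<rightarrow> carrier R" using k l cS by auto
    have s: "lincomb (k ` ?G) ?e \<in> carrier M"
      using e k by (intro M.finsum_closed) (auto simp: Pi_iff)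
    have "\<phi> (lincomb (k ` ?G) ?e) = (\<Oplus>\<^bsub>N\<^esub>y\<in>k ` ?G. \<pi> (?e y) \<odot>\<^bsub>N\<^esub> \<phi> y)"
      using c(2) e k by (intro phi_combination) auto
    also have "\<dots> = (\<Oplus>\<^bsub>N\<^esub>b\<in>?G. \<pi> (?e (k b)) \<odot>\<^bsub>N\<^esub> \<phi> (k b))"
      using inj k l cS B by (intro N.finsum_reindex) (auto simp: inj_on_def subset_iff)
    also have "\<dots> = (\<Oplus>\<^bsub>N\<^esub>b\<in>?G. c b \<odot>\<^bsub>N\<^esub> b)"
      using k l cS B by (intro N.finsum_cong') auto
    finally have "x \<ominus>\<^bsub>M\<^esub> lincomb (k ` ?G) ?e \<in> ker"
      using c(3) x s by (simp flip: phi_eq_iff)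
    moreover have "finite (k ` ?G)" "k ` ?G \<subseteq> k ` B" using c(2) by auto
    ultimately show "\<exists>F e. finite F \<and> F \<subseteq> k ` B \<and> e \<in> F \<rightarrow> carrier R \<and>
       x \<ominus>\<^bsub>M\<^esub> lincomb F e \<in> ker" using e by blast
  next
    fix F e y assume F: "finite F" "F \<subseteq> k ` B" "e \<in> F \<rightarrow> carrier R" and y: "y \<in> F"
      and 0: "lincomb F e \<in> ker"
    obtain G where G: "G \<subseteq> B" "F = k ` G" using F(2) by (meson subset_imageE)
    have finG: "finite G" using F(1) G inj finite_imageD inj_on_subset by metis
    define c where "c = (\<lambda>b\<in>B. if b \<in> G then \<pi> (e (k b)) else \<zero>\<^bsub>S\<^esub>)"
    have eG: "e (k b) \<in> carrier R" if "b \<in> G" for b using that F(3) G by auto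
    have cS: "c \<in> B \<rightarrow>\<^sub>E carrier S" using eG by (auto simp: c_def)
    have "(\<Oplus>\<^bsub>N\<^esub>b\<in>{b\<in>B. c b \<noteq> \<zero>\<^bsub>S\<^esub>}. c b \<odot>\<^bsub>N\<^esub> b) = (\<Oplus>\<^bsub>N\<^esub>b\<in>G. c b \<odot>\<^bsub>N\<^esub> b)"
      using finG G B cS by (intro finsum_support) (auto simp: c_def)
    also have "\<dots> = (\<Oplus>\<^bsub>N\<^esub>b\<in>G. \<pi> (e (k b)) \<odot>\<^bsub>N\<^esub> \<phi> (k b))"
      using G k B eG by (intro N.finsum_cong') (auto simp: c_def subset_iff)
    also have "\<dots> = (\<Oplus>\<^bsub>N\<^esub>y\<in>F. \<pi> (e y) \<odot>\<^bsub>N\<^esub> \<phi> y)"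
      unfolding G(2) using G k eG inj B by (intro N.finsum_reindex[symmetric]) (auto simp: inj_on_def subset_iff)
    also have "\<dots> = \<phi> (lincomb F e)"
      using F k by (intro phi_combination[symmetric]) auto
    also have "\<dots> = \<zero>\<^bsub>N\<^esub>" using 0 by (simp add: ker_def)
    finally have 1: "\<zero>\<^bsub>N\<^esub> = (\<Oplus>\<^bsub>N\<^esub>b\<in>{b\<in>B. c b \<noteq> \<zero>\<^bsub>S\<^esub>}. c b \<odot>\<^bsub>N\<^esub> b)" ..
    define z where "z = (\<lambda>b\<in>B. \<zero>\<^bsub>S\<^esub>)"
    have z: "z \<in> B \<rightarrow>\<^sub>E carrier S" "{b\<in>B. z b \<noteq> \<zero>\<^bsub>S\<^esub>} = {}" by (auto simp: z_def)
    have fin: "finite {b\<in>B. c b \<noteq> \<zero>\<^bsub>S\<^esub>}"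
      by (rule finite_subset[OF _ finG]) (auto simp: c_def)
    define P where "P = (\<lambda>c. c \<in> B \<rightarrow>\<^sub>E carrier S \<and> finite {b\<in>B. c b \<noteq> \<zero>\<^bsub>S\<^esub>} \<and>
        \<zero>\<^bsub>N\<^esub> = (\<Oplus>\<^bsub>N\<^esub>b\<in>{b\<in>B. c b \<noteq> \<zero>\<^bsub>S\<^esub>}. c b \<odot>\<^bsub>N\<^esub> b))"
    have "\<exists>!c. P c" unfolding P_def by (rule coord[OF N.zero_closed])
    moreover have "P c" using cS 1 fin unfolding P_def by blast
    moreover have "P z" unfolding P_def z(2) using z(1) by simp
    ultimately have "c = z" by blast
    obtain b where b: "b \<in> G" "y = k b" using y G by blast
    then have "c b = \<pi> (e y)" "z b = \<zero>\<^bsub>S\<^esub>" using G by (auto simp: c_def z_def)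
    then show "\<pi> (e y) = \<zero>\<^bsub>S\<^esub>" using \<open>c = z\<close> by simp
  qed
qed

text \<open>
  A converse of \<open>free_module_lift_basis\<close>, for finitely many generators. Two coordinate
  functions of the same element lift to coefficients whose differences give a combination in the kernel.
\<close>

lemma free_moduleI_basis:
  assumes X: "finite X" "X \<subseteq> carrier M" "inj_on \<phi> X"
    and span: "\<And>x. x \<in> carrier M \<Longrightarrow> \<exists>e \<in> X \<rightarrow> carrier R. x \<ominus>\<^bsub>M\<^esub> lincomb X e \<in> ker"
    and indep: "\<And>e y. e \<in> X \<rightarrow> carrier R \<Longrightarrow> lincomb X e \<in> ker \<Longrightarrow>
       y \<in> X \<Longrightarrow> \<pi> (e y) = \<zero>\<^bsub>S\<^esub>"
  shows "free_module S N"
  unfolding free_module_def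
proof (intro conjI module_N exI[of _ "\<phi> ` X"] ballI)
  let ?B = "\<phi> ` X"
  define l where "l = inv_into (carrier R) \<pi>"
  have l: "l s \<in> carrier R" "\<pi> (l s) = s" if "s \<in> carrier S" for s
    using that pi_surj unfolding l_def by (auto intro: inv_into_into f_inv_into_f)
  show B: "?B \<subseteq> carrier N" using X by auto
  have fin: "finite {b\<in>?B. c b \<noteq> \<zero>\<^bsub>S\<^esub>}" for c :: "'d \<Rightarrow> 'c" using X(1) by auto
  have comb: "(\<Oplus>\<^bsub>N\<^esub>b\<in>{b\<in>?B. c b \<noteq> \<zero>\<^bsub>S\<^esub>}. c b \<odot>\<^bsub>N\<^esub> b) = \<phi> (lincomb X e)"
    if "c \<in> ?B \<rightarrow> carrier S" "e \<in> X \<rightarrow> carrier R" "\<And>y. y \<in> X \<Longrightarrow> c (\<phi> y) = \<pi> (e y)" for c e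
  proof -
    have "(\<Oplus>\<^bsub>N\<^esub>b\<in>{b\<in>?B. c b \<noteq> \<zero>\<^bsub>S\<^esub>}. c b \<odot>\<^bsub>N\<^esub> b) = (\<Oplus>\<^bsub>N\<^esub>b\<in>?B. c b \<odot>\<^bsub>N\<^esub> b)"
      using that B X by (intro finsum_support) auto
    also have "\<dots> = (\<Oplus>\<^bsub>N\<^esub>y\<in>X. c (\<phi> y) \<odot>\<^bsub>N\<^esub> \<phi> y)"
      using that B X by (intro N.finsum_reindex) (auto simp: Pi_iff subset_iff)
    also have "\<dots> = (\<Oplus>\<^bsub>N\<^esub>y\<in>X. \<pi> (e y) \<odot>\<^bsub>N\<^esub> \<phi> y)"
      using that X by (intro N.finsum_cong') (auto simp: Pi_iff subset_iff)
    also have "\<dots> = \<phi> (lincomb X e)"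
      using X that by (intro phi_combination[symmetric]) auto
    finally show ?thesis .
  qed
  have sumM: "lincomb X e \<in> carrier M" if "e \<in> X \<rightarrow> carrier R" for e
    using that X by (intro M.finsum_closed) (auto simp: Pi_iff subset_iff)
  fix x assume "x \<in> carrier N"
  then obtain x' where x': "x' \<in> carrier M" "x = \<phi> x'" by (metis phi_obtain)
  obtain e where e: "e \<in> X \<rightarrow> carrier R" "x' \<ominus>\<^bsub>M\<^esub> lincomb X e \<in> ker"
    using span[OF x'(1)] by blast
  define c where "c = (\<lambda>b\<in>?B. \<pi> (e (inv_into X \<phi> b)))"
  have c: "c (\<phi> y) = \<pi> (e y)" if "y \<in> X" for y using that X by (simp add: c_def)
  have cS: "c \<in> ?B \<rightarrow>\<^sub>E carrier S" using e(1) by (auto simp: c_def X(3) Pi_iff)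
  show "\<exists>!c. c \<in> ?B \<rightarrow>\<^sub>E carrier S \<and> finite {b\<in>?B. c b \<noteq> \<zero>\<^bsub>S\<^esub>} \<and>
        x = (\<Oplus>\<^bsub>N\<^esub>b\<in>{b\<in>?B. c b \<noteq> \<zero>\<^bsub>S\<^esub>}. c b \<odot>\<^bsub>N\<^esub> b)"
  proof (intro ex1I[of _ c] conjI fin cS)
    have cS': "c \<in> ?B \<rightarrow> carrier S" using cS by auto
    show "x = (\<Oplus>\<^bsub>N\<^esub>b\<in>{b\<in>?B. c b \<noteq> \<zero>\<^bsub>S\<^esub>}. c b \<odot>\<^bsub>N\<^esub> b)"
      using comb[OF cS' e(1) c] x' e(2) sumM[OF e(1)] phi_eq_iff by simp
    fix d assume d: "d \<in> ?B \<rightarrow>\<^sub>E carrier S \<and> finite {b\<in>?B. d b \<noteq> \<zero>\<^bsub>S\<^esub>} \<and>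
        x = (\<Oplus>\<^bsub>N\<^esub>b\<in>{b\<in>?B. d b \<noteq> \<zero>\<^bsub>S\<^esub>}. d b \<odot>\<^bsub>N\<^esub> b)"
    then have dS: "d \<in> ?B \<rightarrow> carrier S" by auto
    define e' where "e' = (\<lambda>y. l (d (\<phi> y)))"
    have e': "e' \<in> X \<rightarrow> carrier R" and \<pi>e': "\<And>y. y \<in> X \<Longrightarrow> d (\<phi> y) = \<pi> (e' y)"
      using dS l by (auto simp: e'_def Pi_iff)
    have "\<phi> (lincomb X e) = \<phi> (lincomb X e')"
      using comb[OF dS e' \<pi>e'] d x' e(2) sumM[OF e(1)] phi_eq_iff by metis
    then have "lincomb X e \<ominus>\<^bsub>M\<^esub> lincomb X e' \<in> ker"
      using sumM e e' phi_eq_iff by blast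
    also have "lincomb X e \<ominus>\<^bsub>M\<^esub> lincomb X e' =
        (\<Oplus>\<^bsub>M\<^esub>y\<in>X. (e y \<ominus> e' y) \<odot>\<^bsub>M\<^esub> y)"
    proof -
      have "lincomb X e = (\<Oplus>\<^bsub>M\<^esub>y\<in>X. (e y \<ominus> e' y) \<odot>\<^bsub>M\<^esub> y \<oplus>\<^bsub>M\<^esub> e' y \<odot>\<^bsub>M\<^esub> y)"
        using e(1) e' X
        by (intro M.finsum_cong')
          (auto simp: Pi_iff subset_iff R.minus_eq R.a_assoc R.l_neg simp flip: smult_l_distr)
      also have "\<dots> = (\<Oplus>\<^bsub>M\<^esub>y\<in>X. (e y \<ominus> e' y) \<odot>\<^bsub>M\<^esub> y) \<oplus>\<^bsub>M\<^esub> lincomb X e'"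
        using e(1) e' X by (intro M.finsum_addf) (auto simp: Pi_iff subset_iff)
      finally show ?thesis
        using sumM[OF e'] sumM[of "\<lambda>y. e y \<ominus> e' y"] e(1) e'
        by (simp add: M.minus_eq M.a_assoc M.r_neg Pi_iff)
    qed
    finally have *: "(\<Oplus>\<^bsub>M\<^esub>y\<in>X. (e y \<ominus> e' y) \<odot>\<^bsub>M\<^esub> y) \<in> ker" .
    have "d (\<phi> y) = c (\<phi> y)" if y: "y \<in> X" for y
    proof -
      have ey: "e y \<in> carrier R" "e' y \<in> carrier R" using e(1) e' y by auto
      have "\<pi> (e y \<ominus> e' y) = \<zero>\<^bsub>S\<^esub>" using e(1) e' by (intro indep[OF _ * y]) auto
      then have "\<pi> (e y \<ominus> e' y) \<oplus>\<^bsub>S\<^esub> \<pi> (e' y) = \<pi> (e' y)" using ey by simp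
      moreover have "\<pi> (e y \<ominus> e' y) \<oplus>\<^bsub>S\<^esub> \<pi> (e' y) = \<pi> (e y)"
        using ey by (simp add: R.minus_eq R.a_assoc R.l_neg flip: ring_hom_add[OF pi_hom])
      ultimately show ?thesis using c \<pi>e' y by simp
    qed
    then show "d = c" using d cS by (intro extensionalityI[of _ ?B]) (auto simp: PiE_def)
  qed
qed

end

lemma UN_eq_const: "A \<noteq> {} \<Longrightarrow> (\<And>x. x \<in> A \<Longrightarrow> f x = C) \<Longrightarrow> (\<Union>x\<in>A. f x) = C"
  by auto

context module begin

lemma submodule_abelian_subgroup: "submodule N R M \<Longrightarrow> abelian_subgroup N M"
  by (rule abelian_subgroupI3) (auto intro: additive_subgroup.intro submodule.axioms(1) M.abelian_group_axioms)

lemma submodule_coset_eq_iff: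
  assumes N: "submodule N R M" "x \<in> carrier M"
  shows "N +>\<^bsub>M\<^esub> x = N \<longleftrightarrow> x \<in> N"
proof -
  interpret N: abelian_subgroup N M by (rule submodule_abelian_subgroup[OF N(1)])
  show ?thesis using assms(2) N.a_rcos_self N.a_rcos_const by blast
qed

text \<open>
  The common core of the scalar multiplications on \<open>M / N\<close> (with \<open>r' = r\<close>) and on \<open>M / IM\<close> over \<open>R / I\<close>
  (with \<open>r' - r \<in> I\<close>).
\<close>

lemma coset_smult_wd:
  assumes N: "submodule N R M" and "x \<in> carrier M" "r \<in> carrier R"
    and x': "x' \<in> N +>\<^bsub>M\<^esub> x" and r': "r' \<in> carrier R" "(r' \<ominus> r) \<odot>\<^bsub>M\<^esub> x \<in> N"
  shows "N +>\<^bsub>M\<^esub> (r' \<odot>\<^bsub>M\<^esub> x') = N +>\<^bsub>M\<^esub> (r \<odot>\<^bsub>M\<^esub> x)"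
proof -
  interpret N: abelian_subgroup N M by (rule submodule_abelian_subgroup[OF N])
  obtain n where n: "n \<in> N" "x' = n \<oplus>\<^bsub>M\<^esub> x" using x' by (auto simp: a_r_coset_def r_coset_def)
  have nM: "n \<in> carrier M" using n by simp
  have "r' \<odot>\<^bsub>M\<^esub> x = (r' \<ominus> r) \<odot>\<^bsub>M\<^esub> x \<oplus>\<^bsub>M\<^esub> r \<odot>\<^bsub>M\<^esub> x"
    using assms by (simp add: R.minus_eq R.a_assoc R.l_neg flip: smult_l_distr)
  then have "r' \<odot>\<^bsub>M\<^esub> x' = (r' \<odot>\<^bsub>M\<^esub> n \<oplus>\<^bsub>M\<^esub> (r' \<ominus> r) \<odot>\<^bsub>M\<^esub> x) \<oplus>\<^bsub>M\<^esub> r \<odot>\<^bsub>M\<^esub> x"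
    using assms nM n by (simp add: smult_r_distr M.a_assoc)
  moreover have "r' \<odot>\<^bsub>M\<^esub> n \<oplus>\<^bsub>M\<^esub> (r' \<ominus> r) \<odot>\<^bsub>M\<^esub> x \<in> N"
    using r' n submoduleE(4)[OF N] by auto
  ultimately have "r' \<odot>\<^bsub>M\<^esub> x' \<in> N +>\<^bsub>M\<^esub> (r \<odot>\<^bsub>M\<^esub> x)" by (auto simp: a_r_coset_def r_coset_def)
  then show ?thesis using assms N.a_repr_independence' by simp
qed

lemma quot_module_surj:
  assumes N: "submodule N R M"
  shows "semilinear_surj R M R (quot_module M N) (\<lambda>r. r) ((+>\<^bsub>M\<^esub>) N)"
proof -
  interpret N: abelian_subgroup N M by (rule submodule_abelian_subgroup[OF N])
  show ?thesis
  proof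
    show "(\<lambda>r. r) \<in> ring_hom R R" by (rule ring_hom_memI) auto
    show "(+>\<^bsub>M\<^esub>) N ` carrier M = carrier (quot_module M N)"
      by (auto simp: quot_module_def A_RCOSETS_def RCOSETS_def a_r_coset_def)
    fix x y assume "x \<in> carrier M" "y \<in> carrier M"
    then show "N +>\<^bsub>M\<^esub> (x \<oplus>\<^bsub>M\<^esub> y) = (N +>\<^bsub>M\<^esub> x) \<oplus>\<^bsub>quot_module M N\<^esub> (N +>\<^bsub>M\<^esub> y)"
      by (simp add: quot_module_def N.a_rcos_sum)
  next
    fix r x assume rx: "r \<in> carrier R" "x \<in> carrier M"
    have "N +>\<^bsub>M\<^esub> (r \<odot>\<^bsub>M\<^esub> x') = N +>\<^bsub>M\<^esub> (r \<odot>\<^bsub>M\<^esub> x)" if "x' \<in> N +>\<^bsub>M\<^esub> x" for x'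
      using rx that N by (intro coset_smult_wd) (auto simp: R.minus_eq R.r_neg)
    then have "(\<Union>x'\<in>N +>\<^bsub>M\<^esub> x. N +>\<^bsub>M\<^esub> (r \<odot>\<^bsub>M\<^esub> x')) = N +>\<^bsub>M\<^esub> (r \<odot>\<^bsub>M\<^esub> x)"
      using N.a_rcos_self[OF rx(2)] by (intro UN_eq_const; blast)
    then show "N +>\<^bsub>M\<^esub> (r \<odot>\<^bsub>M\<^esub> x) = r \<odot>\<^bsub>quot_module M N\<^esub> (N +>\<^bsub>M\<^esub> x)"
      by (simp add: quot_module_def)
  next
    show "N +>\<^bsub>M\<^esub> \<zero>\<^bsub>M\<^esub> = \<zero>\<^bsub>quot_module M N\<^esub>" by (simp add: quot_module_def N.a_rcos_const)
  qed (simp_all add: R.is_cring)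
qed

lemma submod_span_submodule:
  assumes "X \<subseteq> carrier M" shows "submodule (submod_span R M X) R M"
proof (rule submoduleI)
  let ?L = "{L. submodule L R M \<and> X \<subseteq> L}"
  have L: "submodule L R M" if "L \<in> ?L" for L using that by blast
  show "submod_span R M X \<subseteq> carrier M"
    unfolding submod_span_def using carrier_is_submodule assms by blast
  show "\<zero>\<^bsub>M\<^esub> \<in> submod_span R M X" unfolding submod_span_def
    using subgroup.one_closed[OF submodule.axioms(1)[OF L]] by auto
  fix x assume x: "x \<in> submod_span R M X"
  then show "\<ominus>\<^bsub>M\<^esub> x \<in> submod_span R M X" unfolding submod_span_def using submoduleE(3)[OF L] by auto
  { fix y assume "y \<in> submod_span R M X"
    then show "x \<oplus>\<^bsub>M\<^esub> y \<in> submod_span R M X" using x unfolding submod_span_def using submoduleE(5)[OF L] by auto }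
  fix r assume "r \<in> carrier R"
  then show "r \<odot>\<^bsub>M\<^esub> x \<in> submod_span R M X" using x unfolding submod_span_def using submoduleE(4)[OF L] by auto
qed

lemma ideal_smult_submodule:
  "I \<subseteq> carrier R \<Longrightarrow> N \<subseteq> carrier M \<Longrightarrow> submodule (ideal_smult R M I N) R M"
  unfolding ideal_smult_def by (rule submod_span_submodule) auto

lemma mod_reduction_surj:
  assumes I: "ideal I R"
  shows "semilinear_surj R M (R Quot I) (mod_reduction R M I) ((+>) I)
    ((+>\<^bsub>M\<^esub>) (ideal_smult R M I (carrier M)))"
proof -
  interpret I: ideal I R by (rule I)
  let ?N = "ideal_smult R M I (carrier M)"
  have N: "submodule ?N R M" using I.a_subset by (intro ideal_smult_submodule) auto
  have IN: "r \<odot>\<^bsub>M\<^esub> x \<in> ?N" if "r \<in> I" "x \<in> carrier M" for r x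
    using that by (auto simp: ideal_smult_def submod_span_def)
  interpret N: abelian_subgroup ?N M by (rule submodule_abelian_subgroup[OF N])
  show ?thesis
  proof (intro semilinear_surj.intro semilinear_surj_axioms.intro)
    show "module R M" by (rule module_axioms)
    show "cring (R Quot I)" by (rule I.quotient_is_cring) (rule R.is_cring)
    show "(+>) I \<in> ring_hom R (R Quot I)" by (rule I.rcos_ring_hom)
    show "(+>) I ` carrier R = carrier (R Quot I)"
      by (auto simp: FactRing_def A_RCOSETS_def RCOSETS_def a_r_coset_def)
    show "(+>\<^bsub>M\<^esub>) ?N ` carrier M = carrier (mod_reduction R M I)"
      by (auto simp: mod_reduction_def Let_def A_RCOSETS_def RCOSETS_def a_r_coset_def)
    fix x y assume "x \<in> carrier M" "y \<in> carrier M"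
    then show "?N +>\<^bsub>M\<^esub> (x \<oplus>\<^bsub>M\<^esub> y) = (?N +>\<^bsub>M\<^esub> x) \<oplus>\<^bsub>mod_reduction R M I\<^esub> (?N +>\<^bsub>M\<^esub> y)"
      by (simp add: mod_reduction_def Let_def N.a_rcos_sum)
  next
    fix r x assume rx: "r \<in> carrier R" "x \<in> carrier M"
    have "?N +>\<^bsub>M\<^esub> (r' \<odot>\<^bsub>M\<^esub> x') = ?N +>\<^bsub>M\<^esub> (r \<odot>\<^bsub>M\<^esub> x)"
      if x': "x' \<in> ?N +>\<^bsub>M\<^esub> x" and r': "r' \<in> I +> r" for r' x'
    proof (rule coset_smult_wd[OF N rx(2,1) x'])
      show r'R: "r' \<in> carrier R" using r' rx I.a_elemrcos_carrier by blast
      have "r' \<ominus> r \<in> I" using r' rx r'R by (simp add: I.a_rcos_module_minus[OF R.ring_axioms])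
      then show "(r' \<ominus> r) \<odot>\<^bsub>M\<^esub> x \<in> ?N" using rx by (intro IN)
    qed
    then have "(\<Union>r'\<in>I +> r. \<Union>x'\<in>?N +>\<^bsub>M\<^esub> x. ?N +>\<^bsub>M\<^esub> (r' \<odot>\<^bsub>M\<^esub> x')) = ?N +>\<^bsub>M\<^esub> (r \<odot>\<^bsub>M\<^esub> x)"
      using N.a_rcos_self[OF rx(2)] I.a_rcos_self[OF rx(1)] by (intro UN_eq_const; blast)
    then show "?N +>\<^bsub>M\<^esub> (r \<odot>\<^bsub>M\<^esub> x) = (I +> r) \<odot>\<^bsub>mod_reduction R M I\<^esub> (?N +>\<^bsub>M\<^esub> x)"
      by (simp add: mod_reduction_def Let_def Let_def)
  next
    show "?N +>\<^bsub>M\<^esub> \<zero>\<^bsub>M\<^esub> = \<zero>\<^bsub>mod_reduction R M I\<^esub>" by (simp add: mod_reduction_def Let_def N.a_rcos_const)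
  qed
qed

end

lemma semilinear_surj_comp:
  assumes "semilinear_surj R M S N \<pi> \<phi>" "semilinear_surj S N T P \<rho> \<psi>"
  shows "semilinear_surj R M T P (\<lambda>x. \<rho> (\<pi> x)) (\<lambda>x. \<psi> (\<phi> x))"
proof -
  interpret f: semilinear_surj R M S N \<pi> \<phi> by fact
  interpret g: semilinear_surj S N T P \<rho> \<psi> by fact
  show ?thesis
  proof
    show "(\<lambda>x. \<rho> (\<pi> x)) \<in> ring_hom R T"
      using ring_hom_trans[OF f.pi_hom g.pi_hom] by (simp add: comp_def)
    show "(\<lambda>x. \<rho> (\<pi> x)) ` carrier R = carrier T" by (simp flip: image_image add: f.pi_surj g.pi_surj)
    show "(\<lambda>x. \<psi> (\<phi> x)) ` carrier M = carrier P" by (simp flip: image_image add: f.phi_surj g.phi_surj)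
  qed (simp_all add: f.phi_add g.phi_add f.phi_smult g.phi_smult f.phi_zero g.phi_zero g.cring_S)
qed

lemma mod_hom_surj:
  assumes "module R M" "module R N" "h \<in> mod_hom R M N" "h ` carrier M = carrier N"
  shows "semilinear_surj R M R N (\<lambda>r. r) h"
proof -
  interpret M: module R M by fact
  interpret N: module R N by fact
  show ?thesis
  proof
    show "(\<lambda>r. r) \<in> ring_hom R R" by (rule ring_hom_memI) auto
    have "h (\<zero>\<^bsub>R\<^esub> \<odot>\<^bsub>M\<^esub> \<zero>\<^bsub>M\<^esub>) = \<zero>\<^bsub>R\<^esub> \<odot>\<^bsub>N\<^esub> h \<zero>\<^bsub>M\<^esub>"
      using assms(3) M.R.zero_closed M.M.zero_closed unfolding mod_hom_def by blast
    then have "h \<zero>\<^bsub>M\<^esub> = \<zero>\<^bsub>R\<^esub> \<odot>\<^bsub>N\<^esub> h \<zero>\<^bsub>M\<^esub>" by simp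
    also have "\<dots> = \<zero>\<^bsub>N\<^esub>" using assms(3) by (intro N.smult_l_null) (auto simp: mod_hom_def)
    finally show "h \<zero>\<^bsub>M\<^esub> = \<zero>\<^bsub>N\<^esub>" .
  qed (use assms M.R.is_cring in \<open>auto simp: mod_hom_def\<close>)
qed

section \<open>Laurent series with prescribed exponents\<close>

definition series_on :: "int set \<Rightarrow> 'k::field fls set" where
  "series_on A = {F. \<forall>n. fls_nth F n \<noteq> 0 \<longrightarrow> n \<in> A}"

lemma series_onD: "F \<in> series_on A \<Longrightarrow> fls_nth F n \<noteq> 0 \<Longrightarrow> n \<in> A"
  by (simp add: series_on_def)

lemma series_on_zero [simp]: "0 \<in> series_on A"
  by (simp add: series_on_def)

lemma series_on_add: "F \<in> series_on A \<Longrightarrow> G \<in> series_on A \<Longrightarrow> F + G \<in> series_on A"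
  unfolding series_on_def mem_Collect_eq fls_plus_nth by (metis add_0)

lemma series_on_uminus: "F \<in> series_on A \<Longrightarrow> - F \<in> series_on A"
  by (auto simp: series_on_def)

lemma series_on_diff: "F \<in> series_on A \<Longrightarrow> G \<in> series_on A \<Longrightarrow> F - G \<in> series_on A"
  using series_on_add[of F A "- G"] series_on_uminus[of G A] by simp

lemma series_on_mono: "A \<subseteq> B \<Longrightarrow> series_on A \<subseteq> series_on B"
  by (auto simp: series_on_def)

lemma tpow_in_series_on [simp]: "(tpow i :: 'k::field fls) \<in> series_on A \<longleftrightarrow> i \<in> A"
  by (auto simp: series_on_def)

lemma tpow_mult_nth: "fls_nth (tpow i * F) n = fls_nth F (n - i)" for F :: "'k::field fls"
  by (simp add: fls_X_intpow_times_conv_shift)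

lemma tpow_mult_tpow: "tpow i * tpow j = (tpow (i + j) :: 'k::field fls)"
  by (rule fls_X_intpow_times_fls_X_intpow)

lemma one_in_series_on [simp]: "(1 :: 'k::field fls) \<in> series_on A \<longleftrightarrow> 0 \<in> A"
  using tpow_in_series_on[of 0 A, where 'k = 'k] by simp

lemma series_on_mult:
  assumes "F \<in> series_on A" "G \<in> series_on B" "\<And>a b. a \<in> A \<Longrightarrow> b \<in> B \<Longrightarrow> a + b \<in> C"
  shows "F * G \<in> series_on C"
proof -
  have "n \<in> C" if "fls_nth (F * G) n \<noteq> 0" for n
  proof -
    from that obtain i where "fls_nth F i * fls_nth G (n - i) \<noteq> 0"
      unfolding fls_times_nth(2) by (auto elim: sum.not_neutral_contains_not_neutral)
    then have "i + (n - i) \<in> C" using assms by (intro assms(3)) (auto dest: series_onD)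
    then show ?thesis by simp
  qed
  then show ?thesis by (simp add: series_on_def)
qed

lemma tpow_mult_in_series_on:
  "tpow i * F \<in> series_on A \<longleftrightarrow> F \<in> series_on {n. n + i \<in> A}" for F :: "'k::field fls"
proof -
  have "(\<forall>n. fls_nth F (n - i) \<noteq> 0 \<longrightarrow> n \<in> A) \<longleftrightarrow> (\<forall>n. fls_nth F n \<noteq> 0 \<longrightarrow> n + i \<in> A)"
    by (auto dest: spec[of _ "_ + i"] spec[of _ "_ - i"])
  then show ?thesis by (simp only: series_on_def tpow_mult_nth mem_Collect_eq)
qed

text \<open>
  Truncating a series to a set of exponents; this is how sums of monomial ideals are recognized.
\<close>

lemma series_on_split:
  assumes "F \<in> series_on (A \<union> B)"
  obtains G G' where "F = G + G'" "G \<in> series_on A" "G' \<in> series_on (B - A)"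
proof -
  define G where "G = Abs_fls (\<lambda>n. if n \<in> A then fls_nth F n else 0)"
  have nth: "fls_nth G n = (if n \<in> A then fls_nth F n else 0)" for n
    unfolding G_def by (rule nth_Abs_fls_lower_bound[of "fls_subdegree F"]) simp
  show thesis
    by (rule that[of G "F - G"]) (use assms in \<open>auto simp: series_on_def nth split: if_splits\<close>)
qed

lemma series_on_shift:
  assumes "F \<in> series_on ((+) i ` A)"
  obtains G where "F = tpow i * G" "G \<in> series_on A"
proof
  show "F = tpow i * (tpow (- i) * F)" unfolding mult.assoc[symmetric] tpow_mult_tpow by simp
  show "tpow (- i) * F \<in> series_on A"
    unfolding tpow_mult_in_series_on using assms by (force simp: series_on_def)
qed

lemma order_in: "F \<in> series_on A \<Longrightarrow> F \<noteq> 0 \<Longrightarrow> fls_subdegree F \<in> A"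
  using nth_fls_subdegree_nonzero[of F] series_onD[of F A] by blast

lemma series_on_atLeast: "F \<in> series_on {N..} \<longleftrightarrow> F = 0 \<or> N \<le> fls_subdegree F"
proof
  assume "F \<in> series_on {N..}"
  then show "F = 0 \<or> N \<le> fls_subdegree F" using order_in[of F "{N..}"] by auto
next
  assume "F = 0 \<or> N \<le> fls_subdegree F"
  then show "F \<in> series_on {N..}" using fls_subdegree_leI[of F] by (fastforce simp: series_on_def)
qed

lemma fls_const_in_series_on: "0 \<in> A \<Longrightarrow> fls_const c \<in> series_on A"
  by (auto simp: series_on_def)

text \<open>
  The value set of a subspace; it takes the place of dimension counts.
\<close>

definition orders :: "'k::field fls set \<Rightarrow> int set" where
  "orders M = fls_subdegree ` (M - {0})"

lemma orders_mono: "M \<subseteq> M' \<Longrightarrow> orders M \<subseteq> orders M'"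
  by (auto simp: orders_def)

lemma orders_series_on: "orders (series_on A :: 'k::field fls set) = A"
proof
  show "orders (series_on A :: 'k fls set) \<subseteq> A" using order_in by (auto simp: orders_def)
  show "A \<subseteq> orders (series_on A :: 'k fls set)"
  proof
    fix n assume "n \<in> A"
    then have "(tpow n :: 'k fls) \<in> series_on A - {0}" by simp
    from imageI[OF this, of fls_subdegree] show "n \<in> orders (series_on A :: 'k fls set)"
      unfolding orders_def fls_subdegree_fls_X_intpow .
  qed
qed

text \<open>
  Successive approximation: an element of \<open>M'\<close> has the same order as some element of \<open>M\<close>; subtracting a
  multiple of that raises the order, until it reaches \<open>N\<close>.
\<close>

lemma subspace_eqI_orders:
  fixes M M' :: "'k::field fls set"
  assumes sub: "M \<subseteq> M'" and high: "series_on {N..} \<subseteq> M" and ord: "orders M' \<subseteq> orders M"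
    and add: "\<And>x y. x \<in> M \<Longrightarrow> y \<in> M \<Longrightarrow> x + y \<in> M" "\<And>x y. x \<in> M' \<Longrightarrow> y \<in> M' \<Longrightarrow> x + y \<in> M'"
    and scale: "\<And>c x. x \<in> M \<Longrightarrow> fls_const c * x \<in> M" "\<And>c x. x \<in> M' \<Longrightarrow> fls_const c * x \<in> M'"
  shows "M = M'"
proof (rule antisym[OF sub], rule)
  fix x assume "x \<in> M'"
  then show "x \<in> M"
  proof (induction "nat (N - fls_subdegree x)" arbitrary: x rule: less_induct)
    case less
    show ?case
    proof (cases "x \<in> series_on {N..}")
      case True then show ?thesis using high by blast
    next
      case False
      then have x: "x \<noteq> 0" "fls_subdegree x < N" by (auto simp: series_on_atLeast)
      then have "fls_subdegree x \<in> orders M" using ord less.prems by (auto simp: orders_def)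
      then obtain y where "y \<in> M - {0}" "fls_subdegree y = fls_subdegree x"
        unfolding orders_def by (metis imageE)
      then have y: "y \<in> M" "y \<noteq> 0" "fls_subdegree y = fls_subdegree x" by auto
      define c where "c = fls_nth x (fls_subdegree x) / fls_nth y (fls_subdegree x)"
      have yn: "fls_nth y (fls_subdegree x) \<noteq> 0" using y by (metis nth_fls_subdegree_nonzero)
      let ?z = "x + fls_const (- c) * y"
      have cy: "fls_const (- c) * y \<in> M" by (rule scale) (rule y)
      then have zM: "?z \<in> M'" using less.prems add(2) sub by blast
      have "?z \<in> M"
      proof (cases "?z = 0")
        case True then show ?thesis using high by (auto simp only: series_on_zero subset_iff)
      next
        case False
        have "fls_nth ?z k = 0" if "k \<le> fls_subdegree x" for k
          using that yn y(3) by (cases "k = fls_subdegree x") (auto simp: c_def)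
        then have "fls_subdegree x < fls_subdegree ?z" using False by (intro fls_subdegree_greaterI) auto
        then show ?thesis using zM x by (intro less.hyps) auto
      qed
      moreover have "fls_const (- 1) * (fls_const (- c) * y) \<in> M" by (rule scale) (rule cy)
      ultimately have "?z + fls_const (- 1) * (fls_const (- c) * y) \<in> M" by (rule add)
      moreover have "?z + fls_const (- 1) * (fls_const (- c) * y) = x"
        by (simp flip: fls_const_uminus add: mult.assoc[symmetric] distrib_right[symmetric] fls_plus_const)
      ultimately show ?thesis by simp
    qed
  qed
qed

locale numerical_semigroup_ring =
  fixes H :: "int set" and c :: int and R :: "'k::field fls ring"
  assumes zero_in: "0 \<in> H" and plus_in: "\<And>x y. x \<in> H \<Longrightarrow> y \<in> H \<Longrightarrow> x + y \<in> H"
    and nonneg: "\<And>x. x \<in> H \<Longrightarrow> 0 \<le> x" and conductor: "\<And>x. c \<le> x \<Longrightarrow> x \<in> H"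
    and R_eq: "R = semigroup_ring H"
begin

lemma R_simps [simp]:
  "carrier R = series_on H" "mult R = (*)" "one R = 1" "zero R = 0" "add R = (+)"
  by (auto simp: R_eq semigroup_ring_def fls_ring_def series_on_def)

lemma R_mult: "x \<in> series_on H \<Longrightarrow> y \<in> series_on H \<Longrightarrow> x * y \<in> series_on H"
  by (rule series_on_mult) (auto intro: plus_in)

lemma cring_R: "cring R"
proof (rule cringI)
  show "abelian_group R"
  proof (rule abelian_groupI)
    fix x assume "x \<in> carrier R"
    then show "\<exists>y\<in>carrier R. y \<oplus>\<^bsub>R\<^esub> x = \<zero>\<^bsub>R\<^esub>"
      by (intro bexI[of _ "- x"]) (auto intro: series_on_uminus)
  qed (auto intro: series_on_add)
  show "comm_monoid R"
    by (rule comm_monoidI) (auto intro: R_mult zero_in)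
qed (auto simp: algebra_simps)

sublocale R: cring R by (rule cring_R)

lemma pow_R [simp]: "x [^]\<^bsub>R\<^esub> (n::nat) = x ^ n"
  by (induction n) (auto simp: mult.commute)

lemma minus_R: "x \<in> series_on H \<Longrightarrow> \<ominus>\<^bsub>R\<^esub> x = - x"
  by (rule R.minus_equality) (auto intro: series_on_uminus)

text \<open>
  The \<open>R\<close>-submodules of \<open>k((t))\<close>. Ideals of \<open>R\<close> and submodules of fractional ideals are the ones inside the
  respective set (\<open>ideal_iff\<close>, \<open>submodule_fls_iff\<close>).
\<close>

definition Rmod :: "'k fls set \<Rightarrow> bool" where
  "Rmod S \<longleftrightarrow> 0 \<in> S \<and> (\<forall>x\<in>S. \<forall>y\<in>S. x + y \<in> S) \<and> (\<forall>r\<in>series_on H. \<forall>x\<in>S. r * x \<in> S)"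

lemma RmodD:
  assumes "Rmod S"
  shows "0 \<in> S" "x \<in> S \<Longrightarrow> y \<in> S \<Longrightarrow> x + y \<in> S" "r \<in> series_on H \<Longrightarrow> x \<in> S \<Longrightarrow> r * x \<in> S"
    "x \<in> S \<Longrightarrow> - x \<in> S" "x \<in> S \<Longrightarrow> y \<in> S \<Longrightarrow> x - y \<in> S" "x \<in> S \<Longrightarrow> fls_const a * x \<in> S"
proof -
  show 1: "0 \<in> S" "x \<in> S \<Longrightarrow> y \<in> S \<Longrightarrow> x + y \<in> S" "r \<in> series_on H \<Longrightarrow> x \<in> S \<Longrightarrow> r * x \<in> S" for x y r
    using assms by (auto simp: Rmod_def)
  show 2: "- x \<in> S" if "x \<in> S" for x
    using 1(3)[of "- 1" x] that series_on_uminus[of 1 H] zero_in by simp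
  show "x \<in> S \<Longrightarrow> y \<in> S \<Longrightarrow> x - y \<in> S" using 1(2)[of x "- y"] 2[of y] by simp
  show "x \<in> S \<Longrightarrow> fls_const a * x \<in> S"
    by (rule 1(3)) (auto intro: fls_const_in_series_on zero_in)
qed

lemma Rmod_sum: "Rmod S \<Longrightarrow> (\<And>b. b \<in> B \<Longrightarrow> f b \<in> S) \<Longrightarrow> sum f B \<in> S"
  by (induction B rule: infinite_finite_induct) (auto intro: RmodD)

lemma Rmod_series_on: "(\<And>h a. h \<in> H \<Longrightarrow> a \<in> A \<Longrightarrow> h + a \<in> A) \<Longrightarrow> Rmod (series_on A)"
  by (auto simp: Rmod_def intro: series_on_add series_on_mult)

lemma Rmod_R: "Rmod (series_on H)"
  by (rule Rmod_series_on) (rule plus_in)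

lemma self_module_eq: "self_module R = fls_module (series_on H)"
  by (simp add: self_module_def fls_module_def)

lemma module_fls: "Rmod S \<Longrightarrow> module R (fls_module S)"
proof (rule moduleI)
  assume S: "Rmod S"
  show "abelian_group (fls_module S)"
  proof (rule abelian_groupI)
    fix x assume "x \<in> carrier (fls_module S)"
    then show "\<exists>y\<in>carrier (fls_module S). y \<oplus>\<^bsub>fls_module S\<^esub> x = \<zero>\<^bsub>fls_module S\<^esub>"
      using S by (intro bexI[of _ "- x"]) (auto simp: fls_module_def intro: RmodD)
  qed (use S in \<open>auto simp: fls_module_def intro: RmodD\<close>)
qed (auto simp: fls_module_def algebra_simps cring_R intro: RmodD)

lemma submodule_fls_iff:
  assumes "Rmod S"
  shows "submodule N R (fls_module S) \<longleftrightarrow> Rmod N \<and> N \<subseteq> S"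
proof -
  interpret module R "fls_module S" by (rule module_fls[OF assms])
  have inv: "\<ominus>\<^bsub>fls_module S\<^esub> x = - x" if "x \<in> S" for x
    by (rule minus_equality) (use that assms in \<open>auto simp: fls_module_def intro: RmodD\<close>)
  show ?thesis
  proof
    assume N: "submodule N R (fls_module S)"
    interpret N: submodule N R "fls_module S" by (rule N)
    show "Rmod N \<and> N \<subseteq> S"
      using submoduleE[OF N] N.subgroup_axioms subgroup.one_closed[OF N.subgroup_axioms]
      by (auto simp: Rmod_def fls_module_def)
  next
    assume "Rmod N \<and> N \<subseteq> S"
    then show "submodule N R (fls_module S)"
      by (intro submoduleI) (auto simp: inv subset_iff, auto simp: fls_module_def intro: RmodD)
  qed
qed

lemma ideal_iff: "ideal I R \<longleftrightarrow> Rmod I \<and> I \<subseteq> series_on H"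
proof
  assume "ideal I R"
  then interpret I: ideal I R .
  show "Rmod I \<and> I \<subseteq> series_on H"
    using I.zero_closed I.a_closed I.I_l_closed I.a_subset by (auto simp: Rmod_def)
next
  assume I: "Rmod I \<and> I \<subseteq> series_on H"
  show "ideal I R"
  proof (rule idealI)
    show "subgroup I (add_monoid R)"
    proof (rule R.add.subgroupI)
      show "I \<noteq> {}" using I RmodD(1) by blast
      fix x assume "x \<in> I"
      then show "\<ominus>\<^bsub>R\<^esub> x \<in> I" using I minus_R[of x] RmodD(4)[of I x] by auto
    qed (use I in \<open>auto intro: RmodD\<close>)
    show "ring R" by (rule R.ring_axioms)
    fix a x assume "a \<in> I" "x \<in> carrier R"
    then show "x \<otimes>\<^bsub>R\<^esub> a \<in> I" "a \<otimes>\<^bsub>R\<^esub> x \<in> I" using I RmodD(3)[of I x a] by (auto simp: mult.commute)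
  qed
qed

text \<open>
  Split the inverse \<open>g + g'\<close> into its parts with exponents in \<open>H\<close> and outside. Then \<open>xg' = 1 - xg\<close> has
  exponents in \<open>H\<close>, yet its order is that of \<open>g'\<close>.
\<close>

lemma inverse_in:
  assumes "x \<in> series_on H" "fls_nth x 0 \<noteq> 0"
  shows "inverse x \<in> series_on H"
proof -
  have x: "x \<noteq> 0" "fls_subdegree x = 0"
    using assms nonneg by (auto intro!: fls_subdegree_eqI dest: series_onD simp: linorder_not_le[symmetric])
  have "inverse x \<in> series_on (H \<union> UNIV)" by (simp add: series_on_def)
  then obtain g g' where g: "inverse x = g + g'" "g \<in> series_on H" "g' \<in> series_on (UNIV - H)"
    by (rule series_on_split)
  have "x * g' = 1 - x * g"
    using x g(1) by (metis add_diff_cancel_left' distrib_left right_inverse)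
  then have 1: "x * g' \<in> series_on H"
    using assms g by (auto intro!: series_on_diff R_mult zero_in)
  have "g' = 0"
  proof (rule ccontr)
    assume "g' \<noteq> 0"
    then have "fls_subdegree g' \<in> H" "fls_subdegree g' \<notin> H"
      using order_in[OF 1] x order_in[OF g(3)] by auto
    then show False by simp
  qed
  then show ?thesis using g by simp
qed

definition mm :: "'k fls set" where "mm = series_on (H - {0})"

lemma mm_iff: "x \<in> mm \<longleftrightarrow> x \<in> series_on H \<and> fls_nth x 0 = 0"
  by (auto simp: mm_def series_on_def)

lemma mm_add: "x \<in> mm \<Longrightarrow> y \<in> mm \<Longrightarrow> x + y \<in> mm"
  by (auto simp: mm_def intro: series_on_add)

lemma Rmod_mm: "Rmod mm"
  unfolding mm_def
proof (rule Rmod_series_on)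
  fix h a assume "h \<in> H" "a \<in> H - {0}"
  then show "h + a \<in> H - {0}" using nonneg[of h] nonneg[of a] plus_in[of h a] by auto
qed

lemma proper_ideal_subset_mm:
  assumes "Rmod I" "I \<subseteq> series_on H" "1 \<notin> I"
  shows "I \<subseteq> mm"
proof
  fix x assume x: "x \<in> I"
  have "fls_nth x 0 = 0"
  proof (rule ccontr)
    assume n: "fls_nth x 0 \<noteq> 0"
    then have "inverse x * x \<in> I" using x assms by (intro RmodD(3)[OF assms(1)] inverse_in) auto
    moreover have "x \<noteq> 0" using n by auto
    ultimately show False using assms by simp
  qed
  then show "x \<in> mm" using x assms by (auto simp: mm_iff)
qed

lemma ideal_carrierI: "Rmod I \<Longrightarrow> I \<subseteq> series_on H \<Longrightarrow> 1 \<in> I \<Longrightarrow> I = series_on H"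
  using RmodD(3)[of I _ 1] by auto

lemma maximalideal_mm: "maximalideal mm R"
proof (rule maximalidealI)
  show "ideal mm R" using Rmod_mm by (auto simp: ideal_iff mm_iff)
  have "1 \<in> carrier R" "1 \<notin> mm" using zero_in by (auto simp: mm_iff)
  then show "carrier R \<noteq> mm" by blast
  fix J assume J: "ideal J R" "mm \<subseteq> J" "J \<subseteq> carrier R"
  then show "J = mm \<or> J = carrier R"
    using proper_ideal_subset_mm[of J] ideal_carrierI[of J] by (auto simp: ideal_iff)
qed

lemma maximalideal_unique: "maximalideal M R \<Longrightarrow> M = mm"
proof -
  assume "maximalideal M R"
  then interpret M: maximalideal M R .
  have M: "Rmod M" "M \<subseteq> series_on H" using M.is_ideal by (auto simp: ideal_iff)
  then have "M \<subseteq> mm" using proper_ideal_subset_mm[of M] ideal_carrierI[of M] M.I_notcarr by auto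
  moreover have "ideal mm R" "mm \<subseteq> carrier R"
    using maximalideal_mm by (auto simp: maximalideal_def mm_iff)
  ultimately have "mm = M \<or> mm = carrier R" using M.I_maximal[of mm] by blast
  then show ?thesis using maximalideal.I_notcarr[OF maximalideal_mm] by auto
qed

lemma local_ring_R: "local_ring R"
  unfolding local_ring_def using cring_R maximalideal_mm maximalideal_unique by blast

lemma max_ideal_R: "max_ideal R = mm"
  unfolding max_ideal_def using maximalideal_mm maximalideal_unique by (rule the_equality)

lemma mm_power: "x \<in> mm \<Longrightarrow> x ^ n \<in> series_on {int n..}"
proof (induction n)
  case (Suc n)
  show ?case unfolding power_Suc
  proof (rule series_on_mult[of _ "H - {0}" _ "{int n..}"])
    show "x \<in> series_on (H - {0})" using Suc.prems by (simp add: mm_def)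
    fix a b assume "a \<in> H - {0}" "b \<in> {int n..}"
    then show "a + b \<in> {int (Suc n)..}" using nonneg[of a] by auto
  qed (use Suc in auto)
qed simp

text \<open>
  An element outside the maximal ideal is a unit, and high powers of an element of the maximal ideal have
  order at least \<open>N\<close>.
\<close>

lemma m_primaryI:
  assumes I: "Rmod I" "I \<subseteq> mm" and N: "series_on {N..} \<subseteq> I"
  shows "m_primary R I"
proof -
  have IH: "I \<subseteq> series_on H" using I by (auto simp: mm_iff)
  have rad: "radical R I = mm"
  proof (intro equalityI subsetI)
    fix x assume "x \<in> radical R I"
    then obtain n where x: "x \<in> series_on H" "x ^ n \<in> I" by (auto simp: radical_def)
    show "x \<in> mm"
    proof (rule ccontr)
      assume "x \<notin> mm"
      then have nz: "fls_nth x 0 \<noteq> 0" using x by (auto simp: mm_iff)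
      then have "inverse x \<in> series_on H" using x by (intro inverse_in)
      then have "inverse x ^ n \<in> series_on H" by (induction n) (auto intro: R_mult zero_in)
      then have "inverse x ^ n * x ^ n \<in> I" using x I by (intro RmodD)
      moreover have "x \<noteq> 0" using nz by auto
      ultimately have "1 \<in> I" by (simp add: power_inverse)
      then show False using I by (auto simp: mm_iff)
    qed
  next
    fix x assume x: "x \<in> mm"
    then have "x ^ nat N \<in> series_on {int (nat N)..}" by (rule mm_power)
    also have "\<dots> \<subseteq> series_on {N..}" by (rule series_on_mono) auto
    finally show "x \<in> radical R I" using x N by (auto simp: radical_def mm_iff)
  qed
  show ?thesis unfolding m_primary_def
  proof (intro conjI ballI impI)
    show "ideal I R" using I IH by (simp add: ideal_iff)
    have "1 \<in> carrier R" "1 \<notin> I" using I zero_in by (auto simp: mm_iff)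
    then show "I \<noteq> carrier R" by blast
    show "radical R I = max_ideal R" by (simp add: rad max_ideal_R)
    fix x y assume xy: "x \<in> carrier R" "y \<in> carrier R" "x \<otimes>\<^bsub>R\<^esub> y \<in> I"
    show "x \<in> I \<or> y \<in> radical R I"
    proof (cases "y \<in> mm")
      case False
      then have y: "fls_nth y 0 \<noteq> 0" using xy by (auto simp: mm_iff)
      then have "inverse y * (x * y) \<in> I" using xy by (intro RmodD(3)[OF I(1) inverse_in]) auto
      moreover have "y \<noteq> 0" using y by auto
      ultimately show ?thesis by (simp add: field_simps)
    qed (simp add: rad)
  qed
qed

lemma m_primaryD:
  assumes "m_primary R I"
  shows "Rmod I" "I \<subseteq> mm"
proof -
  show I: "Rmod I" using assms by (auto simp: m_primary_def ideal_iff)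
  show "I \<subseteq> mm"
    using assms by (intro proper_ideal_subset_mm I) (auto simp: m_primary_def ideal_iff dest: ideal_carrierI)
qed

text \<open>
  A prime ideal that contains all series of high order contains powers of every element of the maximal
  ideal, so it is the maximal ideal.
\<close>

lemma mod_dim_zero:
  assumes "series_on {N..} \<subseteq> annihilator R M"
  shows "mod_dim R M = 0"
proof -
  have "n = 0" if P: "\<forall>i\<le>n. primeideal (P i) R" "\<forall>i<n. P i \<subset> P (Suc i)" "annihilator R M \<subseteq> P 0" for n P
  proof (rule ccontr)
    assume "n \<noteq> 0"
    then have pr: "primeideal (P 0) R" "primeideal (P 1) R" and lt: "P 0 \<subset> P 1" using P by auto
    interpret P0: primeideal "P 0" R by (rule pr)
    interpret P1: primeideal "P 1" R by (rule pr)
    have "P 1 \<subseteq> mm"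
      using P1.is_ideal P1.I_notcarr ideal_carrierI by (intro proper_ideal_subset_mm) (auto simp: ideal_iff)
    moreover have "mm \<subseteq> P 0"
    proof
      fix x assume x: "x \<in> mm"
      then have "x ^ nat N \<in> series_on {int (nat N)..}" by (rule mm_power)
      also have "\<dots> \<subseteq> series_on {N..}" by (rule series_on_mono) auto
      finally have m: "x ^ nat N \<in> P 0" using assms P by blast
      have "x ^ k \<in> P 0 \<Longrightarrow> x \<in> P 0" for k
      proof (induction k)
        case 0
        have "1 \<notin> P 0" using P0.I_notcarr P0.is_ideal ideal_carrierI by (auto simp: ideal_iff)
        then show ?case using 0 by simp
      next
        case (Suc k)
        have "x \<in> series_on H" using x by (simp add: mm_iff)
        moreover from this have "x ^ k \<in> series_on H" by (induction k) (auto intro: R_mult zero_in)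
        ultimately show ?case using P0.I_prime[of x "x ^ k"] Suc by auto
      qed
      then show "x \<in> P 0" using m by blast
    qed
    ultimately show False using lt by blast
  qed
  then have "{enat n | n. \<exists>P. (\<forall>i\<le>n. primeideal (P i) R) \<and> (\<forall>i<n. P i \<subset> P (Suc i)) \<and>
     annihilator R M \<subseteq> P 0} \<subseteq> {0}" by (auto simp: zero_enat_def)
  then have "mod_dim R M \<le> Sup {0}" unfolding mod_dim_def by (rule Sup_subset_mono)
  then show ?thesis by simp
qed

end

section \<open>Length and freeness for submodules of Laurent series\<close>

lemma enat_Sup_attained:
  assumes "Sup {enat n | n. P n} = enat m" "P k"
  shows "P m"
proof -
  let ?A = "{enat n | n. P n}"
  have ne: "?A \<noteq> {}" using assms(2) by blast
  have "finite ?A" using assms(1) ne by (auto simp: Sup_enat_def split: if_splits)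
  moreover from this have "Max ?A = enat m" using assms(1) ne by (auto simp: Sup_enat_def split: if_splits)
  ultimately have "enat m \<in> ?A" using Max_in[of ?A] ne by simp
  then show ?thesis by auto
qed

text \<open>
  A chain of maximal length above \<open>Z'\<close> could be extended downwards by \<open>Z\<close>.
\<close>

lemma mod_length_above_strict:
  assumes Z: "submodule Z R M" "submodule Z' R M" "Z \<subseteq> Z'"
    and eq: "mod_length_above R M Z' = mod_length_above R M Z" "mod_length_above R M Z \<noteq> \<infinity>"
  shows "Z' = Z"
proof (rule ccontr)
  assume ne: "Z' \<noteq> Z"
  let ?P = "\<lambda>Z n. \<exists>L. (\<forall>i\<le>n. submodule (L i) R M \<and> Z \<subseteq> L i) \<and> (\<forall>i<n. L i \<subset> L (Suc i))"
  obtain m where m: "mod_length_above R M Z = enat m" using eq(2) by auto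
  have 0: "?P Z' 0" using Z(2) by (intro exI[of _ "\<lambda>_. Z'"]) simp
  have "Sup {enat n | n. ?P Z' n} = enat m" using eq(1) m by (simp only: mod_length_above_def)
  from enat_Sup_attained[where P = "?P Z'", OF this 0] obtain L where L: "\<And>i. i \<le> m \<Longrightarrow> submodule (L i) R M \<and> Z' \<subseteq> L i" "\<And>i. i < m \<Longrightarrow> L i \<subset> L (Suc i)" by blast
  have "?P Z (Suc m)"
  proof (intro exI[of _ "\<lambda>i. case i of 0 \<Rightarrow> Z | Suc j \<Rightarrow> L j"] conjI allI impI)
    fix i assume "i \<le> Suc m"
    then show "submodule (case i of 0 \<Rightarrow> Z | Suc j \<Rightarrow> L j) R M" "Z \<subseteq> (case i of 0 \<Rightarrow> Z | Suc j \<Rightarrow> L j)"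
      using L(1)[of "i - 1"] Z by (cases i; simp; blast)+
  next
    fix i assume "i < Suc m"
    then show "(case i of 0 \<Rightarrow> Z | Suc j \<Rightarrow> L j) \<subset> (case Suc i of 0 \<Rightarrow> Z | Suc j \<Rightarrow> L j)"
      using L(1)[of 0] L(2)[of "i - 1"] Z ne by (cases i) auto
  qed
  then have "enat (Suc m) \<le> mod_length_above R M Z"
    unfolding mod_length_above_def by (intro Sup_upper) blast
  then show False using m by simp
qed

lemma fls_module_simps [simp]:
  "carrier (fls_module S) = S" "zero (fls_module S) = 0" "add (fls_module S) = (+)"
  "smult (fls_module S) = (*)"
  by (simp_all add: fls_module_def)

context numerical_semigroup_ring begin

lemma finsum_fls:
  assumes S: "Rmod S" shows "finite F \<Longrightarrow> f \<in> F \<rightarrow> S \<Longrightarrow> finsum (fls_module S) f F = sum f F"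
proof -
  interpret module R "fls_module S" by (rule module_fls[OF S])
  show "finite F \<Longrightarrow> f \<in> F \<rightarrow> S \<Longrightarrow> finsum (fls_module S) f F = sum f F"
  proof (induction F rule: finite_induct)
    case empty
    show ?case using M.finsum_empty[of f] by simp
  next
    case (insert x F)
    have "finsum (fls_module S) f (insert x F) = f x \<oplus>\<^bsub>fls_module S\<^esub> finsum (fls_module S) f F"
      using insert by (intro M.finsum_insert) auto
    then show ?case using insert by simp
  qed
qed

lemma minus_fls:
  assumes "Rmod S" "x \<in> S" "y \<in> S" shows "x \<ominus>\<^bsub>fls_module S\<^esub> y = x - y"
proof -
  interpret module R "fls_module S" by (rule module_fls[OF assms(1)])
  have "\<ominus>\<^bsub>fls_module S\<^esub> y = - y"
    by (rule minus_equality) (use assms in \<open>auto intro: RmodD\<close>)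
  then show ?thesis by (simp add: M.minus_eq)
qed

lemma fls_combination:
  assumes "Rmod S" "finite F" "F \<subseteq> S" "e \<in> F \<rightarrow> series_on H"
  shows "(\<Oplus>\<^bsub>fls_module S\<^esub>y\<in>F. e y \<odot>\<^bsub>fls_module S\<^esub> y) = (\<Sum>y\<in>F. e y * y)" "(\<Sum>y\<in>F. e y * y) \<in> S"
proof -
  have 1: "e y * y \<in> S" if "y \<in> F" for y using assms that by (intro RmodD) auto
  have "(\<lambda>y. e y \<odot>\<^bsub>fls_module S\<^esub> y) = (\<lambda>y. e y * y)" by simp
  then show "(\<Oplus>\<^bsub>fls_module S\<^esub>y\<in>F. e y \<odot>\<^bsub>fls_module S\<^esub> y) = (\<Sum>y\<in>F. e y * y)"
    using assms 1 by (simp only:) (intro finsum_fls; auto)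
  show "(\<Sum>y\<in>F. e y * y) \<in> S" using assms(1) 1 by (rule Rmod_sum)
qed

lemma Rmod_vimage:
  assumes "Rmod S" "semilinear_surj R (fls_module S) R C (\<lambda>r. r) h" "submodule L R C"
  shows "Rmod {x \<in> S. h x \<in> L}"
  using semilinear_surj.submodule_vimage[OF assms(2,3)] submodule_fls_iff[OF assms(1)]
  by simp

text \<open>
  Composing \<open>S \<rightarrow> C\<close> with the reduction \<open>C \<rightarrow> C / IC\<close> moves the study of \<open>C / IC\<close> to series in \<open>S\<close>, for any
  presentation of \<open>C\<close> as a quotient.
\<close>

lemma surj_onto_reduction:
  assumes "semilinear_surj R (fls_module S) R C (\<lambda>r. r) h" "ideal I R"
  shows "semilinear_surj R (fls_module S) (R Quot I) (mod_reduction R C I) ((+>\<^bsub>R\<^esub>) I)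
     (\<lambda>x. ideal_smult R C I (carrier C) +>\<^bsub>C\<^esub> h x)"
    and "semilinear_surj.ker (fls_module S) (mod_reduction R C I) (\<lambda>x. ideal_smult R C I (carrier C) +>\<^bsub>C\<^esub> h x) = {x \<in> S. h x \<in> ideal_smult R C I (carrier C)}"
proof -
  let ?\<psi> = "\<lambda>x. ideal_smult R C I (carrier C) +>\<^bsub>C\<^esub> h x"
  interpret h: semilinear_surj R "fls_module S" R C "\<lambda>r. r" h by fact
  interpret I: ideal I R by fact
  have N: "submodule (ideal_smult R C I (carrier C)) R C"
    using I.a_subset by (intro h.N.ideal_smult_submodule) auto
  show 1: "semilinear_surj R (fls_module S) (R Quot I) (mod_reduction R C I) ((+>\<^bsub>R\<^esub>) I) ?\<psi>"
    using semilinear_surj_comp[OF assms(1) h.N.mod_reduction_surj[OF assms(2)]] by simp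
  interpret p: semilinear_surj R "fls_module S" "R Quot I" "mod_reduction R C I" "(+>\<^bsub>R\<^esub>) I" ?\<psi> by fact
  have "\<zero>\<^bsub>mod_reduction R C I\<^esub> = ideal_smult R C I (carrier C)" by (simp add: mod_reduction_def Let_def)
  moreover have "ideal_smult R C I (carrier C) +>\<^bsub>C\<^esub> h x = ideal_smult R C I (carrier C) \<longleftrightarrow>
      h x \<in> ideal_smult R C I (carrier C)" if "x \<in> S" for x
    by (rule h.N.submodule_coset_eq_iff[OF N]) (use that in \<open>simp\<close>)
  ultimately show "p.ker = {x \<in> S. h x \<in> ideal_smult R C I (carrier C)}"
    unfolding p.ker_def by (simp cong: conj_cong)
qed

lemma ideal_coset_zero_iff:
  assumes "ideal I R" "x \<in> series_on H" shows "I +>\<^bsub>R\<^esub> x = \<zero>\<^bsub>R Quot I\<^esub> \<longleftrightarrow> x \<in> I"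
proof -
  interpret I: ideal I R by fact
  show ?thesis using I.a_rcos_self[of x] I.a_rcos_const[of x] assms(2) by (auto simp: FactRing_def)
qed

lemma free_reduction_basis:
  assumes S: "Rmod S" and h: "semilinear_surj R (fls_module S) R C (\<lambda>r. r) h" and I: "ideal I R"
    and free: "free_module (R Quot I) (mod_reduction R C I)"
    and Z: "Z = {x \<in> S. h x \<in> ideal_smult R C I (carrier C)}"
  obtains X where "X \<subseteq> S"
    "\<And>x. x \<in> S \<Longrightarrow> \<exists>F e. finite F \<and> F \<subseteq> X \<and> e \<in> F \<rightarrow> series_on H \<and> x - (\<Sum>y\<in>F. e y * y) \<in> Z"
    "\<And>F e y. finite F \<Longrightarrow> F \<subseteq> X \<Longrightarrow> e \<in> F \<rightarrow> series_on H \<Longrightarrow> (\<Sum>y\<in>F. e y * y) \<in> Z \<Longrightarrow> y \<in> F \<Longrightarrow> e y \<in> I"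
proof -
  let ?\<psi> = "\<lambda>x. ideal_smult R C I (carrier C) +>\<^bsub>C\<^esub> h x"
  interpret p: semilinear_surj R "fls_module S" "R Quot I" "mod_reduction R C I" "(+>\<^bsub>R\<^esub>) I" ?\<psi>
    by (rule surj_onto_reduction(1)[OF h I])
  have ker: "p.ker = Z" using surj_onto_reduction(2)[OF h I] Z by simp
  have cS: "carrier (fls_module S) = S" by simp
  obtain X where X: "X \<subseteq> S"
    "\<And>x. x \<in> S \<Longrightarrow> \<exists>F e. finite F \<and> F \<subseteq> X \<and> e \<in> F \<rightarrow> series_on H \<and>
       x \<ominus>\<^bsub>fls_module S\<^esub> (\<Oplus>\<^bsub>fls_module S\<^esub>y\<in>F. e y \<odot>\<^bsub>fls_module S\<^esub> y) \<in> Z"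
    "\<And>F e y. finite F \<Longrightarrow> F \<subseteq> X \<Longrightarrow> e \<in> F \<rightarrow> series_on H \<Longrightarrow>
       (\<Oplus>\<^bsub>fls_module S\<^esub>y\<in>F. e y \<odot>\<^bsub>fls_module S\<^esub> y) \<in> Z \<Longrightarrow> y \<in> F \<Longrightarrow> I +>\<^bsub>R\<^esub> e y = \<zero>\<^bsub>R Quot I\<^esub>"
    using p.free_module_lift_basis[OF free] unfolding ker cS R_simps by blast
  show thesis
  proof (rule that[OF X(1)])
    fix x assume x: "x \<in> S"
    obtain F e where F: "finite F" "F \<subseteq> X" "e \<in> F \<rightarrow> series_on H"
      "x \<ominus>\<^bsub>fls_module S\<^esub> (\<Oplus>\<^bsub>fls_module S\<^esub>y\<in>F. e y \<odot>\<^bsub>fls_module S\<^esub> y) \<in> Z" using X(2)[OF x] by blast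
    have "F \<subseteq> S" using F X by blast
    note * = fls_combination[OF S F(1) this F(3)]
    show "\<exists>F e. finite F \<and> F \<subseteq> X \<and> e \<in> F \<rightarrow> series_on H \<and> x - (\<Sum>y\<in>F. e y * y) \<in> Z"
      using F(4) unfolding *(1) minus_fls[OF S x *(2)] using F by blast
  next
    fix F e y assume F: "finite F" "F \<subseteq> X" "e \<in> F \<rightarrow> series_on H" and 0: "(\<Sum>y\<in>F. e y * y) \<in> Z" and y: "y \<in> F"
    have "F \<subseteq> S" using F X by blast
    note * = fls_combination[OF S F(1) this F(3)]
    have "I +>\<^bsub>R\<^esub> e y = \<zero>\<^bsub>R Quot I\<^esub>" using X(3)[OF F _ y] 0 unfolding *(1) by blast
    then show "e y \<in> I" using ideal_coset_zero_iff[OF I] F y by blast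
  qed
qed

lemma free_reductionI:
  assumes S: "Rmod S" and h: "semilinear_surj R (fls_module S) R C (\<lambda>r. r) h" and I: "ideal I R" "1 \<notin> I"
    and Z: "Z = {x \<in> S. h x \<in> ideal_smult R C I (carrier C)}" and X: "finite X" "X \<subseteq> S"
    and span: "\<And>x. x \<in> S \<Longrightarrow> \<exists>e \<in> X \<rightarrow> series_on H. x - (\<Sum>y\<in>X. e y * y) \<in> Z"
    and indep: "\<And>e y. e \<in> X \<rightarrow> series_on H \<Longrightarrow> (\<Sum>y\<in>X. e y * y) \<in> Z \<Longrightarrow> y \<in> X \<Longrightarrow> e y \<in> I"
  shows "free_module (R Quot I) (mod_reduction R C I)"
proof -
  let ?\<psi> = "\<lambda>x. ideal_smult R C I (carrier C) +>\<^bsub>C\<^esub> h x"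
  interpret p: semilinear_surj R "fls_module S" "R Quot I" "mod_reduction R C I" "(+>\<^bsub>R\<^esub>) I" ?\<psi>
    by (rule surj_onto_reduction(1)[OF h I(1)])
  have ker: "p.ker = Z" using surj_onto_reduction(2)[OF h I(1)] Z by simp
  have cS: "carrier (fls_module S) = S" by simp
  show ?thesis
  proof (rule p.free_moduleI_basis[OF X(1)], unfold ker cS R_simps)
    show "X \<subseteq> S" by (rule X(2))
    show "inj_on ?\<psi> X"
    proof (rule inj_onI, rule ccontr)
      fix x y assume xy: "x \<in> X" "y \<in> X" "?\<psi> x = ?\<psi> y" "x \<noteq> y"
      then have "x \<ominus>\<^bsub>fls_module S\<^esub> y \<in> Z"
        using p.phi_eq_iff[of x y, unfolded ker cS] X(2) by blast
      then have "x - y \<in> Z" using minus_fls[OF S] xy X(2) by (metis subsetD)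
      moreover define e where "e = (\<lambda>z :: 'k fls. if z = x then 1 else if z = y then - 1 else 0 :: 'k fls)"
      have "(\<Sum>z\<in>X. e z * z) = (\<Sum>z\<in>{x, y}. e z * z)"
        using xy X(1) by (intro sum.mono_neutral_right) (auto simp: e_def)
      then have "(\<Sum>z\<in>X. e z * z) = x - y" using xy by (simp add: e_def)
      ultimately have "e x \<in> I" using xy zero_in
        by (intro indep) (auto simp: e_def intro!: series_on_uminus)
      then show False using I(2) by (simp add: e_def)
    qed
  next
    fix x assume x: "x \<in> S"
    obtain e where e: "e \<in> X \<rightarrow> series_on H" "x - (\<Sum>y\<in>X. e y * y) \<in> Z" using span[OF x] by blast
    note * = fls_combination[OF S X e(1)]
    show "\<exists>e\<in>X \<rightarrow> series_on H. x \<ominus>\<^bsub>fls_module S\<^esub> (\<Oplus>\<^bsub>fls_module S\<^esub>y\<in>X. e y \<odot>\<^bsub>fls_module S\<^esub> y) \<in> Z"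
    proof (rule bexI[of _ e])
      show "x \<ominus>\<^bsub>fls_module S\<^esub> (\<Oplus>\<^bsub>fls_module S\<^esub>y\<in>X. e y \<odot>\<^bsub>fls_module S\<^esub> y) \<in> Z"
        unfolding *(1) minus_fls[OF S x *(2)] by (rule e(2))
    qed (rule e(1))
  next
    fix e y assume e: "e \<in> X \<rightarrow> series_on H" and 0: "(\<Oplus>\<^bsub>fls_module S\<^esub>y\<in>X. e y \<odot>\<^bsub>fls_module S\<^esub> y) \<in> Z" and y: "y \<in> X"
    have "e y \<in> I" using indep[OF e _ y] 0 fls_combination(1)[OF S X e] by simp
    then show "I +>\<^bsub>R\<^esub> e y = \<zero>\<^bsub>R Quot I\<^esub>" using ideal_coset_zero_iff[OF I(1)] e y by blast
  qed
qed

lemma mod_length_quot: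
  assumes "Rmod S" "semilinear_surj R (fls_module S) R C (\<lambda>r. r) h" "submodule L R C"
  shows "mod_length R (quot_module C L) = mod_length_above R (fls_module S) {x \<in> S. h x \<in> L}"
proof -
  interpret h: semilinear_surj R "fls_module S" R C "\<lambda>r. r" h by fact
  let ?\<psi> = "\<lambda>x. L +>\<^bsub>C\<^esub> h x"
  interpret p: semilinear_surj R "fls_module S" R "quot_module C L" "\<lambda>r. r" ?\<psi>
    using semilinear_surj_comp[OF assms(2) h.N.quot_module_surj[OF assms(3)]] by simp
  have "\<zero>\<^bsub>quot_module C L\<^esub> = L" by (simp add: quot_module_def)
  moreover have "L +>\<^bsub>C\<^esub> h x = L \<longleftrightarrow> h x \<in> L" if "x \<in> S" for x
    by (rule h.N.submodule_coset_eq_iff[OF assms(3)]) (use that in \<open>simp\<close>)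
  ultimately have "p.ker = {x \<in> S. h x \<in> L}"
    unfolding p.ker_def by (simp cong: conj_cong)
  then show ?thesis using p.mod_length_surj by simp
qed

lemma identity_surj: "Rmod S \<Longrightarrow> semilinear_surj R (fls_module S) R (fls_module S) (\<lambda>r. r) (\<lambda>x. x)"
  by (rule mod_hom_surj) (auto simp: module_fls mod_hom_def)

text \<open>
  By \<open>subspace_eqI_orders\<close> the value sets grow strictly along a chain.
\<close>

lemma chain_length_le:
  assumes S: "Rmod S" and Z: "Z \<subseteq> S" "series_on {N..} \<subseteq> Z" and fin: "finite (orders S - orders Z)"
    and L: "\<And>i. i \<le> n \<Longrightarrow> submodule (L i) R (fls_module S) \<and> Z \<subseteq> L i" "\<And>i. i < n \<Longrightarrow> L i \<subset> L (Suc i)"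
  shows "n \<le> card (orders S - orders Z)"
proof -
  have Lm: "Rmod (L i)" "L i \<subseteq> S" "Z \<subseteq> L i" if "i \<le> n" for i
    using L(1)[OF that] submodule_fls_iff[OF S] by auto
  have "i \<le> n \<Longrightarrow> i \<le> card (orders (L i) - orders Z)" for i
  proof (induction i)
    case (Suc i)
    have "orders (L i) \<noteq> orders (L (Suc i))"
    proof
      assume e: "orders (L i) = orders (L (Suc i))"
      have "L i = L (Suc i)"
        using Suc.prems Lm[of i] Lm[of "Suc i"] L(2)[of i] Z e
        by (intro subspace_eqI_orders[of _ _ N]) (auto intro: RmodD)
      then show False using L(2)[of i] Suc.prems by auto
    qed
    moreover have "orders (L i) \<subseteq> orders (L (Suc i))" using L(2)[of i] Suc.prems by (intro orders_mono) auto
    moreover have "orders Z \<subseteq> orders (L i)" using Lm(3)[of i] Suc.prems by (intro orders_mono) auto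
    ultimately have "orders (L i) - orders Z \<subset> orders (L (Suc i)) - orders Z" by blast
    moreover have "finite (orders (L (Suc i)) - orders Z)"
      using fin orders_mono[OF Lm(2)[OF Suc.prems]] by (rule_tac finite_subset[of _ "orders S - orders Z"]) auto
    ultimately have "card (orders (L i) - orders Z) < card (orders (L (Suc i)) - orders Z)"
      by (intro psubset_card_mono)
    then show ?case using Suc by simp
  qed simp
  from this[of n] have "n \<le> card (orders (L n) - orders Z)" by simp
  also have "\<dots> \<le> card (orders S - orders Z)"
    using fin orders_mono[OF Lm(2)[of n]] by (intro card_mono) auto
  finally show ?thesis .
qed

lemma mod_length_above_le:
  assumes "Rmod S" "Z \<subseteq> S" "series_on {N..} \<subseteq> Z" "finite (orders S - orders Z)"
  shows "mod_length_above R (fls_module S) Z \<le> enat (card (orders S - orders Z))"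
  unfolding mod_length_above_def
proof (rule Sup_least)
  fix x assume "x \<in> {enat n | n. \<exists>L. (\<forall>i\<le>n. submodule (L i) R (fls_module S) \<and> Z \<subseteq> L i) \<and>
     (\<forall>i<n. L i \<subset> L (Suc i))}"
  then obtain n L where x: "x = enat n" and L: "\<And>i. i \<le> n \<Longrightarrow> submodule (L i) R (fls_module S) \<and> Z \<subseteq> L i"
    "\<And>i. i < n \<Longrightarrow> L i \<subset> L (Suc i)" by blast
  show "x \<le> enat (card (orders S - orders Z))" unfolding x enat_ord_simps by (rule chain_length_le[OF assms]) (use L in blast)+
qed

text \<open>
  The largest exponent \<open>b\<close> of \<open>B - A\<close> can be added to \<open>A\<close> first: \<open>h + b\<close> with \<open>h > 0\<close> is in \<open>B\<close> and exceeds
  \<open>b\<close>, so it is already in \<open>A\<close>.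
\<close>

lemma monomial_chain:
  assumes "finite (B - A)" "A \<subseteq> B" "\<And>h a. h \<in> H \<Longrightarrow> a \<in> A \<Longrightarrow> h + a \<in> A" "\<And>h b. h \<in> H \<Longrightarrow> b \<in> B \<Longrightarrow> h + b \<in> B"
  shows "\<exists>L :: nat \<Rightarrow> 'k fls set. (\<forall>i\<le>card (B - A). Rmod (L i) \<and> series_on A \<subseteq> L i \<and> L i \<subseteq> series_on B) \<and>
    (\<forall>i<card (B - A). L i \<subset> L (Suc i))"
  using assms
proof (induction "card (B - A)" arbitrary: A)
  case 0
  then have "B = A" by auto
  then show ?case using Rmod_series_on[of B] 0 by (intro exI[of _ "\<lambda>_. series_on B"]) auto
next
  case (Suc n)
  define b where "b = Max (B - A)"
  have ne: "B - A \<noteq> {}" using Suc.hyps(2) by (metis card.empty Zero_not_Suc)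
  have b: "b \<in> B" "b \<notin> A" and b_max: "\<And>x. x \<in> B - A \<Longrightarrow> x \<le> b"
    using Max_in[OF Suc.prems(1) ne] Max_ge[OF Suc.prems(1)] by (auto simp: b_def)
  have hb: "h + b \<in> insert b A" if "h \<in> H" for h
    using Suc.prems(4)[OF that b(1)] b_max[of "h + b"] nonneg[OF that] by (cases "h + b \<in> A") auto
  have "B - insert b A = (B - A) - {b}" by auto
  then have n: "n = card (B - insert b A)" using Suc.hyps(2) Suc.prems(1) b by simp
  have "\<exists>L. (\<forall>i\<le>card (B - insert b A). Rmod (L i) \<and> series_on (insert b A) \<subseteq> L i \<and> L i \<subseteq> series_on B) \<and>
      (\<forall>i<card (B - insert b A). L i \<subset> L (Suc i))"
  proof (rule Suc.hyps(1)[OF n])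
    show "finite (B - insert b A)" using Suc.prems(1) by (rule rev_finite_subset) blast
    show "insert b A \<subseteq> B" using Suc.prems(2) b by blast
    show "\<And>h a. h \<in> H \<Longrightarrow> a \<in> insert b A \<Longrightarrow> h + a \<in> insert b A" using Suc.prems(3) hb by blast
  qed (rule Suc.prems(4))
  then obtain L where L: "\<And>i. i \<le> n \<Longrightarrow> Rmod (L i) \<and> series_on (insert b A) \<subseteq> L i \<and> L i \<subseteq> series_on B"
      "\<And>i. i < n \<Longrightarrow> L i \<subset> L (Suc i)" unfolding n[symmetric] by blast
  have AB: "series_on A \<subset> (series_on (insert b A) :: 'k fls set)"
  proof -
    have "tpow b \<in> (series_on (insert b A) :: 'k fls set)" "tpow b \<notin> (series_on A :: 'k fls set)"
      using b by simp_all
    then show ?thesis using series_on_mono[of A "insert b A"] by blast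
  qed
  show ?case unfolding Suc.hyps(2)[symmetric]
  proof (intro exI[of _ "\<lambda>i. case i of 0 \<Rightarrow> series_on A | Suc j \<Rightarrow> L j"] conjI allI impI)
    fix i assume "i \<le> Suc n"
    then show "Rmod (case i of 0 \<Rightarrow> series_on A | Suc j \<Rightarrow> L j)"
      "series_on A \<subseteq> (case i of 0 \<Rightarrow> series_on A | Suc j \<Rightarrow> L j)"
      "(case i of 0 \<Rightarrow> series_on A | Suc j \<Rightarrow> L j) \<subseteq> series_on B"
      using L(1)[of "i - 1"] AB Rmod_series_on[of A] Suc.prems(2,3) series_on_mono[of A B]
      by (cases i; simp; blast)+
  next
    fix i assume "i < Suc n"
    then show "(case i of 0 \<Rightarrow> series_on A | Suc j \<Rightarrow> L j) \<subset> (case Suc i of 0 \<Rightarrow> series_on A | Suc j \<Rightarrow> L j)"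
      using L(1)[of 0] L(2)[of "i - 1"] AB by (cases i) auto
  qed
qed

lemma mod_length_above_monomial:
  assumes fin: "finite (B - A)" and sub: "A \<subseteq> B" "{N..} \<subseteq> A"
    and cl: "\<And>h a. h \<in> H \<Longrightarrow> a \<in> A \<Longrightarrow> h + a \<in> A" "\<And>h b. h \<in> H \<Longrightarrow> b \<in> B \<Longrightarrow> h + b \<in> B"
  shows "mod_length_above R (fls_module (series_on B :: 'k fls set)) (series_on A) = enat (card (B - A))"
proof (rule antisym)
  note B = Rmod_series_on[of B, OF cl(2)]
  show "mod_length_above R (fls_module (series_on B :: 'k fls set)) (series_on A) \<le> enat (card (B - A))"
    using mod_length_above_le[of "series_on B" "series_on A" N] B series_on_mono[OF sub(1)] series_on_mono[OF sub(2)] fin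
    by (simp add: orders_series_on)
  obtain L :: "nat \<Rightarrow> 'k fls set" where "\<forall>i\<le>card (B - A). Rmod (L i) \<and> series_on A \<subseteq> L i \<and> L i \<subseteq> series_on B"
    "\<forall>i<card (B - A). L i \<subset> L (Suc i)" using monomial_chain[OF fin sub(1) cl] by blast
  then show "enat (card (B - A)) \<le> mod_length_above R (fls_module (series_on B :: 'k fls set)) (series_on A)"
    unfolding mod_length_above_def using submodule_fls_iff[OF B] by (intro Sup_upper) auto
qed

lemma ideal_smult_subset: "submodule L R C \<Longrightarrow> (\<And>r x. r \<in> I \<Longrightarrow> x \<in> N \<Longrightarrow> r \<odot>\<^bsub>C\<^esub> x \<in> L) \<Longrightarrow> ideal_smult R C I N \<subseteq> L"
  by (auto simp: ideal_smult_def submod_span_def)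

lemma annihilator_high:
  assumes h: "semilinear_surj R (fls_module S) R C (\<lambda>r. r) h"
    and S: "S \<subseteq> series_on {M..}" and N: "series_on {N..} \<inter> S \<subseteq> {x \<in> S. h x = \<zero>\<^bsub>C\<^esub>}" and "Rmod S"
  shows "series_on {max c (N - M)..} \<subseteq> annihilator R C"
proof
  interpret h: semilinear_surj R "fls_module S" R C "\<lambda>r. r" h by fact
  have cS: "carrier (fls_module S) = S" by simp
  fix r :: "'k fls" assume r: "r \<in> series_on {max c (N - M)..}"
  have rH: "r \<in> series_on H"
    using r series_on_mono[of "{max c (N - M)..}" H] conductor by fastforce
  have "r \<odot>\<^bsub>C\<^esub> y = \<zero>\<^bsub>C\<^esub>" if y: "y \<in> carrier C" for y
  proof -
    obtain x where x: "x \<in> S" "y = h x" using h.phi_obtain[OF y] cS by metis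
    have "r * x \<in> series_on {N..}" using r x(1) S by (intro series_on_mult) auto
    moreover have "r * x \<in> S" using rH x assms(4) by (auto intro: RmodD)
    ultimately have "h (r * x) = \<zero>\<^bsub>C\<^esub>" using N by auto
    then show ?thesis using h.phi_smult[of r x] rH x by simp
  qed
  then show "r \<in> annihilator R C" using rH by (simp add: annihilator_def)
qed

text \<open>
  Since \<open>C\<close> is killed by series of high order, it has dimension zero, and \<open>I\<^sup>nC = 0\<close> for large \<open>n\<close>.
  The multiplicity is then the length of \<open>C\<close>. If it equals the length of \<open>C / IC\<close>, then \<open>IC = 0\<close>, because
  these lengths are finite.
\<close>

lemma ulrich_quotient_killed:
  assumes S: "Rmod S" "S \<subseteq> series_on {0..}" and h: "semilinear_surj R (fls_module S) R C (\<lambda>r. r) h"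
    and N: "series_on {N..} \<subseteq> {x \<in> S. h x = \<zero>\<^bsub>C\<^esub>}" and I: "Rmod I" "I \<subseteq> mm"
    and mult: "multiplicity0 R I C = ereal_of_enat (mod_length R (quot_module C (ideal_smult R C I (carrier C))))"
  shows "ideal_smult R C I (carrier C) = {\<zero>\<^bsub>C\<^esub>}"
proof -
  interpret h: semilinear_surj R "fls_module S" R C "\<lambda>r. r" h by fact
  have cS: "carrier (fls_module S) = S" by simp
  have IR: "I \<subseteq> carrier R" using I by (auto simp: mm_iff)
  have zero_sub: "submodule {\<zero>\<^bsub>C\<^esub>} R C" by (rule h.N.submoduleI) auto
  have pow_sub: "submodule (ideal_pow_smult R C I n) R C \<and>
      ideal_pow_smult R C I n \<subseteq> h ` (S \<inter> series_on {int n..})" for n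
  proof (induction n)
    case 0
    have "S \<inter> series_on {0..} = S" using S by auto
    then show ?case using h.phi_surj cS by (simp add: ideal_pow_smult_def h.N.carrier_is_submodule)
  next
    case (Suc n)
    let ?P = "ideal_pow_smult R C I n"
    have P: "ideal_pow_smult R C I (Suc n) = ideal_smult R C I ?P" by (simp add: ideal_pow_smult_def)
    have "Rmod (S \<inter> series_on {int (Suc n)..})"
    proof -
      have "Rmod (series_on {int (Suc n)..})" using nonneg by (intro Rmod_series_on) force
      then show ?thesis using S(1) by (auto simp: Rmod_def)
    qed
    then have sub: "submodule (h ` (S \<inter> series_on {int (Suc n)..})) R C"
      using h.submodule_image submodule_fls_iff[OF S(1)] by auto
    have "r \<odot>\<^bsub>C\<^esub> y \<in> h ` (S \<inter> series_on {int (Suc n)..})" if ry: "r \<in> I" "y \<in> ?P" for r y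
    proof -
      obtain x where x: "x \<in> S" "x \<in> series_on {int n..}" "y = h x" using Suc ry by blast
      have r: "r \<in> series_on (H - {0})" "r \<in> series_on H" using ry I mm_iff[of r] by (auto simp: mm_def)
      have "r * x \<in> series_on {int (Suc n)..}"
      proof (rule series_on_mult[OF r(1) x(2)])
        fix a b assume "a \<in> H - {0}" "b \<in> {int n..}"
        then show "a + b \<in> {int (Suc n)..}" using nonneg[of a] by auto
      qed
      moreover have "r * x \<in> S" using r x S by (auto intro: RmodD)
      moreover have "r \<odot>\<^bsub>C\<^esub> y = h (r * x)" using h.phi_smult[of r x] r x by simp
      ultimately show ?thesis by blast
    qed
    then have "ideal_pow_smult R C I (Suc n) \<subseteq> h ` (S \<inter> series_on {int (Suc n)..})"
      unfolding P by (intro ideal_smult_subset sub)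
    moreover have "submodule (ideal_pow_smult R C I (Suc n)) R C"
      unfolding P using Suc h.N.submoduleE(1) IR by (intro h.N.ideal_smult_submodule) auto
    ultimately show ?case by blast
  qed
  have pow0: "ideal_pow_smult R C I n = {\<zero>\<^bsub>C\<^esub>}" if "N \<le> int n" for n
  proof -
    have "series_on {int n..} \<subseteq> (series_on {N..} :: 'k fls set)" using that by (intro series_on_mono) auto
    then have "ideal_pow_smult R C I n \<subseteq> {\<zero>\<^bsub>C\<^esub>}" using pow_sub[of n] N by blast
    moreover have "\<zero>\<^bsub>C\<^esub> \<in> ideal_pow_smult R C I n"
      using subgroup.one_closed[OF submodule.axioms(1)[OF conjunct1[OF pow_sub[of n]]]] by simp
    ultimately show ?thesis by blast
  qed
  have "mod_dim R C = 0" using annihilator_high[OF h S(2) _ S(1), of N] N by (intro mod_dim_zero) blast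
  then have "multiplicity0 R I C =
      lim (\<lambda>n. ereal_of_enat (mod_length R (quot_module C (ideal_pow_smult R C I (Suc n)))))"
    by (simp add: multiplicity0_def zero_enat_def flip: one_ereal_def)
  also have "\<dots> = ereal_of_enat (mod_length R (quot_module C {\<zero>\<^bsub>C\<^esub>}))"
  proof (rule limI, rule tendsto_eventually)
    show "\<forall>\<^sub>F n in sequentially. ereal_of_enat (mod_length R (quot_module C (ideal_pow_smult R C I (Suc n)))) =
        ereal_of_enat (mod_length R (quot_module C {\<zero>\<^bsub>C\<^esub>}))"
      using eventually_ge_at_top[of "nat N"] by eventually_elim (simp add: pow0)
  qed
  finally have "mod_length R (quot_module C (ideal_smult R C I (carrier C))) = mod_length R (quot_module C {\<zero>\<^bsub>C\<^esub>})"
    using mult ereal_of_enat_le_iff by (metis antisym order_refl)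
  moreover have IC: "submodule (ideal_smult R C I (carrier C)) R C" using IR by (intro h.N.ideal_smult_submodule) auto
  ultimately have eq: "mod_length_above R (fls_module S) {x \<in> S. h x \<in> ideal_smult R C I (carrier C)} =
      mod_length_above R (fls_module S) {x \<in> S. h x \<in> {\<zero>\<^bsub>C\<^esub>}}" (is "mod_length_above R _ ?Z' = mod_length_above R _ ?Z")
    using mod_length_quot[OF S(1) h] zero_sub by simp
  have Zs: "Rmod ?Z" "Rmod ?Z'" "?Z \<subseteq> S" "?Z' \<subseteq> S"
    using Rmod_vimage[OF S(1) h zero_sub] Rmod_vimage[OF S(1) h IC] by auto
  have "orders S - orders ?Z \<subseteq> {0..<N}"
  proof
    fix n assume n: "n \<in> orders S - orders ?Z"
    have "orders (series_on {N..} :: 'k fls set) \<subseteq> orders ?Z" using N by (intro orders_mono) auto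
    moreover have "orders S \<subseteq> orders (series_on {0..} :: 'k fls set)" using S by (intro orders_mono) auto
    ultimately have "n \<notin> {N..}" "n \<in> {0..}" using n unfolding orders_series_on by blast+
    then show "n \<in> {0..<N}" by simp
  qed
  then have "mod_length_above R (fls_module S) ?Z \<le> enat (card (orders S - orders ?Z))"
    using N by (intro mod_length_above_le[OF S(1), of _ N]) (auto intro: finite_subset)
  then have "mod_length_above R (fls_module S) ?Z \<noteq> \<infinity>" using enat_ile by fastforce
  moreover have "?Z \<subseteq> ?Z'" using subgroup.one_closed[OF submodule.axioms(1)[OF IC]] by auto
  ultimately have "?Z' = ?Z"
    using eq Zs submodule_fls_iff[OF S(1)] by (intro mod_length_above_strict[where R = R and M = "fls_module S"]) auto
  have "y = \<zero>\<^bsub>C\<^esub>" if y: "y \<in> ideal_smult R C I (carrier C)" for y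
  proof -
    have "y \<in> carrier C" using y h.N.submoduleE(1)[OF IC] by blast
    then obtain x where "x \<in> carrier (fls_module S)" "y = h x" by (rule h.phi_obtain)
    then have x: "x \<in> S" "y = h x" by simp_all
    then have "x \<in> ?Z'" using y by simp
    then have "x \<in> ?Z" unfolding \<open>?Z' = ?Z\<close> .
    then show ?thesis using x by simp
  qed
  moreover have "\<zero>\<^bsub>C\<^esub> \<in> ideal_smult R C I (carrier C)"
    using subgroup.one_closed[OF submodule.axioms(1)[OF IC]] by simp
  ultimately show ?thesis by blast
qed

end

section \<open>From the GGL property to the semigroup\<close>

locale herzog_ring = herzog_semigroup +
  fixes R :: "'k::field fls ring"
  assumes ring_eq: "R = semigroup_ring H"
begin

sublocale numerical_semigroup_ring H "pf2 + 1" R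
  using semigroup_add semigroup_nonneg above_frobenius ring_eq by unfold_locales auto

abbreviation RR :: "'k fls set" where "RR \<equiv> series_on H"

text \<open>
  The fractional ideal \<open>R + Rt\<^sup>a\<close>, given by its exponents; \<open>canonical_ideal_eq\<close> identifies it with the
  canonical ideal.
\<close>

definition K :: "'k fls set" where "K = series_on (H \<union> (+) shift ` H)"

abbreviation ta :: "'k fls" where "ta \<equiv> tpow shift"

lemma Rmod_K: "Rmod K"
  unfolding K_def
proof (rule Rmod_series_on)
  fix h x assume h: "h \<in> H" and "x \<in> H \<union> (+) shift ` H"
  then consider "x \<in> H" | y where "x = shift + y" "y \<in> H" by blast
  then show "h + x \<in> H \<union> (+) shift ` H"
  proof cases
    case 1 then show ?thesis using semigroup_add[OF h] by blast
  next
    case 2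
    then have "h + x = shift + (h + y)" by simp
    then show ?thesis using semigroup_add[OF h 2(2)] by blast
  qed
qed

lemma R_subset_K: "RR \<subseteq> K"
  unfolding K_def by (rule series_on_mono) blast

lemma one_K: "1 \<in> K" and ta_K: "ta \<in> K"
  using R_subset_K zero_in by (auto simp: K_def)

lemma K_nonneg: "K \<subseteq> series_on {0..}"
  unfolding K_def using semigroup_nonneg shift_pos by (intro series_on_mono) force

lemma K_obtain:
  assumes "x \<in> K" obtains r s where "r \<in> RR" "s \<in> RR" "x = r + s * ta"
proof -
  obtain r y where 1: "x = r + y" "r \<in> RR" "y \<in> series_on ((+) shift ` H - H)"
    using assms unfolding K_def by (rule series_on_split)
  then have "y \<in> series_on ((+) shift ` H)" using series_on_mono by blast
  then obtain s where "y = ta * s" "s \<in> RR" by (rule series_on_shift)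
  then show thesis using 1 that by (metis mult.commute)
qed

lemma K_intro: "r \<in> RR \<Longrightarrow> s \<in> RR \<Longrightarrow> r + s * ta \<in> K"
  using R_subset_K ta_K Rmod_K by (intro RmodD(2)[OF Rmod_K] RmodD(3)[OF Rmod_K]) auto

lemma RR_add: "x \<in> RR \<Longrightarrow> y \<in> RR \<Longrightarrow> x + y \<in> RR" by (rule series_on_add)

lemma conductor_series: "series_on conductor_set = {x \<in> RR. x * ta \<in> RR}"
proof -
  have "x * ta \<in> RR \<longleftrightarrow> x \<in> series_on {n. n + shift \<in> H}" for x
    using tpow_mult_in_series_on[of shift x H] by (simp only: mult.commute)
  then show ?thesis by (auto simp: series_on_def conductor_set_def)
qed

lemma not_in_R: "ta \<notin> RR"
  using shift_notin by simp

lemma RR_nth_neg: "x \<in> RR \<Longrightarrow> n < 0 \<Longrightarrow> fls_nth x n = 0"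
  using semigroup_nonneg series_onD by fastforce

lemma unit_scale:
  assumes "u \<in> RR" "fls_nth u 0 \<noteq> 0" "Rmod S" "u * x \<in> S" shows "x \<in> S"
proof -
  have "inverse u * (u * x) \<in> S" using assms by (intro RmodD(3)[OF assms(3) inverse_in]) auto
  moreover have "u \<noteq> 0" using assms(2) by auto
  ultimately show ?thesis by (simp flip: mult.assoc)
qed

text \<open>
  The submodule \<open>IK\<close> for an ideal \<open>I\<close>, as \<open>K\<close> is generated by \<open>1\<close> and \<open>t\<^sup>a\<close> (\<open>ideal_smult_K\<close>).
\<close>

definition IK :: "'k fls set \<Rightarrow> 'k fls set" where
  "IK I = {x + y * ta | x y. x \<in> I \<and> y \<in> I}"

lemma Rmod_IK: "Rmod I \<Longrightarrow> Rmod (IK I)"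
  unfolding Rmod_def[of "IK I"]
proof (intro conjI ballI)
  assume I: "Rmod I"
  show "0 \<in> IK I" unfolding IK_def using RmodD(1)[OF I] by (auto intro!: exI[of _ 0])
  fix x assume "x \<in> IK I"
  then obtain u v where x: "x = u + v * ta" "u \<in> I" "v \<in> I" unfolding IK_def by blast
  { fix y assume "y \<in> IK I"
    then obtain u' v' where y: "y = u' + v' * ta" "u' \<in> I" "v' \<in> I" unfolding IK_def by blast
    have "x + y = (u + u') + (v + v') * ta" by (simp only: x y algebra_simps)
    then show "x + y \<in> IK I" unfolding IK_def using x y RmodD(2)[OF I] by blast }
  fix r assume "r \<in> RR"
  moreover have "r * x = r * u + (r * v) * ta" by (simp only: x algebra_simps)
  ultimately show "r * x \<in> IK I" unfolding IK_def using x RmodD(3)[OF I] by blast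
qed

lemma ideal_times_K: "Rmod I \<Longrightarrow> r \<in> I \<Longrightarrow> x \<in> K \<Longrightarrow> r * x \<in> IK I"
proof -
  assume I: "Rmod I" "r \<in> I" "x \<in> K"
  obtain u v where x: "u \<in> RR" "v \<in> RR" "x = u + v * ta" using I(3) by (rule K_obtain)
  have "r * x = u * r + (v * r) * ta" by (simp only: x algebra_simps)
  then show ?thesis unfolding IK_def using RmodD(3)[OF I(1)] x I(2) by blast
qed

lemma IK_subset_K: "I \<subseteq> RR \<Longrightarrow> IK I \<subseteq> K"
  unfolding IK_def using K_intro by blast

lemma ideal_smult_K:
  assumes "Rmod I" "I \<subseteq> RR" shows "ideal_smult R (fls_module K) I K = IK I"
proof
  show "ideal_smult R (fls_module K) I K \<subseteq> IK I"
    using submodule_fls_iff[OF Rmod_K] Rmod_IK IK_subset_K assms ideal_times_K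
    by (intro ideal_smult_subset) auto
  show "IK I \<subseteq> ideal_smult R (fls_module K) I K"
  proof
    fix z assume "z \<in> IK I"
    then obtain x y where z: "z = x + y * ta" "x \<in> I" "y \<in> I" unfolding IK_def by blast
    have "z \<in> L" if L: "submodule L R (fls_module K)" "{r * x |r x. r \<in> I \<and> x \<in> K} \<subseteq> L" for L
    proof -
      have "x * 1 \<in> L" "y * ta \<in> L" using z one_K ta_K L(2) by blast+
      then show ?thesis using L(1) submodule_fls_iff[OF Rmod_K] RmodD(2)[of L] z by auto
    qed
    then show "z \<in> ideal_smult R (fls_module K) I K"
      unfolding ideal_smult_def submod_span_def by auto
  qed
qed

text \<open>
  The hypotheses give \<open>IK = Rw\<close>. Writing \<open>w = i \<cdot> 1 + j \<cdot> t\<^sup>a\<close> and dividing by \<open>w\<close>, one of the two summands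
  is a unit of \<open>R\<close>. So \<open>K\<close> would be generated by \<open>1\<close> or by \<open>t\<^sup>a\<close> alone, but neither \<open>t\<^sup>a\<close> nor \<open>t\<^sup>-\<^sup>a\<close> is in
  \<open>R\<close>.
\<close>

lemma canonical_module_not_cyclic:
  assumes I: "Rmod I" "I \<subseteq> RR" and w: "w \<noteq> 0" "w \<in> IK I"
    and IKw: "\<And>i x. i \<in> I \<Longrightarrow> x \<in> K \<Longrightarrow> i * x \<in> (\<lambda>r. r * w) ` RR"
  shows False
proof -
  obtain i j where ij: "i \<in> I" "j \<in> I" "w = i + j * ta" using w(2) unfolding IK_def by blast
  obtain \<rho> where \<rho>: "\<rho> \<in> RR" "i * 1 = \<rho> * w" using IKw[OF ij(1) one_K] by blast
  obtain \<sigma> where \<sigma>: "\<sigma> \<in> RR" "i * ta = \<sigma> * w" using IKw[OF ij(1) ta_K] by blast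
  obtain \<tau> where \<tau>: "\<tau> \<in> RR" "j * 1 = \<tau> * w" using IKw[OF ij(2) one_K] by blast
  obtain \<upsilon> where \<upsilon>: "\<upsilon> \<in> RR" "j * ta = \<upsilon> * w" using IKw[OF ij(2) ta_K] by blast
  have "w * (\<rho> + \<upsilon>) = w * 1" using ij(3) \<rho>(2) \<upsilon>(2) by (simp add: algebra_simps)
  then have 1: "\<rho> + \<upsilon> = 1" using w(1) by (metis mult_left_cancel)
  have "w * \<sigma> = w * (\<rho> * ta)" using \<rho>(2) \<sigma>(2) by (metis mult.assoc mult.commute mult_1_right)
  then have \<sigma>': "\<sigma> = \<rho> * ta" using w(1) by (metis mult_left_cancel)
  have "w * \<upsilon> = w * (\<tau> * ta)" using \<tau>(2) \<upsilon>(2) by (metis mult.assoc mult.commute mult_1_right)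
  then have "\<upsilon> = ta * \<tau>" using w(1) by (metis mult_left_cancel mult.commute)
  then have "fls_nth \<upsilon> 0 = fls_nth \<tau> (0 - shift)" by (simp only: tpow_mult_nth)
  then have "fls_nth \<upsilon> 0 = 0" using RR_nth_neg[OF \<tau>(1), of "0 - shift"] shift_pos by simp
  moreover have "fls_nth \<rho> 0 + fls_nth \<upsilon> 0 = 1" using 1 by (metis fls_one_nth fls_plus_nth)
  ultimately have "fls_nth \<rho> 0 \<noteq> 0" by simp
  then have "ta \<in> RR" using unit_scale[OF \<rho>(1) _ Rmod_R, of ta] \<sigma>(1) \<sigma>' by simp
  then show False using not_in_R by blast
qed

lemma unit_diff: "x \<in> mm \<Longrightarrow> fls_nth (1 - x) 0 \<noteq> 0"
  by (simp add: mm_iff)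

lemma sum_over_union:
  assumes "finite F" "finite G" "e \<in> F \<rightarrow> RR" "e' \<in> G \<rightarrow> RR"
  obtains d d' where "d \<in> F \<union> G \<rightarrow> RR" "d' \<in> F \<union> G \<rightarrow> RR"
    "(\<Sum>y\<in>F. e y * y) = (\<Sum>y\<in>F \<union> G. d y * y)" "(\<Sum>y\<in>G. e' y * y) = (\<Sum>y\<in>F \<union> G. d' y * y)"
proof (rule that[of "\<lambda>y. if y \<in> F then e y else 0" "\<lambda>y. if y \<in> G then e' y else 0"])
  show "(\<Sum>y\<in>F. e y * y) = (\<Sum>y\<in>F \<union> G. (if y \<in> F then e y else 0) * y)"
    using assms by (intro sum.mono_neutral_cong_left) auto
  show "(\<Sum>y\<in>G. e' y * y) = (\<Sum>y\<in>F \<union> G. (if y \<in> G then e' y else 0) * y)"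
    using assms by (intro sum.mono_neutral_cong_left) auto
qed (use assms in auto)

text \<open>
  Here \<open>X\<close> is a basis of \<open>K / Rw\<close> over \<open>R / I\<close>. Suppose that \<open>w = x + yt\<^sup>a\<close> with nonunits \<open>x\<close>, \<open>y\<close>. Expressing \<open>1\<close>
  and \<open>t\<^sup>a\<close> in the basis up to multiples \<open>rw\<close>, \<open>sw\<close> turns this into a combination equal to
  \<open>(1 - xr - ys)w\<close>. Its coefficients are in \<open>I\<close> by independence, and the factor of \<open>w\<close> is a unit, so
  \<open>w \<in> IK\<close>.
\<close>

lemma minimal_generator:
  assumes I: "Rmod I" "I \<subseteq> RR" and w: "w \<noteq> 0"
    and IKw: "\<And>i x. i \<in> I \<Longrightarrow> x \<in> K \<Longrightarrow> i * x \<in> (\<lambda>r. r * w) ` RR"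
    and X: "X \<subseteq> K"
      "\<And>x. x \<in> K \<Longrightarrow> \<exists>F e. finite F \<and> F \<subseteq> X \<and> e \<in> F \<rightarrow> RR \<and> x - (\<Sum>y\<in>F. e y * y) \<in> (\<lambda>r. r * w) ` RR"
      "\<And>F e y. finite F \<Longrightarrow> F \<subseteq> X \<Longrightarrow> e \<in> F \<rightarrow> RR \<Longrightarrow> (\<Sum>y\<in>F. e y * y) \<in> (\<lambda>r. r * w) ` RR \<Longrightarrow> y \<in> F \<Longrightarrow> e y \<in> I"
  shows "w \<notin> IK mm"
proof
  assume "w \<in> IK mm"
  then obtain x y where xy: "x \<in> mm" "y \<in> mm" "w = x + y * ta" unfolding IK_def by blast
  have xyR: "x \<in> RR" "y \<in> RR" using xy by (auto simp: mm_iff)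
  obtain F e r where F: "finite F" "F \<subseteq> X" "e \<in> F \<rightarrow> RR" "r \<in> RR" "1 - (\<Sum>y\<in>F. e y * y) = r * w"
    using X(2)[OF one_K] by blast
  obtain G e' s where G: "finite G" "G \<subseteq> X" "e' \<in> G \<rightarrow> RR" "s \<in> RR" "ta - (\<Sum>y\<in>G. e' y * y) = s * w"
    using X(2)[OF ta_K] by blast
  obtain d d' where d: "d \<in> F \<union> G \<rightarrow> RR" "d' \<in> F \<union> G \<rightarrow> RR"
    "(\<Sum>y\<in>F. e y * y) = (\<Sum>y\<in>F \<union> G. d y * y)" "(\<Sum>y\<in>G. e' y * y) = (\<Sum>y\<in>F \<union> G. d' y * y)"
    using sum_over_union[OF F(1) G(1) F(3) G(3)] by blast
  define b where "b = (\<lambda>z. x * d z + y * d' z)"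
  have bR: "b \<in> F \<union> G \<rightarrow> RR" using d xyR by (auto simp: b_def Pi_iff intro!: RR_add R_mult)
  have "(\<Sum>z\<in>F \<union> G. b z * z) = x * (\<Sum>y\<in>F. e y * y) + y * (\<Sum>y\<in>G. e' y * y)"
    unfolding d(3,4) b_def by (simp only: sum_distrib_left sum.distrib[symmetric] algebra_simps)
  also have "\<dots> = x * (1 - r * w) + y * (ta - s * w)"
    by (simp add: F(5)[symmetric] G(5)[symmetric])
  also have "\<dots> = (1 - (x * r + y * s)) * w" by (simp add: xy(3) algebra_simps)
  finally have eq: "(\<Sum>z\<in>F \<union> G. b z * z) = (1 - (x * r + y * s)) * w" .
  have m: "x * r + y * s \<in> mm"
    using RmodD(3)[OF Rmod_mm, of r x] RmodD(3)[OF Rmod_mm, of s y] xy F G by (auto intro!: mm_add simp: mult.commute)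
  then have u: "1 - (x * r + y * s) \<in> RR" by (auto simp: mm_iff intro!: series_on_diff)
  have "b z \<in> I" if "z \<in> F \<union> G" for z
    using X(3)[of "F \<union> G" b z] F G bR that u eq by blast
  then have "(\<Sum>z\<in>F \<union> G. b z * z) \<in> IK I"
    using X(1) F(2) G(2) by (intro Rmod_sum[OF Rmod_IK[OF I(1)]] ideal_times_K[OF I(1)]) auto
  then have "w \<in> IK I"
    using unit_scale[OF u unit_diff[OF m] Rmod_IK[OF I(1)]] eq by simp
  then show False using canonical_module_not_cyclic[OF I w _ IKw] by blast
qed

text \<open>
  In a basis of \<open>K / IK\<close> over \<open>R / I\<close> a minimal generator has a unit coordinate, and multiplying that by \<open>r\<close>
  must give an element of \<open>I\<close>.
\<close>

lemma annihilator_of_minimal_generator: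
  assumes I: "Rmod I" "I \<subseteq> mm" and w: "w \<in> K" "w \<notin> IK mm"
    and X: "X \<subseteq> K"
      "\<And>x. x \<in> K \<Longrightarrow> \<exists>F e. finite F \<and> F \<subseteq> X \<and> e \<in> F \<rightarrow> RR \<and> x - (\<Sum>y\<in>F. e y * y) \<in> IK I"
      "\<And>F e y. finite F \<Longrightarrow> F \<subseteq> X \<Longrightarrow> e \<in> F \<rightarrow> RR \<Longrightarrow> (\<Sum>y\<in>F. e y * y) \<in> IK I \<Longrightarrow> y \<in> F \<Longrightarrow> e y \<in> I"
    and r: "r \<in> RR" "r * w \<in> IK I"
  shows "r \<in> I"
proof -
  have sub: "IK I \<subseteq> IK mm" using I(2) unfolding IK_def by blast
  obtain F e where F: "finite F" "F \<subseteq> X" "e \<in> F \<rightarrow> RR" "w - (\<Sum>y\<in>F. e y * y) \<in> IK I"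
    using X(2)[OF w(1)] by blast
  have "r * (w - (\<Sum>y\<in>F. e y * y)) \<in> IK I" using r(1) F(4) by (rule RmodD(3)[OF Rmod_IK[OF I(1)]])
  then have "r * w - r * (w - (\<Sum>y\<in>F. e y * y)) \<in> IK I" using r(2) by (intro RmodD(5)[OF Rmod_IK[OF I(1)]])
  also have "r * w - r * (w - (\<Sum>y\<in>F. e y * y)) = (\<Sum>y\<in>F. (r * e y) * y)"
    by (simp add: algebra_simps sum_distrib_left)
  finally have *: "(\<Sum>y\<in>F. (r * e y) * y) \<in> IK I" .
  have "\<exists>y\<in>F. e y \<notin> mm"
  proof (rule ccontr)
    assume "\<not> ?thesis"
    then have "(\<Sum>y\<in>F. e y * y) \<in> IK mm"
      using X(1) F(2) by (intro Rmod_sum[OF Rmod_IK[OF Rmod_mm]] ideal_times_K[OF Rmod_mm]) auto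
    from RmodD(2)[OF Rmod_IK[OF Rmod_mm] subsetD[OF sub F(4)] this]
    show False using w(2) by simp
  qed
  then obtain y where y: "y \<in> F" "e y \<notin> mm" by blast
  then have ey: "e y \<in> RR" "fls_nth (e y) 0 \<noteq> 0" using F(3) by (auto simp: mm_iff)
  have "(\<lambda>y. r * e y) \<in> F \<rightarrow> RR" using F(3) r(1) by (auto intro: R_mult)
  then have "r * e y \<in> I" using X(3)[of F "\<lambda>y. r * e y" y] F * y by blast
  then show ?thesis using unit_scale[OF ey I(1)] by (simp add: mult.commute)
qed

lemma ggl_imp_three_shift:
  assumes ggl: "ggl_ring R (fls_module K)"
  shows "3 * shift \<in> H"
proof -
  obtain I C g h where prim: "m_primary R I"
    and ex: "short_exact R (self_module R) (fls_module K) (C :: ('k fls, 'k fls set) module) g h"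
    and ul: "ulrich R I C" and free: "free_module (R Quot I) (mod_reduction R (fls_module K) I)"
    using ggl unfolding ggl_ring_def by blast
  note I = m_primaryD[OF prim]
  have IR: "I \<subseteq> RR" using I by (auto simp: mm_iff)
  have idI: "ideal I R" using I IR by (simp add: ideal_iff)
  have hC: "h \<in> mod_hom R (fls_module K) C" "h ` K = carrier C" and modC: "module R C"
    and g: "g \<in> mod_hom R (fls_module RR) (fls_module K)" "inj_on g RR" "g ` RR = {x \<in> K. h x = \<zero>\<^bsub>C\<^esub>}"
    using ex unfolding short_exact_def self_module_eq by auto
  interpret h: semilinear_surj R "fls_module K" R C "\<lambda>r. r" h
    by (rule mod_hom_surj[OF module_fls[OF Rmod_K] modC hC(1)]) (simp add: hC(2))
  define w where "w = g 1"
  have gr: "g r = r * w" if "r \<in> RR" for r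
  proof -
    have "\<forall>r\<in>RR. \<forall>x\<in>RR. g (r * x) = r * g x" using g(1) by (simp add: mod_hom_def)
    moreover have "1 \<in> RR" using zero_in by simp
    ultimately have "g (r * 1) = r * g 1" using that by blast
    then show ?thesis by (simp add: w_def)
  qed
  let ?Z = "(\<lambda>r. r * w) ` RR"
  have Z: "{x \<in> K. h x = \<zero>\<^bsub>C\<^esub>} = ?Z" unfolding g(3)[symmetric] by (rule image_cong) (simp_all add: gr)
  have wK: "w \<in> K" using g(1) zero_in by (auto simp: mod_hom_def w_def)
  have w0: "w \<noteq> 0"
  proof
    assume "w = 0"
    then have "g 0 = g 1" using gr[of 0] gr[of 1] zero_in by simp
    then have "(0 :: 'k fls) = 1" using g(2) zero_in by (auto dest: inj_onD)
    then show False by simp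
  qed
  \<comment> \<open>A series of this order, divided by \<open>w\<close>, only has exponents above the Frobenius number.\<close>
  define N where "N = fls_subdegree w + pf2 + 1"
  have high: "series_on {N..} \<subseteq> ?Z"
  proof
    fix x :: "'k fls" assume x: "x \<in> series_on {N..}"
    have "x / w \<in> RR"
    proof (cases "x = 0")
      case False
      then have "x / w \<noteq> 0" using w0 by simp
      moreover have "x = x / w * w" using w0 by simp
      ultimately have "fls_subdegree x = fls_subdegree (x / w) + fls_subdegree w"
        using w0 by (metis fls_subdegree_mult)
      then have "pf2 + 1 \<le> fls_subdegree (x / w)" using x False by (simp add: series_on_atLeast N_def)
      then have "x / w \<in> series_on {pf2 + 1..}" by (simp add: series_on_atLeast)
      also have "\<dots> \<subseteq> RR" using above_frobenius by (intro series_on_mono) auto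
      finally show ?thesis .
    qed simp
    then show "x \<in> ?Z" using w0 by (intro image_eqI[of _ _ "x / w"]) auto
  qed
  have IC: "ideal_smult R C I (carrier C) = {\<zero>\<^bsub>C\<^esub>}"
    using ul high Z I by (intro ulrich_quotient_killed[OF Rmod_K K_nonneg h.semilinear_surj_axioms, of N])
      (auto simp: ulrich_def)
  have IKw: "i * x \<in> ?Z" if "i \<in> I" "x \<in> K" for i x
  proof -
    have "i \<odot>\<^bsub>C\<^esub> h x \<in> ideal_smult R C I (carrier C)"
      using that hC(2) unfolding ideal_smult_def submod_span_def by blast
    then have "h (i * x) = \<zero>\<^bsub>C\<^esub>" using IC h.phi_smult[of i x] that IR by auto
    moreover have "i * x \<in> K" using that IR by (intro RmodD(3)[OF Rmod_K]) auto
    ultimately show ?thesis using Z by blast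
  qed
  obtain X where X: "X \<subseteq> K"
    "\<And>x. x \<in> K \<Longrightarrow> \<exists>F e. finite F \<and> F \<subseteq> X \<and> e \<in> F \<rightarrow> RR \<and> x - (\<Sum>y\<in>F. e y * y) \<in> ?Z"
    "\<And>F e y. finite F \<Longrightarrow> F \<subseteq> X \<Longrightarrow> e \<in> F \<rightarrow> RR \<Longrightarrow> (\<Sum>y\<in>F. e y * y) \<in> ?Z \<Longrightarrow> y \<in> F \<Longrightarrow> e y \<in> I"
  proof (rule free_reduction_basis[OF Rmod_K h.semilinear_surj_axioms idI])
    show "free_module (R Quot I) (mod_reduction R C I)" using ul by (simp add: ulrich_def)
    show "?Z = {x \<in> K. h x \<in> ideal_smult R C I (carrier C)}" using Z IC by auto
  qed (rule that)
  obtain Y where Y: "Y \<subseteq> K"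
    "\<And>x. x \<in> K \<Longrightarrow> \<exists>F e. finite F \<and> F \<subseteq> Y \<and> e \<in> F \<rightarrow> RR \<and> x - (\<Sum>y\<in>F. e y * y) \<in> IK I"
    "\<And>F e y. finite F \<Longrightarrow> F \<subseteq> Y \<Longrightarrow> e \<in> F \<rightarrow> RR \<Longrightarrow> (\<Sum>y\<in>F. e y * y) \<in> IK I \<Longrightarrow> y \<in> F \<Longrightarrow> e y \<in> I"
  proof (rule free_reduction_basis[OF Rmod_K identity_surj[OF Rmod_K] idI free])
    show "IK I = {x \<in> K. x \<in> ideal_smult R (fls_module K) I (carrier (fls_module K))}"
      using ideal_smult_K[OF I(1) IR] IK_subset_K[OF IR] by auto
  qed (rule that)
  have w_min: "w \<notin> IK mm" by (rule minimal_generator[where I = I and X = X]) (fact I(1) IR w0 IKw X)+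
  \<comment> \<open>The annihilator of the nonzero free \<open>R / I\<close>-module \<open>C\<close> is contained in \<open>I\<close>.\<close>
  have ann: "r \<in> I" if r: "r \<in> RR" "\<And>x. x \<in> K \<Longrightarrow> r * x \<in> ?Z" for r
  proof -
    have "carrier C \<noteq> {\<zero>\<^bsub>C\<^esub>}" using ul by (simp add: ulrich_def)
    moreover have "\<zero>\<^bsub>C\<^esub> \<in> carrier C" using h.N.zero_closed .
    ultimately obtain v where "v \<in> carrier C" "v \<noteq> \<zero>\<^bsub>C\<^esub>" by blast
    then obtain x where "x \<in> K" "h x \<noteq> \<zero>\<^bsub>C\<^esub>" using hC(2) by blast
    then have x: "x \<in> K" "x \<notin> ?Z" unfolding Z[symmetric] by simp_all
    obtain F e where F: "F \<subseteq> X" "x - (\<Sum>y\<in>F. e y * y) \<in> ?Z" using X(2)[OF x(1)] by blast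
    then obtain y where y: "y \<in> X" using x(2) by (cases "F = {}") auto
    have "(\<Sum>z\<in>{y}. r * z) \<in> ?Z" using r y X(1) by auto
    then show ?thesis using X(3)[of "{y}" "\<lambda>_. r" y] y r by auto
  qed
  have w_ann: "r \<in> I" if "r \<in> RR" "r * w \<in> IK I" for r
    by (rule annihilator_of_minimal_generator[where I = I and X = Y and w = w]) (fact I wK w_min Y that)+
  have column: "tpow p \<in> I \<and> tpow (p + shift) \<in> I"
    if p: "p \<in> H" "p + shift \<in> H" for p
  proof -
    obtain x y where xy: "x \<in> RR" "y \<in> RR" "w = x + y * ta" using wK by (rule K_obtain)
    \<comment> \<open>Chosen so that \<open>r \<cdot> 1\<close> and \<open>r t\<^sup>a\<close> are the multiples of \<open>w\<close> by the two entries of the column.\<close>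
    define r where "r = x * tpow p + y * tpow (p + shift)"
    have tp: "(tpow p :: 'k fls) \<in> RR" "(tpow (p + shift) :: 'k fls) \<in> RR"
      using p by (simp_all only: tpow_in_series_on)
    have rR: "r \<in> RR" unfolding r_def using xy tp by (intro RR_add R_mult)
    have q: "tpow (p + shift) = (tpow p * ta :: 'k fls)" by (simp only: tpow_mult_tpow)
    have r1: "r * 1 = tpow p * w" unfolding mult_1_right r_def q xy(3) by (simp only: algebra_simps)
    have rt: "r * ta = tpow (p + shift) * w" unfolding r_def q by (simp only: xy(3) algebra_simps)
    have "r * z \<in> ?Z" if z: "z \<in> K" for z
    proof -
      obtain s s' where s: "s \<in> RR" "s' \<in> RR" "z = s + s' * ta" using z by (rule K_obtain)
      have "r * z = s * (r * 1) + s' * (r * ta)" unfolding mult_1_right s(3) by (simp only: algebra_simps)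
      also have "\<dots> = (s * tpow p + s' * tpow (p + shift)) * w" unfolding r1 rt by (simp only: algebra_simps)
      finally show ?thesis
      proof (rule image_eqI)
        show "s * tpow p + s' * tpow (p + shift) \<in> RR" using s tp by (intro RR_add R_mult)
      qed
    qed
    then have rI: "r \<in> I" by (rule ann[OF rR])
    show ?thesis
      using w_ann[OF tp(1)] w_ann[OF tp(2)] ideal_times_K[OF I(1) rI one_K] ideal_times_K[OF I(1) rI ta_K]
      unfolding r1 rt by blast
  qed
  have order_div: "n - fls_subdegree w \<in> H" if n: "tpow n \<in> ?Z" for n
  proof -
    obtain \<rho> where \<rho>: "\<rho> \<in> RR" "tpow n = \<rho> * w" using n by blast
    then have "\<rho> \<noteq> 0" by (metis fls_X_intpow_nonzero mult_zero_left)
    then have "fls_subdegree (\<rho> * w) = fls_subdegree \<rho> + fls_subdegree w" using w0 by simp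
    then have "n = fls_subdegree \<rho> + fls_subdegree w" unfolding \<rho>(2)[symmetric] fls_subdegree_fls_X_intpow .
    then show ?thesis using order_in[OF \<rho>(1) \<open>\<rho> \<noteq> 0\<close>] by simp
  qed
  have cols: "\<alpha> * a1 \<in> H" "\<alpha> * a1 + shift = \<beta>' * a2" "\<beta>' * a2 \<in> H"
     "\<beta> * a2 \<in> H" "\<beta> * a2 + shift = \<gamma>' * a3" "\<gamma>' * a3 \<in> H"
     "\<gamma> * a3 \<in> H" "\<gamma> * a3 + shift = \<alpha>' * a1" "\<alpha>' * a1 \<in> H"
    using shift_eqs gens_in_semigroup exp_pos by (auto simp: shift_def)
  have in_I: "tpow (\<alpha> * a1) \<in> I" "tpow (\<beta> * a2) \<in> I" "tpow (\<gamma> * a3) \<in> I"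
    "tpow (\<beta>' * a2) \<in> I" "tpow (\<gamma>' * a3) \<in> I" "tpow (\<alpha>' * a1) \<in> I"
    using column[OF cols(1)] column[OF cols(4)] column[OF cols(7)] cols by simp_all
  let ?o = "fls_subdegree w"
  have o_in: "?o \<in> H \<union> (+) shift ` H" using order_in wK w0 unfolding K_def by blast
  have below: "n - ?o \<in> H" if "tpow n \<in> I" for n
    using order_div[of n] IKw[OF that one_K] by simp
  have above: "n + shift - ?o \<in> H" if "tpow n \<in> I" for n
    using order_div[of "n + shift"] IKw[OF that ta_K] by (simp only: tpow_mult_tpow)
  \<comment> \<open>An order in \<open>a + H\<close> would let \<open>a\<close> be subtracted from all entries of the first row.\<close>
  have "?o \<in> H"
  proof (rule ccontr)
    assume "?o \<notin> H"
    then obtain e where e: "e \<in> H" "?o = shift + e" using o_in by blast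
    have "n - shift \<in> H" if "tpow n \<in> I" for n
      using semigroup_add[OF below[OF that] e(1)] e(2) by simp
    then show False using not_all_minus_shift in_I by blast
  qed
  then have o0: "?o = 0" using common_divisor_zero below in_I by blast
  have "\<beta>' * a2 \<in> conductor_set" "\<gamma>' * a3 \<in> conductor_set" "\<alpha>' * a1 \<in> conductor_set"
    using above in_I cols o0 by (auto simp: conductor_set_def)
  then show ?thesis unfolding three_shift_iff using conductor_power_le by blast
qed

end

section \<open>From the semigroup to the GGL property\<close>

context herzog_ring begin

text \<open>
  The ideal \<open>R : K\<close>. It is generated by the first row of the matrix (\<open>Idl_monomials\<close>).
\<close>

definition CC :: "'k fls set" where "CC = series_on conductor_set"

lemma Rmod_CC: "Rmod CC"
  unfolding CC_def using conductor_set_add by (rule Rmod_series_on)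

lemma CC_iff: "x \<in> CC \<longleftrightarrow> x \<in> RR \<and> x * ta \<in> RR"
  unfolding CC_def conductor_series by simp

lemma CC_subset: "CC \<subseteq> RR" by (auto simp: CC_iff)

lemma CC_high: "series_on {pf2 + 1..} \<subseteq> CC"
  unfolding CC_def using conductor_set_high by (intro series_on_mono) auto

lemma one_notin_CC: "1 \<notin> CC"
  using not_in_R by (simp add: CC_iff)

lemma CC_subset_mm: "CC \<subseteq> mm"
  using proper_ideal_subset_mm Rmod_CC CC_subset one_notin_CC by blast

lemma ideal_CC: "ideal CC R"
  using Rmod_CC CC_subset by (simp add: ideal_iff)

text \<open>
  This is where the inequalities between the two rows enter: \<open>\<cc>\<close> is an ideal of \<open>R[t\<^sup>a]\<close>.
\<close>

lemma CC_shift: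
  assumes "3 * shift \<in> H" "x \<in> CC" shows "x * ta \<in> CC"
proof -
  have "ta * x \<in> CC" unfolding CC_def
  proof (rule series_on_mult[of _ "{shift}" _ conductor_set])
    show "ta \<in> series_on {shift}" by simp
    show "x \<in> series_on conductor_set" using assms(2) by (simp add: CC_def)
    show "\<And>a b. a \<in> {shift} \<Longrightarrow> b \<in> conductor_set \<Longrightarrow> a + b \<in> conductor_set"
      using conductor_set_shift assms(1) three_shift_iff by (auto simp: add.commute)
  qed
  then show ?thesis by (simp only: mult.commute)
qed

lemma IK_CC: "3 * shift \<in> H \<Longrightarrow> IK CC = CC"
proof
  assume a: "3 * shift \<in> H"
  show "IK CC \<subseteq> CC" unfolding IK_def using CC_shift[OF a] RmodD(2)[OF Rmod_CC] by blast
  show "CC \<subseteq> IK CC"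
  proof
    fix x assume "x \<in> CC"
    then show "x \<in> IK CC" unfolding IK_def using RmodD(1)[OF Rmod_CC]
      by (intro CollectI exI[of _ x] exI[of _ 0]) simp
  qed
qed

text \<open>
  Since \<open>\<cc>K = \<cc>\<close> lies in \<open>R\<close>, a combination \<open>u + vt\<^sup>a\<close> in \<open>\<cc>K\<close> has \<open>vt\<^sup>a \<in> R\<close>, so \<open>v\<close> and then \<open>u\<close> are in \<open>\<cc>\<close>.
\<close>

lemma free_K_CC:
  assumes a: "3 * shift \<in> H"
  shows "free_module (R Quot CC) (mod_reduction R (fls_module K) CC)"
proof (rule free_reductionI[OF Rmod_K identity_surj[OF Rmod_K] ideal_CC one_notin_CC])
  show "CC = {x \<in> K. x \<in> ideal_smult R (fls_module K) CC (carrier (fls_module K))}"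
    using ideal_smult_K[OF Rmod_CC CC_subset] IK_CC[OF a] CC_subset R_subset_K by auto
  show "finite {1, ta}" "{1, ta} \<subseteq> K" using one_K ta_K by auto
  have ne: "1 \<noteq> ta" using not_in_R zero_in by (metis one_in_series_on)
  have sum: "(\<Sum>y\<in>{1, ta}. e y * y) = e 1 + e ta * ta" for e :: "'k fls \<Rightarrow> 'k fls"
    using ne by simp
  { fix x assume "x \<in> K"
    then obtain r s where rs: "r \<in> RR" "s \<in> RR" "x = r + s * ta" by (rule K_obtain)
    show "\<exists>e\<in>{1, ta} \<rightarrow> RR. x - (\<Sum>y\<in>{1, ta}. e y * y) \<in> CC"
    proof (rule bexI[of _ "\<lambda>y. if y = 1 then r else s"])
      show "x - (\<Sum>y\<in>{1, ta}. (if y = 1 then r else s) * y) \<in> CC"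
        unfolding sum using rs ne RmodD(1)[OF Rmod_CC] by simp
    qed (use rs in auto) }
  fix e y assume e: "e \<in> {1, ta} \<rightarrow> RR" and 0: "(\<Sum>y\<in>{1, ta}. e y * y) \<in> CC" and y: "y \<in> {1, ta}"
  have 1: "e 1 + e ta * ta \<in> CC" using 0 unfolding sum .
  have eR: "e 1 \<in> RR" "e ta \<in> RR" using e by auto
  have "(e 1 + e ta * ta) - e 1 \<in> RR" using 1 CC_subset eR by (intro series_on_diff) auto
  then have t: "e ta \<in> CC" using eR by (simp add: CC_iff)
  have "(e 1 + e ta * ta) - e ta * ta \<in> CC" using 1 CC_shift[OF a t] by (rule RmodD(5)[OF Rmod_CC])
  then show "e y \<in> CC" using t y by auto
qed

lemma quotient_surj: "semilinear_surj R (fls_module K) R (quot_module (fls_module K) RR) (\<lambda>r. r) ((+>\<^bsub>fls_module K\<^esub>) RR)"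
proof -
  interpret module R "fls_module K" by (rule module_fls[OF Rmod_K])
  show ?thesis using submodule_fls_iff[OF Rmod_K] Rmod_R R_subset_K by (intro quot_module_surj) auto
qed

lemma ideal_smult_zero:
  assumes "module R C" "I \<subseteq> carrier R" "N \<subseteq> carrier C" "\<And>r x. r \<in> I \<Longrightarrow> x \<in> N \<Longrightarrow> r \<odot>\<^bsub>C\<^esub> x = \<zero>\<^bsub>C\<^esub>"
  shows "ideal_smult R C I N = {\<zero>\<^bsub>C\<^esub>}"
proof -
  interpret C: module R C by fact
  have "submodule {\<zero>\<^bsub>C\<^esub>} R C" by (rule C.submoduleI) auto
  then have "ideal_smult R C I N \<subseteq> {\<zero>\<^bsub>C\<^esub>}" using assms(4) by (intro ideal_smult_subset) auto
  moreover have "\<zero>\<^bsub>C\<^esub> \<in> ideal_smult R C I N"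
    using subgroup.one_closed[OF submodule.axioms(1)[OF C.ideal_smult_submodule[OF assms(2,3)]]] by simp
  ultimately show ?thesis by blast
qed

text \<open>
  The sequence \<open>0 \<rightarrow> R \<rightarrow> K \<rightarrow> K / R \<rightarrow> 0\<close> and \<open>I = \<cc>\<close> serve. As \<open>\<cc>\<close> kills \<open>K / R\<close>, the filtration in the multiplicity
  is constant, and no element of the maximal ideal is regular on \<open>K / R\<close>, so its depth is zero.
\<close>

lemma three_shift_imp_ggl:
  assumes a: "3 * shift \<in> H"
  shows "ggl_ring R (fls_module K)"
proof -
  define C where "C = quot_module (fls_module K) RR"
  define h where "h = (+>\<^bsub>fls_module K\<^esub>) RR"
  interpret h: semilinear_surj R "fls_module K" R C "\<lambda>r. r" h
    unfolding C_def h_def by (rule quotient_surj)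
  have sub: "submodule RR R (fls_module K)" using submodule_fls_iff[OF Rmod_K] Rmod_R R_subset_K by blast
  have zC: "\<zero>\<^bsub>C\<^esub> = RR" by (simp add: C_def quot_module_def)
  have h0: "h x = \<zero>\<^bsub>C\<^esub> \<longleftrightarrow> x \<in> RR" if "x \<in> K" for x
    unfolding zC h_def using h.submodule_coset_eq_iff[OF sub] that by simp
  have hs: "r \<odot>\<^bsub>C\<^esub> h x = h (r * x)" if "r \<in> RR" "x \<in> K" for r x
    using h.phi_smult[of r x] that by simp
  have hK: "h ` K = carrier C" using h.phi_surj by simp
  have C_el: "\<exists>x\<in>K. v = h x" if "v \<in> carrier C" for v using that hK by blast
  have short: "short_exact R (self_module R) (fls_module K) C (\<lambda>r. r) h"
    unfolding short_exact_def self_module_eq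
  proof (intro conjI)
    have "{x \<in> K. h x = \<zero>\<^bsub>C\<^esub>} = RR" using h0 R_subset_K by blast
    then show "(\<lambda>r. r) ` carrier (fls_module RR) = {x \<in> carrier (fls_module K). h x = \<zero>\<^bsub>C\<^esub>}" by simp
    show "h \<in> mod_hom R (fls_module K) C"
      using h.phi_add h.phi_smult h.phi_closed by (simp add: mod_hom_def)
  qed (use module_fls[OF Rmod_R] module_fls[OF Rmod_K] h.module_N R_subset_K hK in \<open>auto simp: mod_hom_def\<close>)
  have killed: "r \<odot>\<^bsub>C\<^esub> v = \<zero>\<^bsub>C\<^esub>" if rv: "r \<in> CC" "v \<in> carrier C" for r v
  proof -
    obtain x where x: "x \<in> K" "v = h x" using C_el[OF rv(2)] by blast
    have rR: "r \<in> RR" using rv(1) CC_subset by blast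
    have "r * x \<in> IK CC" using ideal_times_K[OF Rmod_CC rv(1) x(1)] .
    then have "r * x \<in> RR" using IK_CC[OF a] CC_subset by blast
    moreover have "r * x \<in> K" using rR x by (intro RmodD(3)[OF Rmod_K])
    ultimately show ?thesis using hs[OF rR x(1)] h0 x by simp
  qed
  have CCR: "CC \<subseteq> carrier R" using CC_subset by simp
  have zero: "ideal_smult R C CC N = {\<zero>\<^bsub>C\<^esub>}" if "N \<subseteq> carrier C" for N
    using killed that by (intro ideal_smult_zero h.module_N CCR) auto
  have pow: "ideal_pow_smult R C CC (Suc n) = {\<zero>\<^bsub>C\<^esub>}" for n
  proof (induction n)
    case 0 then show ?case by (simp add: ideal_pow_smult_def zero)
  next
    case (Suc n)
    have "ideal_pow_smult R C CC (Suc (Suc n)) = ideal_smult R C CC (ideal_pow_smult R C CC (Suc n))"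
      by (simp add: ideal_pow_smult_def)
    also have "\<dots> = {\<zero>\<^bsub>C\<^esub>}" unfolding Suc using h.N.zero_closed by (intro zero) auto
    finally show ?case .
  qed
  have dim: "mod_dim R C = 0"
  proof (rule mod_dim_zero)
    show "series_on {pf2 + 1..} \<subseteq> annihilator R C"
      using CC_high CCR killed unfolding annihilator_def by blast
  qed
  have hta: "h ta \<in> carrier C" "h ta \<noteq> \<zero>\<^bsub>C\<^esub>" using hK ta_K h0[OF ta_K] not_in_R by auto
  have mult: "multiplicity0 R CC C = ereal_of_enat (mod_length R (quot_module C (ideal_smult R C CC (carrier C))))"
    using dim by (simp add: multiplicity0_def zero_enat_def pow zero lim_const flip: one_ereal_def)
  have gen: "submod_span R C {h ta} = carrier C"
  proof
    show "submod_span R C {h ta} \<subseteq> carrier C"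
      using h.N.submoduleE(1)[OF h.N.submod_span_submodule[of "{h ta}"]] hta by auto
    show "carrier C \<subseteq> submod_span R C {h ta}"
    proof
      fix v assume "v \<in> carrier C"
      then obtain x where x: "x \<in> K" "v = h x" using C_el by blast
      obtain r s where rs: "r \<in> RR" "s \<in> RR" "x = r + s * ta" using x(1) by (rule K_obtain)
      have "s * ta \<in> K" using rs ta_K by (intro RmodD(3)[OF Rmod_K])
      moreover have "r \<in> K" using rs R_subset_K by blast
      ultimately have "v = h r \<oplus>\<^bsub>C\<^esub> h (s * ta)" using x(2) rs(3) h.phi_add[of r "s * ta"] by simp
      also have "\<dots> = h (s * ta)" using h0[OF \<open>r \<in> K\<close>] rs(1) h.phi_closed[of "s * ta"] \<open>s * ta \<in> K\<close> by simp
      also have "\<dots> = s \<odot>\<^bsub>C\<^esub> h ta" using hs[OF rs(2) ta_K] by simp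
      finally have "v = s \<odot>\<^bsub>C\<^esub> h ta" .
      then show "v \<in> submod_span R C {h ta}"
        using h.N.submoduleE(4) rs(2) unfolding submod_span_def by auto
    qed
  qed
  have depth: "depth R C = 0"
  proof -
    have "xs = []" if xs: "set xs \<subseteq> max_ideal R" "regular_seq R C xs" for xs
    proof (rule ccontr)
      assume "xs \<noteq> []"
      then have "0 < length xs" by simp
      have x: "xs ! 0 \<in> mm" using xs(1) \<open>0 < length xs\<close> max_ideal_R nth_mem by blast
      then have xR: "xs ! 0 \<in> RR" by (simp add: mm_iff)
      have Idl0: "Idl\<^bsub>R\<^esub> {} = {0}" using R.genideal_zero R.subset_Idl_subset R.zeroideal
        unfolding genideal_def by (auto simp: ideal_iff Rmod_def)
      have null: "ideal_smult R C (Idl\<^bsub>R\<^esub> (set (take 0 xs))) (carrier C) = {\<zero>\<^bsub>C\<^esub>}"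
        unfolding take_0 list.set(1) Idl0
        using h.N.smult_l_null by (intro ideal_smult_zero h.module_N) auto
      have "\<forall>i<length xs. let N = ideal_smult R C (Idl\<^bsub>R\<^esub> (set (take i xs))) (carrier C) in
          \<forall>v\<in>carrier C. (xs ! i) \<odot>\<^bsub>C\<^esub> v \<in> N \<longrightarrow> v \<in> N"
        using xs(2) unfolding regular_seq_def by (elim conjE)
      from spec[OF this, of 0] have reg: "\<forall>v\<in>carrier C. (xs ! 0) \<odot>\<^bsub>C\<^esub> v = \<zero>\<^bsub>C\<^esub> \<longrightarrow> v = \<zero>\<^bsub>C\<^esub>"
        using \<open>0 < length xs\<close> unfolding null Let_def singleton_iff by blast
      \<comment> \<open>A nonzerodivisor on \<open>K / R\<close> would keep its powers from killing \<open>t\<^sup>a\<close>, but high powers are in \<open>\<cc>\<close>.\<close>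
      have "(xs ! 0) ^ n \<in> RR \<and> h ((xs ! 0) ^ n * ta) \<noteq> \<zero>\<^bsub>C\<^esub>" for n
      proof (induction n)
        case 0 then show ?case using hta zero_in by simp
      next
        case (Suc n)
        have k: "(xs ! 0) ^ n * ta \<in> K" using Suc ta_K by (intro RmodD(3)[OF Rmod_K]) auto
        then have "h ((xs ! 0) ^ n * ta) \<in> carrier C" using hK by blast
        then have "(xs ! 0) \<odot>\<^bsub>C\<^esub> h ((xs ! 0) ^ n * ta) \<noteq> \<zero>\<^bsub>C\<^esub>" using reg Suc by blast
        then show ?case using hs[OF xR k] xR Suc by (auto simp: mult.assoc intro: R_mult)
      qed
      note this[of "nat (pf2 + 1)"]
      moreover have "(xs ! 0) ^ nat (pf2 + 1) \<in> CC"
      proof -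
        have "(xs ! 0) ^ nat (pf2 + 1) \<in> series_on {int (nat (pf2 + 1))..}" using x by (rule mm_power)
        also have "\<dots> \<subseteq> series_on {pf2 + 1..}" by (rule series_on_mono) auto
        finally show ?thesis using CC_high by blast
      qed
      ultimately show False using h0 R_subset_K by (auto simp: CC_iff)
    qed
    then have "depth R C \<le> 0" unfolding depth_def by (intro Sup_least) (auto simp: zero_enat_def)
    then show ?thesis by simp
  qed
  have free: "free_module (R Quot CC) (mod_reduction R C CC)"
  proof (rule free_reductionI[OF Rmod_K h.semilinear_surj_axioms ideal_CC one_notin_CC])
    show "RR = {x \<in> K. h x \<in> ideal_smult R C CC (carrier C)}"
      using zero[of "carrier C"] h0 R_subset_K by auto
    show "finite {ta}" "{ta} \<subseteq> K" using ta_K by auto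
    { fix x assume "x \<in> K"
      then obtain r s where rs: "r \<in> RR" "s \<in> RR" "x = r + s * ta" by (rule K_obtain)
      then show "\<exists>e\<in>{ta} \<rightarrow> RR. x - (\<Sum>y\<in>{ta}. e y * y) \<in> RR" by (intro bexI[of _ "\<lambda>_. s"]) auto }
    fix e y assume "e \<in> {ta} \<rightarrow> RR" "(\<Sum>y\<in>{ta}. e y * y) \<in> RR" "y \<in> {ta}"
    then show "e y \<in> CC" by (auto simp: CC_iff)
  qed
  have "ulrich R CC C"
    unfolding ulrich_def cohen_macaulay_def fin_gen_def
    using h.module_N hta gen mult free depth dim by auto
  then show ?thesis
    unfolding ggl_ring_def using local_ring_R m_primaryI[OF Rmod_CC CC_subset_mm CC_high] short free_K_CC[OF a] C_def
    by blast
qed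

section \<open>The conductor of \<open>R[K]\<close>\<close>

lemma Idl_monomials:
  "Idl\<^bsub>R\<^esub> {tpow (\<alpha> * a1), tpow (\<beta> * a2), tpow (\<gamma> * a3)} = CC" (is "Idl\<^bsub>R\<^esub> ?T = _")
proof
  have "?T \<subseteq> CC"
    using conductor_set_eq zero_in by (simp only: CC_def tpow_in_series_on insert_subset empty_subsetI) force
  then show "Idl\<^bsub>R\<^esub> ?T \<subseteq> CC" unfolding genideal_def using ideal_CC by blast
  show "CC \<subseteq> Idl\<^bsub>R\<^esub> ?T"
  proof
    fix x assume "x \<in> CC"
    then have "x \<in> series_on ((+) (\<alpha> * a1) ` H \<union> ((+) (\<beta> * a2) ` H \<union> (+) (\<gamma> * a3) ` H))"
      unfolding CC_def conductor_set_eq by (simp only: Un_assoc)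
    then obtain u u' where u: "x = u + u'" "u \<in> series_on ((+) (\<alpha> * a1) ` H)"
      "u' \<in> series_on ((+) (\<beta> * a2) ` H \<union> (+) (\<gamma> * a3) ` H - (+) (\<alpha> * a1) ` H)"
      by (rule series_on_split)
    have "u' \<in> series_on ((+) (\<beta> * a2) ` H \<union> (+) (\<gamma> * a3) ` H)"
      by (rule subsetD[OF series_on_mono u(3)]) blast
    then obtain v w where v: "u' = v + w" "v \<in> series_on ((+) (\<beta> * a2) ` H)"
      "w \<in> series_on ((+) (\<gamma> * a3) ` H - (+) (\<beta> * a2) ` H)"
      by (rule series_on_split)
    have w: "w \<in> series_on ((+) (\<gamma> * a3) ` H)" by (rule subsetD[OF series_on_mono v(3)]) blast
    obtain r where r: "u = tpow (\<alpha> * a1) * r" "r \<in> RR" by (rule series_on_shift[OF u(2)])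
    obtain s where s: "v = tpow (\<beta> * a2) * s" "s \<in> RR" by (rule series_on_shift[OF v(2)])
    obtain q where q: "w = tpow (\<gamma> * a3) * q" "q \<in> RR" by (rule series_on_shift[OF w])
    have "x \<in> J" if J: "ideal J R" "?T \<subseteq> J" for J
    proof -
      have Jm: "Rmod J" using J(1) by (simp add: ideal_iff)
      have "r * tpow (\<alpha> * a1) \<in> J" "s * tpow (\<beta> * a2) \<in> J" "q * tpow (\<gamma> * a3) \<in> J"
        using J(2) by (auto intro!: RmodD(3)[OF Jm] r s q)
      then have "r * tpow (\<alpha> * a1) + (s * tpow (\<beta> * a2) + q * tpow (\<gamma> * a3)) \<in> J"
        by (intro RmodD(2)[OF Jm])
      then show ?thesis unfolding u(1) v(1) r(1) s(1) q(1) by (simp only: mult.commute)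
    qed
    then show "x \<in> Idl\<^bsub>R\<^esub> ?T" unfolding genideal_def by blast
  qed
qed

text \<open>
  The elements that multiply \<open>\<cc>\<close> into itself form a ring that contains \<open>R\<close> and \<open>K\<close>. The other inclusion
  only tests the elements \<open>1\<close> and \<open>t\<^sup>a\<close> of \<open>R[K]\<close>.
\<close>

lemma colon_eq_CC:
  assumes a: "3 * shift \<in> H"
  shows "colon R (ring_adjoin R K) = CC"
proof
  have fls_ring [simp]: "mult (fls_ring :: 'k fls ring) = (*)" "add (fls_ring :: 'k fls ring) = (+)"
    "one (fls_ring :: 'k fls ring) = 1" "zero (fls_ring :: 'k fls ring) = 0" "carrier (fls_ring :: 'k fls ring) = UNIV"
    by (simp_all add: fls_ring_def)
  have neg: "\<ominus>\<^bsub>fls_ring\<^esub> x = - x" for x :: "'k fls"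
  proof -
    have "(THE y. x + y = 0 \<and> y + x = 0) = - x"
      by (rule the_equality) (simp, metis minus_unique)
    then show ?thesis by (simp add: a_inv_def m_inv_def)
  qed
  have "1 \<in> ring_adjoin R K" "ta \<in> ring_adjoin R K"
    using ta_K by (auto simp: ring_adjoin_def intro: generate_ring.one[of fls_ring, simplified] generate_ring.incl)
  then show "colon R (ring_adjoin R K) \<subseteq> CC"
    by (force simp: colon_def CC_iff)
  have "\<forall>x\<in>CC. x * y \<in> CC" if "y \<in> ring_adjoin R K" for y
    using that unfolding ring_adjoin_def
  proof (induction rule: generate_ring.induct)
    case (incl y)
    then have "y \<in> K" using R_subset_K by auto
    then show ?case using ideal_times_K[OF Rmod_CC] IK_CC[OF a] by blast
  next
    case (eng_add y z) then show ?case using RmodD(2)[OF Rmod_CC] by (simp add: distrib_left)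
  next
    case (eng_mult y z) then show ?case by (simp flip: mult.assoc)
  qed (use RmodD(4)[OF Rmod_CC] in \<open>auto simp: neg\<close>)
  moreover have "x \<in> fraction_set R" if "x \<in> RR" for x
    unfolding fraction_set_def using that zero_in by (intro CollectI exI[of _ x] exI[of _ 1]) simp
  ultimately show "CC \<subseteq> colon R (ring_adjoin R K)"
    using CC_subset by (auto simp: colon_def)
qed

lemma length_R_CC: "mod_length R (quot_module (self_module R) CC) = enat (nat \<alpha> * nat \<beta> * nat \<gamma>)"
proof -
  have "submodule CC R (fls_module RR)" using submodule_fls_iff[OF Rmod_R] Rmod_CC CC_subset by blast
  then have "mod_length R (quot_module (fls_module RR) CC) = mod_length_above R (fls_module RR) {x \<in> RR. x \<in> CC}"
    by (rule mod_length_quot[OF Rmod_R identity_surj[OF Rmod_R]])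
  also have "{x \<in> RR. x \<in> CC} = series_on conductor_set" using CC_subset CC_def by auto
  also have "mod_length_above R (fls_module RR) (series_on conductor_set) = enat (card (H - conductor_set))"
  proof (rule mod_length_above_monomial)
    show "{pf2 + 1..} \<subseteq> conductor_set" using conductor_set_high by auto
    have "H - conductor_set \<subseteq> {0..pf2}"
      using conductor_set_high semigroup_nonneg by (force simp: not_less[symmetric])
    then show "finite (H - conductor_set)" by (rule finite_subset) simp
  qed (use conductor_set_subset conductor_set_add plus_in in auto)
  finally show ?thesis by (simp add: self_module_eq card_outside_conductor)
qed

end

section \<open>The canonical ideal and the three conditions\<close>

text \<open>
  The sum that defines the canonical ideal has two terms, one for each pseudo-Frobenius number; their
  exponents are \<open>0\<close> and \<open>a\<close>.
\<close>

lemma canonical_ideal_eq: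
  fixes a1 a2 a3 :: nat and R :: "'k::field fls ring"
  assumes "herzog_ring (int a1) (int a2) (int a3) \<alpha> \<beta> \<gamma> \<alpha>' \<beta>' \<gamma>' R"
  shows "canonical_ideal a1 a2 a3 = (herzog_ring.K (int a1) (int a2) (int a3) \<alpha> \<beta>' :: 'k fls set)"
    and "num_semigroup a1 a2 a3 = herzog_relations.H (int a1) (int a2) (int a3)"
proof -
  interpret herzog_ring "int a1" "int a2" "int a3" \<alpha> \<beta> \<gamma> \<alpha>' \<beta>' \<gamma>' R by fact
  show H: "num_semigroup a1 a2 a3 = H"
  proof (intro equalityI subsetI)
    fix h assume "h \<in> num_semigroup a1 a2 a3"
    then obtain x y z where "h = int x * int a1 + int y * int a2 + int z * int a3"
      by (auto simp: num_semigroup_def)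
    then show "h \<in> H" by (simp only:) (rule semigroupI; simp)
  next
    fix h assume "h \<in> H"
    then obtain x y z where "h = x * int a1 + y * int a2 + z * int a3" "0 \<le> x" "0 \<le> y" "0 \<le> z"
      by (auto simp: H_def)
    then have "h = int (nat x * a1 + nat y * a2 + nat z * a3)" by simp
    then show "h \<in> num_semigroup a1 a2 a3" unfolding num_semigroup_def by blast
  qed
  have P: "pseudo_frobenius a1 a2 a3 = {pf1, pf2}"
    unfolding pseudo_frobenius_def Let_def H by (rule pseudo_frobenius_eq)
  have F: "frobenius_number H = pf2"
    unfolding frobenius_number_def using pf2_notin above_frobenius
    by (intro Greatest_equality) (auto simp: not_less[symmetric])
  have ne: "pf1 \<noteq> pf2" using pf2_eq shift_pos by simp
  have "(\<Sum>c\<in>{pf1, pf2}. r c * tpow (pf2 - c)) = r pf1 * tpow shift + r pf2" for r :: "int \<Rightarrow> 'k fls"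
  proof -
    have "pf2 - pf1 = shift" by (simp add: pf2_eq)
    then show ?thesis using ne by (simp only: sum.insert sum.empty finite.intros insert_iff empty_iff simp_thms) simp
  qed
  then have eq: "canonical_ideal a1 a2 a3 = {r pf1 * tpow shift + r pf2 | r :: int \<Rightarrow> 'k fls. r pf1 \<in> RR \<and> r pf2 \<in> RR}"
    unfolding canonical_ideal_def Let_def P H F by (simp flip: ring_eq)
  show "canonical_ideal a1 a2 a3 = K"
  proof (intro equalityI subsetI)
    fix x :: "'k fls" assume "x \<in> canonical_ideal a1 a2 a3"
    then show "x \<in> K" unfolding eq using K_intro by (auto simp: add.commute)
  next
    fix x :: "'k fls" assume "x \<in> K"
    then obtain r s where "r \<in> RR" "s \<in> RR" "x = r + s * ta" by (rule K_obtain)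
    then show "x \<in> canonical_ideal a1 a2 a3" unfolding eq mem_Collect_eq using ne
      by (intro exI[of _ "\<lambda>c. if c = pf1 then s else r"]) (simp add: add.commute)
  qed
qed

theorem theorem5p8:
  fixes a1 a2 a3 \<alpha> \<beta> \<gamma> \<alpha>' \<beta>' \<gamma>' :: nat
    and a :: int
    and H :: "int set"
    and R :: "'k::field fls ring"
    and K \<cc> :: "'k fls set"
  assumes "0 < a1" "0 < a2" "0 < a3"
    and "gcd a1 (gcd a2 a3) = 1"
    and H_def: "H = num_semigroup a1 a2 a3"
    and R_def: "R = semigroup_ring H"
    and not_gorenstein: "\<not> gorenstein_local TYPE('k fls set) R"
    and "0 < \<alpha>" "0 < \<beta>" "0 < \<gamma>" "0 < \<alpha>'" "0 < \<beta>'" "0 < \<gamma>'"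
    and kernel: "{F :: 'k poly poly poly. toric_map a1 a2 a3 F = 0} =
       minors_ideal (varX ^ \<alpha>) (varY ^ \<beta>) (varZ ^ \<gamma>)
                    (varY ^ \<beta>') (varZ ^ \<gamma>') (varX ^ \<alpha>')"
    and a_def: "a = int a2 * int \<beta>' - int a1 * int \<alpha>"
    and "0 < a"
    and K_def: "K = canonical_ideal a1 a2 a3"
    and c_def: "\<cc> = colon R (ring_adjoin R K)"
  shows "a = int a3 * int \<gamma>' - int a2 * int \<beta> \<and> a = int a1 * int \<alpha>' - int a3 * int \<gamma> \<and>
    (ggl_ring R (fls_module K) \<longleftrightarrow> 3 * a \<in> H) \<and>
    (3 * a \<in> H \<longleftrightarrow> \<alpha> \<le> \<alpha>' \<and> \<beta> \<le> \<beta>' \<and> \<gamma> \<le> \<gamma>') \<and>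
    (ggl_ring R (fls_module K) \<longrightarrow>
       \<cc> = Idl\<^bsub>R\<^esub> {tpow (int \<alpha> * int a1), tpow (int \<beta> * int a2), tpow (int \<gamma> * int a3)} \<and>
       mod_length R (quot_module (self_module R) \<cc>) = enat (\<alpha> * \<beta> * \<gamma>))"
proof -
  interpret L: herzog_relations "int a1" "int a2" "int a3" "int \<alpha>" "int \<beta>" "int \<gamma>" "int \<alpha>'" "int \<beta>'" "int \<gamma>'"
    by (rule herzog_relations_from_kernel) fact+
  have shift: "L.shift = a" by (simp add: L.shift_def a_def mult.commute)
  have bezout: "\<exists>x y z. x * int a1 + y * int a2 + z * int a3 = 1"
  proof -
    obtain u v where 1: "u * int a2 + v * int a3 = gcd (int a2) (int a3)" using bezout_int by blast
    obtain x w where 2: "x * int a1 + w * gcd (int a2) (int a3) = gcd (int a1) (gcd (int a2) (int a3))"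
      using bezout_int by blast
    have "gcd (int a1) (gcd (int a2) (int a3)) = int (gcd a1 (gcd a2 a3))" by simp
    then have "gcd (int a1) (gcd (int a2) (int a3)) = 1" using assms(4) by simp
    then have "x * int a1 + w * u * int a2 + w * v * int a3 = 1" using 2 unfolding 1[symmetric]
      by (simp add: algebra_simps)
    then show ?thesis by blast
  qed
  interpret L: herzog_semigroup "int a1" "int a2" "int a3" "int \<alpha>" "int \<beta>" "int \<gamma>" "int \<alpha>'" "int \<beta>'" "int \<gamma>'"
    using bezout \<open>0 < a\<close> shift by unfold_locales auto
  have H: "H = L.H"
  proof -
    interpret R0: herzog_ring "int a1" "int a2" "int a3" "int \<alpha>" "int \<beta>" "int \<gamma>" "int \<alpha>'" "int \<beta>'" "int \<gamma>'"
      "semigroup_ring L.H :: 'k fls ring" by unfold_locales simp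
    show ?thesis unfolding H_def by (rule canonical_ideal_eq(2)[OF R0.herzog_ring_axioms])
  qed
  interpret L: herzog_ring "int a1" "int a2" "int a3" "int \<alpha>" "int \<beta>" "int \<gamma>" "int \<alpha>'" "int \<beta>'" "int \<gamma>'" R
    using R_def H by unfold_locales simp
  have K: "K = L.K" unfolding K_def by (rule canonical_ideal_eq(1)[OF L.herzog_ring_axioms])
  have ggl: "ggl_ring R (fls_module K) \<longleftrightarrow> 3 * a \<in> H"
    using L.ggl_imp_three_shift L.three_shift_imp_ggl unfolding K H shift by blast
  have three: "3 * a \<in> H \<longleftrightarrow> \<alpha> \<le> \<alpha>' \<and> \<beta> \<le> \<beta>' \<and> \<gamma> \<le> \<gamma>'"
    using L.three_shift_iff unfolding H shift by simp
  have conductor: "\<cc> = Idl\<^bsub>R\<^esub> {tpow (int \<alpha> * int a1), tpow (int \<beta> * int a2), tpow (int \<gamma> * int a3)}"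
    "mod_length R (quot_module (self_module R) \<cc>) = enat (\<alpha> * \<beta> * \<gamma>)" if "3 * a \<in> H"
    using L.colon_eq_CC L.Idl_monomials L.length_R_CC that unfolding c_def K H shift by simp_all
  show ?thesis
    using L.shift_eqs ggl three conductor unfolding shift by (simp add: mult.commute)
qed

end
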